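(* Let $n\ge 2$, let $f:\mathbb{R}^n\to\mathbb{R}^n$ be quasiregular of polynomial type and let $S>1$. Then \[ \limsup_{r\to\infty} \frac{M(Sr,f)}{M(r,f)} < \infty. \]
   Context: A continuous mapping $f:\mathbb{R}^n\to\mathbb{R}^n$ is called quasiregular if it belongs to the Sobolev space $W^1_{n,\mathrm{loc}}(\mathbb{R}^n)$ and there exists $K\in[1,\infty)$ such that $|f'(x)|^n\le K J_f(x)$ for almost every $x\in \mathbb{R}^n$, where $|f'(x)|$ is the operator norm of the derivative and $J_f(x)$ is the Jacobian determinant. A non-constant quasiregular mapping $f:\mathbb{R}^n\to\mathbb{R}^n$ is of polynomial type if $|f(x)|\to\infty$ as $|x|\to\infty$. The maximum modulus is $M(r,f)=\sup_{|x|=r}|f(x)|$. *)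

theory Defs
  imports "HOL-Analysis.Analysis"
begin

definition partial_deriv :: "'n::finite \<Rightarrow> (real^'n \<Rightarrow> real) \<Rightarrow> real^'n \<Rightarrow> real" where
  "partial_deriv j \<phi> = (\<lambda>x. frechet_derivative \<phi> (at x) (axis j 1))"

fun C_k :: "nat \<Rightarrow> (real^'n::finite \<Rightarrow> real) \<Rightarrow> bool" where
  "C_k 0 \<phi> \<longleftrightarrow> continuous_on UNIV \<phi>"
| "C_k (Suc k) \<phi> \<longleftrightarrow>
     (\<forall>x. \<phi> differentiable (at x)) \<and> (\<forall>j. C_k k (partial_deriv j \<phi>))"

definition test_function :: "(real^'n::finite \<Rightarrow> real) \<Rightarrow> bool" where
  "test_function \<phi> \<longleftrightarrow> (\<forall>k. C_k k \<phi>) \<and> compact (closure {x. \<phi> x \<noteq> 0})"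

definition Lp_loc :: "real \<Rightarrow> (real^'n::finite \<Rightarrow> real) set" where
  "Lp_loc p = {u. u \<in> borel_measurable lebesgue \<and>
     (\<forall>C. compact C \<longrightarrow> set_integrable lebesgue C (\<lambda>x. \<bar>u x\<bar> powr p))}"

definition weak_partial_deriv ::
    "'n::finite \<Rightarrow> (real^'n \<Rightarrow> real) \<Rightarrow> (real^'n \<Rightarrow> real) \<Rightarrow> bool" where
  "weak_partial_deriv j u g \<longleftrightarrow> u \<in> Lp_loc 1 \<and> g \<in> Lp_loc 1 \<and>
     (\<forall>\<phi>. test_function \<phi> \<longrightarrow>
        (LINT x|lebesgue. u x * partial_deriv j \<phi> x) = - (LINT x|lebesgue. g x * \<phi> x))"

text \<open>\<open>D x\<close> is the matrix of the weak derivative of \<open>f\<close>: row \<open>i\<close> is the weak gradient of the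
  \<open>i\<close>-th component. It is determined by \<open>f\<close> up to a null set.\<close>

definition weak_jacobian ::
    "(real^'n::finite \<Rightarrow> real^'m::finite) \<Rightarrow> (real^'n \<Rightarrow> real^'n^'m) \<Rightarrow> bool" where
  "weak_jacobian f D \<longleftrightarrow>
     (\<forall>i j. weak_partial_deriv j (\<lambda>x. f x $ i) (\<lambda>x. D x $ i $ j))"

definition W1_loc :: "real \<Rightarrow> (real^'n::finite \<Rightarrow> real^'m::finite) set" where
  "W1_loc p = {f. (\<forall>i. (\<lambda>x. f x $ i) \<in> Lp_loc p) \<and>
     (\<exists>D. weak_jacobian f D \<and> (\<forall>i j. (\<lambda>x. D x $ i $ j) \<in> Lp_loc p))}"

text \<open>Since the weak derivative is unique up to a null set and the distortion inequality is only
  required almost everywhere, it does not matter which representative \<open>D\<close> is used below.\<close>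

definition quasiregular :: "(real^'n::finite \<Rightarrow> real^'n) \<Rightarrow> bool" where
  "quasiregular f \<longleftrightarrow> continuous_on UNIV f \<and> f \<in> W1_loc (real CARD('n)) \<and>
     (\<exists>K\<ge>1. \<exists>D. weak_jacobian f D \<and>
        (AE x in lebesgue. onorm (\<lambda>v. D x *v v) ^ CARD('n) \<le> K * det (D x)))"

definition polynomial_type :: "(real^'n::finite \<Rightarrow> real^'n) \<Rightarrow> bool" where
  "polynomial_type f \<longleftrightarrow> quasiregular f \<and> \<not> f constant_on UNIV \<and>
     filterlim (\<lambda>x. norm (f x)) at_top at_infinity"

definition max_modulus :: "real \<Rightarrow> (real^'n::finite \<Rightarrow> real^'n) \<Rightarrow> real" where
  "max_modulus r f = (SUP x\<in>sphere 0 r. norm (f x))"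

end

theory Submission imports Defs
begin

text \<open>Fix a radius \<open>r\<close> and write \<open>A = M(r,f)\<close>, \<open>B = M(Sr,f)\<close>. If \<open>B\<close> is about \<open>2\<^sup>N A\<close>, then a function that
grows like \<open>log |f|\<close> oscillates by \<open>N\<close> between the sphere \<open>|x| = r\<close> and a point \<open>x\<^sub>0\<close> with \<open>|x\<^sub>0| = Sr\<close> and
\<open>|f(x\<^sub>0)| = B\<close>. Two estimates for the conformally invariant energy, the integral of the \<open>n\<close>-th power of
its gradient, then contradict each other when \<open>N\<close> is large.

\<^item> Lower bound (\<open>loewner_cubes\<close>). By the maximum principle the boundary of every cube centred at \<open>x\<^sub>0\<close>
  contains a point with \<open>|f| \<ge> B\<close>, and for an interval of cube sizes comparable to \<open>r\<close> it meets the sphere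
  \<open>|x| = r\<close>, where \<open>|f| \<le> A\<close>. So the function oscillates by \<open>N\<close> on each of these boundaries. The faces
  have dimension \<open>n - 1 < n\<close>, so Morrey's inequality on the faces, integrated over the sizes of the cubes,
  bounds the energy from below by a constant times \<open>N\<^sup>n\<close>.

\<^item> Upper bound (\<open>degree_energy_bound\<close>). The distortion inequality bounds the energy by the integral of
  \<open>\<kappa>(f) J\<^sub>f\<close> for a weight \<open>\<kappa>\<close> that is a sum of \<open>N\<close> terms, one for each dyadic range of values of \<open>|f|\<close>. Since
  \<open>|f|\<close> tends to infinity, each term contributes what a fixed multiple of the degree of \<open>f\<close> would
  contribute, hence a constant times \<open>N\<close> altogether.

Hence \<open>N\<^sup>n \<le> C N\<close> with \<open>C\<close> independent of \<open>r\<close>, and \<open>N\<close> is bounded because \<open>n \<ge> 2\<close>.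

Degree theory enters only through one identity: if two \<open>C\<^sup>1\<close> maps \<open>P\<^sub>1\<close> and \<open>P\<^sub>2\<close> of the target agree near the
image of the boundary of a cube, then \<open>P\<^sub>1 \<circ> f\<close> and \<open>P\<^sub>2 \<circ> f\<close> have the same integral of the Jacobian over the
cube (\<open>degree_identity_sobolev\<close>). For \<open>C\<^sup>1\<close> maps \<open>f\<close> it follows from Milnor's observation that the volume of
the image under \<open>x + t v(x)\<close> is a polynomial in \<open>t\<close> and is constant for small \<open>t\<close>. It passes to Sobolev maps by
mollification. With suitable radial maps \<open>P\<^sub>i\<close> it yields the upper bound above, and also the maximum principle.\<close>

hide_const (open) Polynomial.content

section \<open>The integral of a Jacobian of compact support\<close>

text \<open>The derivative is carried along as a matrix field, so that Jacobian determinants and their continuity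
can be written without \<open>frechet_derivative\<close>.\<close>

definition C1_with :: "(real^'n::finite \<Rightarrow> real^'m::finite) \<Rightarrow> (real^'n \<Rightarrow> real^'n^'m) \<Rightarrow> bool" where
  "C1_with g G \<longleftrightarrow> (\<forall>x. (g has_derivative (\<lambda>h. G x *v h)) (at x)) \<and> continuous_on UNIV G"

lemma C1_withD:
  assumes "C1_with g G"
  shows "(g has_derivative (\<lambda>h. G x *v h)) (at x)" "continuous_on UNIV G" "continuous_on UNIV g"
proof -
  show "(g has_derivative (\<lambda>h. G x *v h)) (at x)" for x using assms by (auto simp: C1_with_def)
  then show "continuous_on UNIV g"
    by (meson continuous_at_imp_continuous_on has_derivative_continuous)
  show "continuous_on UNIV G" using assms by (auto simp: C1_with_def)
qed

text \<open>The point of this expansion is that \<open>det (s I + A)\<close> is visibly a polynomial in \<open>s\<close> whose coefficients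
are polynomials in the entries of \<open>A\<close>, so that it may be integrated coefficient by coefficient.\<close>

lemma det_mat_add_expand:
  fixes A :: "real^'n::finite^'n"
  shows "det (mat s + A) = (\<Sum>p\<in>{p. p permutes (UNIV::'n set)}. \<Sum>J\<in>Pow UNIV.
     s ^ card J * (of_int (sign p) * (\<Prod>i\<in>J. if i = p i then 1 else 0) * (\<Prod>i\<in>UNIV-J. A$i$p i)))"
proof -
  have "(\<Prod>i\<in>UNIV. (mat s + A)$i$p i) = (\<Sum>J\<in>Pow UNIV. s ^ card J * ((\<Prod>i\<in>J. if i = p i then 1 else 0) * (\<Prod>i\<in>UNIV-J. A$i$p i)))" for p :: "'n \<Rightarrow> 'n"
  proof -
    have "(\<Prod>i\<in>UNIV. (mat s + A)$i$p i) = (\<Prod>i\<in>UNIV. s * (if i = p i then 1 else 0) + A$i$p i)"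
      by (intro prod.cong) (auto simp: mat_def)
    also have "\<dots> = (\<Sum>J\<in>Pow UNIV. (\<Prod>i\<in>J. s * (if i = p i then 1 else 0)) * (\<Prod>i\<in>UNIV-J. A$i$p i))"
      by (rule prod_add) simp
    finally show ?thesis by (simp add: prod.distrib mult.assoc)
  qed
  then show ?thesis
    unfolding det_def by (simp add: sum_distrib_left mult_ac)
qed

lemma det_mat_scalar: "det (mat s :: real^'n::finite^'n) = s ^ CARD('n)"
  by (subst det_diagonal) (auto simp: mat_def)

lemma mat_vector_mult: "mat s *v (h::real^'n::finite) = s *\<^sub>R h"
  by (simp add: vec_eq_iff matrix_vector_mult_def mat_def if_distrib if_distribR cong: if_cong)

lemma continuous_on_det [continuous_intros]:
  fixes A :: "'a::topological_space \<Rightarrow> real^'n::finite^'n"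
  assumes "continuous_on S A" shows "continuous_on S (\<lambda>x. det (A x))"
  unfolding det_def by (intro continuous_intros assms)

text \<open>Outside the support the derivative vanishes and on the support it is bounded by compactness, so the
mean value inequality gives a global Lipschitz constant.\<close>

lemma C1_with_compact_support_bound:
  fixes v :: "real^'n::finite \<Rightarrow> real^'n"
  assumes v: "C1_with v V" and supp: "\<And>x. x \<notin> cbox a b \<Longrightarrow> v x = 0"
  obtains L where "L > 0" "\<And>x. onorm (\<lambda>h. V x *v h) \<le> L" "\<And>x y. norm (v x - v y) \<le> L * norm (x - y)"
proof -
  have "compact (V ` cbox a b)"
    by (intro compact_continuous_image compact_cbox continuous_on_subset[OF C1_withD(2)[OF v]]) auto
  then obtain M where M: "\<And>x. x \<in> cbox a b \<Longrightarrow> norm (V x) \<le> M"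
    by (meson bounded_iff compact_imp_bounded imageI)
  have V0: "V x = 0" if "x \<notin> cbox a b" for x
  proof -
    have "(v has_derivative (\<lambda>h. 0)) (at x)"
    proof (rule has_derivative_transform_within_open)
      show "((\<lambda>x. 0) has_derivative (\<lambda>h. 0)) (at x)" by simp
      show "open (- cbox a b)" by (simp add: closed_cbox open_Compl)
    qed (use that supp in auto)
    then have "(\<lambda>h. V x *v h) = (\<lambda>h. 0)" 
      using C1_withD(1)[OF v] has_derivative_unique by blast
    then show ?thesis by (metis matrix_eq matrix_vector_mult_0)
  qed
  define L where "L = max 1 (real CARD('n) * real CARD('n) * max M 0)"
  have on: "onorm (\<lambda>h. V x *v h) \<le> L" for x
  proof -
    have "norm (V x) \<le> max M 0" using M[of x] V0[of x] by (cases "x \<in> cbox a b") auto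
    then have "\<bar>V x $ i $ j\<bar> \<le> max M 0" for i j
      using component_le_norm_cart[of "V x $ i" j] Finite_Cartesian_Product.norm_nth_le[of "V x" i] by linarith
    from onorm_le_matrix_component[OF this] show ?thesis unfolding L_def by simp
  qed
  have "norm (v x - v y) \<le> L * norm (x - y)" for x y
    by (rule differentiable_bound[OF convex_UNIV])
      (use on C1_withD(1)[OF v] in auto)
  with on show ?thesis by (intro that[of L]) (auto simp: L_def)
qed

text \<open>For \<open>s\<close> above the Lipschitz constant of \<open>v\<close> the map \<open>x \<mapsto> s x + v(x)\<close> is a bijection of the whole space, by
the contraction principle, and it equals \<open>s x\<close> outside the cube. It therefore maps the cube onto its dilate by
\<open>s\<close>, and the change of variables formula evaluates the integral of its Jacobian. The
order on the index type is an auxiliary structure for that formula; \<open>integral_det_compact_support\<close> removes it.\<close>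

lemma integral_det_shift_wellorder:
  fixes v :: "real^'n::{finite,wellorder} \<Rightarrow> real^'n::_"
  assumes v: "C1_with v V" and supp: "\<And>x. x \<notin> cbox a b \<Longrightarrow> v x = 0"
    and L: "L > 0" "\<And>x. onorm (\<lambda>h. V x *v h) \<le> L" "\<And>x y. norm (v x - v y) \<le> L * norm (x - y)"
    and s: "s > L"
  shows "integral (cbox a b) (\<lambda>x. det (mat s + V x)) = s ^ CARD('n) * measure lebesgue (cbox a b)"
proof -
  define f where "f x = s *\<^sub>R x + v x" for x
  let ?S = "cbox a b"
  have s0: "s > 0" using L s by simp
  have der: "(f has_derivative (\<lambda>h. (mat s + V x) *v h)) (at x)" for x
    unfolding f_def[abs_def] matrix_vector_mult_add_rdistrib mat_vector_mult
    by (intro derivative_intros C1_withD(1)[OF v])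
  have inj: "x = y" if "f x = f y" for x y
  proof (rule ccontr)
    assume ne: "x \<noteq> y"
    have "s *\<^sub>R (x - y) = - (v x - v y)" using that by (simp add: f_def algebra_simps) 
    then have "s * norm (x - y) = norm (v x - v y)"
      by (metis abs_of_pos norm_minus_cancel norm_scaleR s0)
    with L(3)[of x y] have "s * norm (x-y) \<le> L * norm (x - y)" by simp
    with ne s show False by auto
  qed
  have im: "f ` ?S = (\<lambda>x. s *\<^sub>R x) ` ?S"
  proof safe
    fix x assume x: "x \<in> ?S"
    show "f x \<in> (\<lambda>x. s *\<^sub>R x) ` ?S"
    proof (rule ccontr)
      assume *: "f x \<notin> (\<lambda>x. s *\<^sub>R x) ` ?S"
      define y where "y = f x /\<^sub>R s"
      have y: "f x = s *\<^sub>R y" using s0 by (simp add: y_def)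
      then have "y \<notin> ?S" using * by auto
      then have "f y = f x" using supp y by (simp add: f_def)
      then show False using inj x \<open>y \<notin> ?S\<close> by auto
    qed
  next
    fix y assume y: "y \<in> ?S"
    have "\<exists>!x. y - v x /\<^sub>R s = x"
    proof (rule banach_fix_type)
      show "0 \<le> L / s" "L / s < 1" using L s s0 by auto
      show "\<forall>x z. dist (y - v x /\<^sub>R s) (y - v z /\<^sub>R s) \<le> L / s * dist x z"
      proof safe
        fix x z
        have "dist (y - v x /\<^sub>R s) (y - v z /\<^sub>R s) = norm (v z - v x) / s"
          using s0 by (simp add: dist_norm divide_inverse_commute flip: scaleR_diff_right)
        also have "\<dots> \<le> L * norm (z - x) / s" using L(3)[of z x] s0 by (intro divide_right_mono) auto
        finally show "dist (y - v x /\<^sub>R s) (y - v z /\<^sub>R s) \<le> L / s * dist x z"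
          by (simp add: dist_norm norm_minus_commute)
      qed
    qed
    then obtain x where x: "y - v x /\<^sub>R s = x" by auto
    have "f x = s *\<^sub>R y" unfolding f_def using s0 by (subst (1) x[symmetric]) (simp add: algebra_simps)
    moreover have "x \<in> ?S"
    proof (rule ccontr)
      assume "x \<notin> ?S" 
      then show False using supp x y by auto
    qed
    ultimately show "s *\<^sub>R y \<in> f ` ?S" by (metis imageI)
  qed
  have pos: "det (mat s + V x) > 0" for x
  proof -
    \<comment> \<open>Along the segment from \<open>s I\<close> to \<open>s I + V x\<close> the determinant has no zero, so it keeps its sign.\<close>
    have nz: "det (mat s + t *\<^sub>R V x) \<noteq> 0" if t: "0 \<le> t" "t \<le> 1" for t
    proof
      assume "det (mat s + t *\<^sub>R V x) = 0"
      then obtain h where h: "h \<noteq> 0" "(mat s + t *\<^sub>R V x) *v h = 0"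
        by (metis invertible_det_nz invertible_left_inverse matrix_left_invertible_ker)
      have "s *\<^sub>R h = - (t *\<^sub>R (V x *v h))" 
        using h(2) by (simp add: matrix_vector_mult_add_rdistrib mat_vector_mult eq_neg_iff_add_eq_0 scaleR_matrix_vector_assoc)
      then have "s * norm h = t * norm (V x *v h)" using t s0
        by (metis abs_of_nonneg less_eq_real_def norm_minus_cancel norm_scaleR)
      also have "\<dots> \<le> 1 * (L * norm h)"
      proof (intro mult_mono)
        have "norm (V x *v h) \<le> onorm (\<lambda>h. V x *v h) * norm h" 
          by (rule onorm) (simp add: matrix_vector_mul_bounded_linear)
        also have "\<dots> \<le> L * norm h" using L(2) by (intro mult_right_mono) auto
        finally show "norm (V x *v h) \<le> L * norm h" .
      qed (use t in auto)
      finally show False using h(1) s by auto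
    qed
    have cont: "continuous_on {0..1} (\<lambda>t. det (mat s + t *\<^sub>R V x))" by (intro continuous_intros)
    show ?thesis
    proof (rule ccontr)
      assume "\<not> ?thesis"
      then have "\<exists>t\<ge>0. t \<le> 1 \<and> det (mat s + t *\<^sub>R V x) = 0"
        by (intro IVT2') (use cont s0 in \<open>auto simp: det_mat_scalar\<close>)
      then show False using nz by blast
    qed
  qed
  have mf: "matrix (\<lambda>h. (mat s + V x) *v h) = mat s + V x" for x by simp
  have contdet: "continuous_on ?S (\<lambda>x. det (mat s + V x))"
    by (intro continuous_intros continuous_on_subset[OF C1_withD(2)[OF v]]) auto
  have "measure lebesgue (f ` ?S) = integral ?S (\<lambda>x. \<bar>det (matrix (\<lambda>h. (mat s + V x) *v h))\<bar>)"
  proof (rule measure_differentiable_image_eq)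
    show "(f has_derivative (\<lambda>h. (mat s + V x) *v h)) (at x within ?S)" for x
      using der has_derivative_at_withinI by blast
    show "(\<lambda>x. \<bar>det (matrix (\<lambda>h. (mat s + V x) *v h))\<bar>) integrable_on ?S"
      unfolding mf by (intro integrable_continuous continuous_intros contdet)
  qed (use inj in \<open>auto simp: inj_on_def\<close>)
  also have "\<dots> = integral ?S (\<lambda>x. det (mat s + V x))"
    unfolding mf using pos by (simp add: abs_of_pos)
  moreover have ms: "matrix (\<lambda>x::real^'n::{finite,wellorder}. s *\<^sub>R x) = mat s"
    by (metis (no_types) matrix_of_matrix_vector_mul mat_vector_mult ext)
  ultimately have "integral ?S (\<lambda>x. det (mat s + V x)) = measure lebesgue ((\<lambda>x. s *\<^sub>R x) ` ?S)"
    using im by simp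
  also have "\<dots> = s ^ CARD('n) * measure lebesgue ?S"
    using s0 measure_linear_image[of "\<lambda>x. s *\<^sub>R x" ?S] ms by (simp add: det_mat_scalar linear_scaleR)
  finally show ?thesis .
qed

text \<open>Milnor's argument: the integral of \<open>det (s I + V)\<close> minus the volume of the dilated cube is a polynomial in
\<open>s\<close> that vanishes for all large \<open>s\<close>, hence also at \<open>s = 0\<close>.\<close>

lemma integral_det_compact_support_wellorder:
  fixes v :: "real^'n::{finite,wellorder} \<Rightarrow> real^'n::_"
  assumes v: "C1_with v V" and supp: "\<And>x. x \<notin> cbox a b \<Longrightarrow> v x = 0"
  shows "integral (cbox a b) (\<lambda>x. det (V x)) = 0"
proof -
  obtain L where L: "L > 0" "\<And>x. onorm (\<lambda>h. V x *v h) \<le> L" "\<And>x y. norm (v x - v y) \<le> L * norm (x - y)"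
    using C1_with_compact_support_bound[OF v supp] by blast
  let ?S = "cbox a b"
  let ?c = "\<lambda>p J A. of_int (sign p) * (\<Prod>i\<in>J. if i = p i then 1 else 0) * (\<Prod>i\<in>UNIV-J. A$i$p i) :: real"
  define P where "P = (\<Sum>p\<in>{p. p permutes (UNIV::'n set)}. \<Sum>J\<in>Pow UNIV. monom (integral ?S (\<lambda>x. ?c p J (V x))) (card J))
      - monom (measure lebesgue ?S) CARD('n)"
  have int: "(\<lambda>x. ?c p J (V x)) integrable_on ?S" for p J
    by (intro integrable_continuous continuous_intros continuous_on_subset[OF C1_withD(2)[OF v]]) auto
  have P: "poly P s = integral ?S (\<lambda>x. det (mat s + V x)) - s ^ CARD('n) * measure lebesgue ?S" for s
    unfolding det_mat_add_expand P_def
    by (subst integral_sum integral_mult_right | intro integrable_sum int integrable_on_mult_right finite_permutations finite ballI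
       | simp add: poly_sum poly_monom finite_permutations mult.commute)+
  have "poly P s = 0" if "s > L" for s
    using integral_det_shift_wellorder[OF v supp L that] P by simp
  then have "{L<..} \<subseteq> {s. poly P s = 0}" by auto
  then have "P = 0" using infinite_Ioi[of L] poly_roots_finite[of P] finite_subset by blast
  then have "poly P 0 = 0" by simp
  then show ?thesis unfolding P by (simp add: mat_def zero_vec_def[symmetric] if_distrib) 
qed

text \<open>A well-ordered copy of an arbitrary finite index type, through which the preceding lemma is transported to all
finite index types.\<close>

typedef ('n::finite) ord_index = "{..<CARD('n)}"
  morphisms index_nat nat_index
  using finite_UNIV_card_ge_0[where 'a='n] by (intro exI[of _ 0]) auto

lemma CARD_ord_index: "CARD('n::finite ord_index) = CARD('n)"
  using type_definition.card[OF type_definition_ord_index[where 'n='n]] by simp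

instance ord_index :: (finite) finite
proof
  show "finite (UNIV :: 'a ord_index set)"
    using CARD_ord_index[where 'n='a] by (intro card_ge_0_finite) (simp add: finite_UNIV_card_ge_0)
qed

instantiation ord_index :: (finite) wellorder
begin

definition less_eq_ord_index :: "'a ord_index \<Rightarrow> 'a ord_index \<Rightarrow> bool" where
  "less_eq_ord_index x y \<longleftrightarrow> index_nat x \<le> index_nat y"

definition less_ord_index :: "'a ord_index \<Rightarrow> 'a ord_index \<Rightarrow> bool" where
  "less_ord_index x y \<longleftrightarrow> index_nat x < index_nat y"

instance
proof
  fix P :: "'a ord_index \<Rightarrow> bool" and a
  assume step: "\<And>x. (\<And>y. y < x \<Longrightarrow> P y) \<Longrightarrow> P x"
  show "P a"
    by (induction "index_nat a" arbitrary: a rule: less_induct) (auto intro: step simp: less_ord_index_def)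
qed (auto simp: less_eq_ord_index_def less_ord_index_def index_nat_inject)

end

text \<open>Conjugation by a bijection turns transpositions into transpositions, so the number of factors in a
decomposition is preserved even when the two index types differ.\<close>

lemma sign_conjugate:
  fixes \<pi> :: "'m::finite \<Rightarrow> 'n::finite"
  assumes \<pi>: "bij \<pi>" and p: "p permutes UNIV"
  shows "sign (\<pi> \<circ> p \<circ> inv \<pi>) = sign p"
  using p finite_class.finite_UNIV
proof (induction p rule: permutes_induct)
  case id
  then show ?case using \<pi> by (simp add: bij_is_surj surj_f_inv_f)
next
  case (swap a b p)
  have ip: "inv \<pi> (\<pi> x) = x" for x using \<pi> by (simp add: bij_is_inj)
  have pi: "\<pi> (inv \<pi> y) = y" for y using \<pi> by (simp add: bij_is_surj surj_f_inv_f)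
  have eq: "\<pi> \<circ> (Transposition.transpose a b \<circ> p) \<circ> inv \<pi> = Transposition.transpose (\<pi> a) (\<pi> b) \<circ> (\<pi> \<circ> p \<circ> inv \<pi>)"
    using bij_is_inj[OF \<pi>] by (auto simp: fun_eq_iff Transposition.transpose_def inj_eq)
  have "bij (\<pi> \<circ> p \<circ> inv \<pi>)" 
    using \<pi> swap.hyps by (auto intro!: bij_comp bij_imp_bij_inv dest: permutes_bij)
  then have perm: "permutation (\<pi> \<circ> p \<circ> inv \<pi>)" by (simp add: permutation)
  have permp: "permutation p" using swap.hyps permutation_permutes finite_class.finite_UNIV by metis
  have "\<pi> a \<noteq> \<pi> b" using swap.hyps ip by metis
  then show ?case unfolding eq
    using swap.hyps swap.IH perm permp \<open>\<pi> a \<noteq> \<pi> b\<close> by (simp add: sign_compose sign_swap_id permutation_swap_id del: o_apply)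
qed

lemma det_reindex:
  fixes A :: "real^'n::finite^'n" and \<pi> :: "'m::finite \<Rightarrow> 'n"
  assumes \<pi>: "bij \<pi>"
  shows "det (\<chi> k l. A $ \<pi> k $ \<pi> l) = det A"
proof -
  have ip: "inv \<pi> (\<pi> x) = x" for x using \<pi> by (simp add: bij_is_inj)
  have pi: "\<pi> (inv \<pi> y) = y" for y using \<pi> by (simp add: bij_is_surj surj_f_inv_f)
  have bi: "bij (inv \<pi>)" using \<pi> by (rule bij_imp_bij_inv)
  have conj: "\<pi> \<circ> (inv \<pi> \<circ> q \<circ> \<pi>) \<circ> inv \<pi> = q" "inv \<pi> \<circ> (\<pi> \<circ> p \<circ> inv \<pi>) \<circ> \<pi> = p" for p q
    by (simp_all add: fun_eq_iff ip pi)
  have "det A = (\<Sum>p\<in>{p. p permutes (UNIV::'m set)}. of_int (sign (\<pi> \<circ> p \<circ> inv \<pi>)) * (\<Prod>i\<in>UNIV. A$i$(\<pi> \<circ> p \<circ> inv \<pi>) i))"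
    unfolding det_def
  proof (rule sum.reindex_bij_witness[where i="\<lambda>p. \<pi> \<circ> p \<circ> inv \<pi>" and j="\<lambda>q. inv \<pi> \<circ> q \<circ> \<pi>"])
    show "inv \<pi> \<circ> q \<circ> \<pi> \<in> {p. p permutes UNIV}" if "q \<in> {p. p permutes UNIV}" for q
      using that \<pi> bi by (auto intro!: bij_imp_permutes bij_comp dest: permutes_bij)
    show "\<pi> \<circ> p \<circ> inv \<pi> \<in> {p. p permutes UNIV}" if "p \<in> {p. p permutes UNIV}" for p
      using that \<pi> bi by (auto intro!: bij_imp_permutes bij_comp dest: permutes_bij)
  qed (simp_all only: conj)
  also have "\<dots> = (\<Sum>p\<in>{p. p permutes (UNIV::'m set)}. of_int (sign p) * (\<Prod>k\<in>UNIV. A$\<pi> k$\<pi> (p k)))"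
  proof (intro sum.cong refl)
    fix p :: "'m \<Rightarrow> 'm" assume "p \<in> {p. p permutes UNIV}"
    then have "sign (\<pi> \<circ> p \<circ> inv \<pi>) = sign p" using sign_conjugate[OF \<pi>] by simp
    moreover have "(\<Prod>i\<in>UNIV. A$i$(\<pi> \<circ> p \<circ> inv \<pi>) i) = (\<Prod>k\<in>UNIV. A$\<pi> k$\<pi> (p k))"
      using prod.reindex_bij_betw[of \<pi> UNIV UNIV "\<lambda>i. A$i$(\<pi> \<circ> p \<circ> inv \<pi>) i"] \<pi> by (simp add: ip)
    ultimately show "of_int (sign (\<pi> \<circ> p \<circ> inv \<pi>)) * (\<Prod>i\<in>UNIV. A$i$(\<pi> \<circ> p \<circ> inv \<pi>) i)
      = of_int (sign p) * (\<Prod>k\<in>UNIV. A$\<pi> k$\<pi> (p k))" by simp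
  qed
  finally show ?thesis unfolding det_def by simp
qed

lemma integral_reindex:
  fixes \<pi> :: "'m::finite \<Rightarrow> 'n::finite" and g :: "real^'n \<Rightarrow> real"
  assumes \<pi>: "bij \<pi>" and g: "g integrable_on cbox a b"
  shows "integral (cbox (\<chi> k. a $ \<pi> k) (\<chi> k. b $ \<pi> k)) (\<lambda>x. g (\<chi> i. x $ inv \<pi> i)) = integral (cbox a b) g"
proof -
  have ip: "inv \<pi> (\<pi> x) = x" for x using \<pi> by (simp add: bij_is_inj)
  have pi: "\<pi> (inv \<pi> y) = y" for y using \<pi> by (simp add: bij_is_surj surj_f_inv_f)
  let ?P = "\<lambda>x::real^'m. (\<chi> i. x $ inv \<pi> i)" and ?Q = "\<lambda>y::real^'n. (\<chi> k. y $ \<pi> k)"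
  have QP: "?Q (?P x) = x" for x by (simp add: vec_eq_iff ip)
  have PQ: "?P (?Q y) = y" for y by (simp add: vec_eq_iff pi)
  have imP: "?P ` cbox u v = cbox (?P u) (?P v)" for u v
  proof (intro set_eqI iffI)
    fix y assume "y \<in> cbox (?P u) (?P v)"
    then have "?Q y \<in> cbox u v" by (auto simp: mem_box_cart) (metis ip)+
    then show "y \<in> ?P ` cbox u v" using PQ by (metis imageI)
  qed (auto simp: mem_box_cart)
  have imQ: "?Q ` cbox u v = cbox (?Q u) (?Q v)" for u v
  proof (intro set_eqI iffI)
    fix y assume "y \<in> cbox (?Q u) (?Q v)"
    then have "?P y \<in> cbox u v" by (auto simp: mem_box_cart) (metis pi)+
    then show "y \<in> ?Q ` cbox u v" using QP by (metis imageI)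
  qed (auto simp: mem_box_cart)
  have content: "content (?P ` cbox u v) = content (cbox u v)" for u v
  proof (cases "cbox u v = {}")
    case False
    then have ne: "cbox (?P u) (?P v) \<noteq> {}" using imP[of u v] by auto
    show ?thesis
      unfolding imP content_cbox_cart[OF ne] content_cbox_cart[OF False]
      using prod.reindex_bij_betw[of "inv \<pi>" UNIV UNIV "\<lambda>k. v$k - u$k"] bij_imp_bij_inv[OF \<pi>] by simp
  qed simp
  have "((\<lambda>x. g (?P x)) has_integral (1 / 1) *\<^sub>R integral (cbox a b) g) (?Q ` cbox a b)"
  proof (rule has_integral_twiddle)
    show "continuous (at x) ?P" for x
      by (intro linear_continuous_at linear_conv_bounded_linear[THEN iffD1] linearI) (auto simp: vec_eq_iff)
    show "(g has_integral integral (cbox a b) g) (cbox a b)" using g by (rule integrable_integral)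
    show "\<exists>w z. ?P ` cbox u v = cbox w z" for u v using imP by blast
    show "\<exists>w z. ?Q ` cbox u v = cbox w z" for u v using imQ by blast
  qed (use QP PQ content in auto)
  then show ?thesis unfolding imQ by (simp add: integral_unique)
qed

text \<open>Renaming the coordinates conjugates the derivative and leaves both determinants and integrals over boxes
unchanged, so the statement for well-ordered index types carries over.\<close>

lemma integral_det_compact_support:
  fixes v :: "real^'n::finite \<Rightarrow> real^'n"
  assumes v: "C1_with v V" and supp: "\<And>x. x \<notin> cbox a b \<Longrightarrow> v x = 0"
  shows "integral (cbox a b) (\<lambda>x. det (V x)) = 0"
proof -
  obtain \<pi> :: "'n ord_index \<Rightarrow> 'n" where \<pi>: "bij \<pi>"
    using CARD_ord_index[where 'n='n] by (metis finite_class.finite_UNIV finite_same_card_bij)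
  have ip: "inv \<pi> (\<pi> x) = x" for x using \<pi> by (simp add: bij_is_inj)
  have pi: "\<pi> (inv \<pi> y) = y" for y using \<pi> by (simp add: bij_is_surj surj_f_inv_f)
  let ?P = "\<lambda>x::real^'n ord_index. (\<chi> i. x $ inv \<pi> i)" and ?Q = "\<lambda>y::real^'n. (\<chi> k. y $ \<pi> k)"
  have PQ: "?P (?Q y) = y" for y by (simp add: vec_eq_iff pi)
  have blP: "bounded_linear ?P" and blQ: "bounded_linear ?Q"
    by (auto intro!: linear_conv_bounded_linear[THEN iffD1] linearI simp: vec_eq_iff)
  define w where "w x = ?Q (v (?P x))" for x
  define W where "W x = (\<chi> k l. V (?P x) $ \<pi> k $ \<pi> l)" for x
  have mult: "?Q (V (?P x) *v ?P h) = W x *v h" for x h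
    unfolding vec_eq_iff W_def matrix_vector_mult_def
    using sum.reindex_bij_betw[of \<pi> UNIV UNIV "\<lambda>j. V (?P x) $ \<pi> i $ j * h $ inv \<pi> j" for i] \<pi>
    by (simp add: ip)
  have "(w has_derivative (\<lambda>h. W x *v h)) (at x)" for x
    unfolding w_def[abs_def] mult[symmetric]
    by (intro bounded_linear.has_derivative[OF blQ] has_derivative_compose[OF _ C1_withD(1)[OF v]]
        bounded_linear_imp_has_derivative[OF blP])
  moreover have "continuous_on UNIV W"
    unfolding W_def
    by (intro continuous_intros continuous_on_compose2[OF C1_withD(2)[OF v]]) auto
  ultimately have C1: "C1_with w W" by (simp add: C1_with_def)
  have sw: "w x = 0" if "x \<notin> cbox (?Q a) (?Q b)" for x
  proof -
    have "?P x \<notin> cbox a b" using that by (auto simp: mem_box_cart) (metis ip)+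
    then show ?thesis using supp by (simp add: w_def vec_eq_iff)
  qed
  have "0 = integral (cbox (?Q a) (?Q b)) (\<lambda>x. det (W x))"
    using integral_det_compact_support_wellorder[OF C1 sw] by simp
  also have "\<dots> = integral (cbox (?Q a) (?Q b)) (\<lambda>x. det (V (?P x)))"
    unfolding W_def by (simp add: det_reindex[OF \<pi>])
  also have "\<dots> = integral (cbox a b) (\<lambda>x. det (V x))"
    by (intro integral_reindex[OF \<pi>, where g="\<lambda>x. det (V x)"] integrable_continuous continuous_intros
        continuous_on_subset[OF C1_withD(2)[OF v]]) auto
  finally show ?thesis by simp
qed

section \<open>Cutoff functions and the degree identity for smooth maps\<close>

text \<open>Up to the factor 2 this is the primitive of the positive part, hence a \<open>C\<^sup>1\<close> function. All \<open>C\<^sup>1\<close> gluing below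
is done with it.\<close>

definition pos2 :: "real \<Rightarrow> real" where "pos2 t = (max 0 t)\<^sup>2"

lemma DERIV_pos2: "(pos2 has_real_derivative 2 * max 0 t) (at t)"
proof -
  consider "t < 0" | "t > 0" | "t = 0" by linarith
  then show ?thesis
  proof cases
    case 1
    have "((\<lambda>_. 0) has_real_derivative 2 * max 0 t) (at t)" using 1 by simp
    then show ?thesis
      by (rule has_field_derivative_transform_within_open[where S="{..<0}"]) (use 1 in \<open>auto simp: pos2_def\<close>)
  next
    case 2
    have "((\<lambda>t. t\<^sup>2) has_real_derivative 2 * max 0 t) (at t)" using 2 by (auto intro!: derivative_eq_intros)
    then show ?thesis
      by (rule has_field_derivative_transform_within_open[where S="{0<..}"]) (use 2 in \<open>auto simp: pos2_def\<close>)
  next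
    case 3
    have "((\<lambda>h. (pos2 h - pos2 0) / h) \<longlongrightarrow> 0) (at 0)"
    proof (rule Lim_null_comparison)
      have "norm ((pos2 h - pos2 0) / h) \<le> \<bar>h\<bar>" for h
        by (cases "h \<le> 0") (auto simp: pos2_def power2_eq_square)
      then show "\<forall>\<^sub>F h in at 0. norm ((pos2 h - pos2 0) / h) \<le> \<bar>h\<bar>" by simp
      show "((\<lambda>h::real. \<bar>h\<bar>) \<longlongrightarrow> 0) (at 0)" by (intro tendsto_eq_intros) auto
    qed
    with 3 show ?thesis by (simp add: DERIV_def)
  qed
qed

lemmas DERIV_pos2_chain [derivative_intros] = DERIV_pos2[THEN DERIV_chain2]

lemma continuous_on_pos2 [continuous_intros]: "continuous_on S f \<Longrightarrow> continuous_on S (\<lambda>x. pos2 (f x))"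
  unfolding pos2_def by (intro continuous_intros)

text \<open>For \<open>0 \<le> t \<le> 1\<close> this is \<open>3t\<^sup>2 - 2t\<^sup>3\<close>; the second summand cancels the excess of this polynomial over the value
1 for \<open>t \<ge> 1\<close>, and the first one vanishes for \<open>t \<le> 0\<close>.\<close>

definition smoothstep :: "real \<Rightarrow> real" where
  "smoothstep t = (3 - 2 * t) * pos2 t + (2 * t + 1) * pos2 (t - 1)"

definition smoothstep' :: "real \<Rightarrow> real" where
  "smoothstep' t = 6 * max 0 t - 6 * pos2 t + 6 * max 0 (t - 1) + 6 * pos2 (t - 1)"

lemma DERIV_smoothstep: "(smoothstep has_real_derivative smoothstep' t) (at t)"
proof -
  have "(smoothstep has_real_derivative (-2) * pos2 t + (2 * max 0 t) * (3 - 2 * t)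
      + (2 * pos2 (t - 1) + (2 * max 0 (t - 1)) * (2 * t + 1))) (at t)"
    unfolding smoothstep_def[abs_def]
    by (intro DERIV_add DERIV_mult DERIV_pos2) (auto intro!: derivative_eq_intros)
  moreover have "(-2) * pos2 t + (2 * max 0 t) * (3 - 2 * t)
      + (2 * pos2 (t - 1) + (2 * max 0 (t - 1)) * (2 * t + 1)) = smoothstep' t"
    by (simp add: smoothstep'_def pos2_def max_def power2_eq_square algebra_simps)
  ultimately show ?thesis by simp
qed

lemmas DERIV_smoothstep_chain [derivative_intros] = DERIV_smoothstep[THEN DERIV_chain2]

lemma continuous_on_smoothstep' [continuous_intros]:
  "continuous_on S f \<Longrightarrow> continuous_on S (\<lambda>x. smoothstep' (f x))"
  unfolding smoothstep'_def by (intro continuous_intros)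

lemma smoothstep_simps:
  "t \<le> 0 \<Longrightarrow> smoothstep t = 0" "t \<ge> 1 \<Longrightarrow> smoothstep t = 1"
  "t \<le> 0 \<Longrightarrow> smoothstep' t = 0" "t \<ge> 1 \<Longrightarrow> smoothstep' t = 0"
  by (auto simp: smoothstep_def smoothstep'_def pos2_def max_def power2_eq_square algebra_simps)

lemma smoothstep'_bounds: "0 \<le> smoothstep' t" "smoothstep' t \<le> 3 / 2"
proof -
  have "smoothstep' t = 6 * t * (1 - t)" if "0 \<le> t" "t \<le> 1"
    using that by (auto simp: smoothstep'_def pos2_def max_def power2_eq_square algebra_simps)
  moreover have "6 * t * (1 - t) \<le> 3 / 2" using zero_le_power2[of "2 * t - 1"] by (simp add: power2_eq_square algebra_simps)
  moreover have "0 \<le> 6 * t * (1 - t)" if "0 \<le> t" "t \<le> 1" using that by auto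
  ultimately show "0 \<le> smoothstep' t" "smoothstep' t \<le> 3 / 2"
    using smoothstep_simps[of t] by (cases "0 \<le> t"; cases "t \<le> 1"; simp)+
qed

lemma has_derivative_norm_squared:
  "((\<lambda>y::'a::real_inner. (norm y)\<^sup>2) has_derivative (\<lambda>h. 2 * (y \<bullet> h))) (at y)"
  unfolding power2_norm_eq_inner by (auto intro!: derivative_eq_intros simp: inner_commute)

lemma has_derivative_norm_squared_compose:
  assumes "(\<phi> has_real_derivative \<phi>') (at ((norm y)\<^sup>2))"
  shows "((\<lambda>y::'a::real_inner. \<phi> ((norm y)\<^sup>2)) has_derivative (\<lambda>h. (2 * \<phi>' * (y \<bullet> h)))) (at y)"
  using has_derivative_compose[OF has_derivative_norm_squared assms[unfolded has_field_derivative_def]]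
  by (simp add: mult_ac)

text \<open>The derivative of a product of a scalar and a vector field has a rank one part, which is the source of the
rank one matrices in the Jacobians of radial maps.\<close>

lemma C1_with_scale:
  fixes \<psi> :: "real^'n::finite \<Rightarrow> real" and A :: "real^'n \<Rightarrow> real^'m::finite"
  assumes A: "C1_with A DA" and \<psi>: "\<And>x. (\<psi> has_derivative (\<lambda>h. d x \<bullet> h)) (at x)" and d: "continuous_on UNIV d"
  shows "C1_with (\<lambda>x. \<psi> x *\<^sub>R A x) (\<lambda>x. \<psi> x *\<^sub>R DA x + (\<chi> i j. A x $ i * d x $ j))"
proof -
  have "continuous_on UNIV \<psi>"
    by (meson \<psi> continuous_at_imp_continuous_on has_derivative_continuous)
  then have "continuous_on UNIV (\<lambda>x. \<psi> x *\<^sub>R DA x + (\<chi> i j. A x $ i * d x $ j))"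
    by (intro continuous_intros C1_withD[OF A] d)
  moreover have "((\<lambda>x. \<psi> x *\<^sub>R A x) has_derivative (\<lambda>h. (\<psi> x *\<^sub>R DA x + (\<chi> i j. A x $ i * d x $ j)) *v h)) (at x)" for x
  proof -
    have "(\<chi> i j. A x $ i * d x $ j) *v h = (d x \<bullet> h) *\<^sub>R A x" for h
      by (simp add: vec_eq_iff matrix_vector_mult_def inner_vec_def sum_distrib_left sum_distrib_right mult_ac)
    then show ?thesis
      by (auto intro!: derivative_eq_intros C1_withD(1)[OF A] \<psi> simp: matrix_vector_mult_add_rdistrib scaleR_matrix_vector_assoc)
  qed
  ultimately show ?thesis by (simp add: C1_with_def)
qed

lemma C1_with_compose:
  assumes P: "C1_with P DP" and g: "C1_with g G"
  shows "C1_with (\<lambda>x. P (g x)) (\<lambda>x. DP (g x) ** G x)"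
proof -
  have "((\<lambda>x. P (g x)) has_derivative (\<lambda>h. (DP (g x) ** G x) *v h)) (at x)" for x
    using has_derivative_compose[OF C1_withD(1)[OF g] C1_withD(1)[OF P]]
    by (simp add: matrix_vector_mul_assoc)
  moreover have "continuous_on UNIV (\<lambda>x. DP (g x) ** G x)"
    unfolding matrix_matrix_mult_def
    by (intro continuous_intros continuous_on_compose2[OF C1_withD(2)[OF P] C1_withD(3)[OF g]] C1_withD(2)[OF g]) auto
  ultimately show ?thesis by (simp add: C1_with_def)
qed

lemma C1_with_derivative_eq:
  assumes "C1_with A DA" "C1_with B DB" "open U" "x \<in> U" "\<And>y. y \<in> U \<Longrightarrow> A y = B y"
  shows "DA x = DB x"
proof -
  have "(B has_derivative (\<lambda>h. DA x *v h)) (at x)"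
    using C1_withD(1)[OF assms(1)] assms(3-5) by (rule has_derivative_transform_within_open)
  then have "(\<lambda>h. DA x *v h) = (\<lambda>h. DB x *v h)"
    using C1_withD(1)[OF assms(2)] has_derivative_unique by blast
  then show ?thesis by (metis matrix_eq)
qed

lemma smooth_cutoff:
  obtains \<psi> :: "real^'n::finite \<Rightarrow> real" and d c e
  where "\<And>x. (\<psi> has_derivative (\<lambda>h. d x \<bullet> h)) (at x)" "continuous_on UNIV d"
    "\<And>x. x \<in> cbox a b \<Longrightarrow> \<psi> x = 1" "\<And>x. x \<in> cbox a b \<Longrightarrow> d x = 0"
    "\<And>x. x \<notin> cbox c e \<Longrightarrow> \<psi> x = 0" "cbox a b \<subseteq> cbox c e"
proof -
  obtain R where R: "\<And>x. x \<in> cbox a b \<Longrightarrow> norm x \<le> R" "R > 0"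
    using bounded_cbox[of a b] by (meson bounded_pos)
  define \<psi> where "\<psi> x = 1 - smoothstep ((norm x)\<^sup>2 - R\<^sup>2)" for x :: "real^'n"
  define d where "d x = (- 2 * smoothstep' ((norm x)\<^sup>2 - R\<^sup>2)) *\<^sub>R x" for x :: "real^'n"
  obtain c e :: "real^'n" where ce: "cball 0 (R + 1) \<subseteq> cbox c e"
    using bounded_subset_cbox_symmetric[OF bounded_cball] by metis
  show ?thesis
  proof (rule that[of \<psi> d c e])
    show "(\<psi> has_derivative (\<lambda>h. d x \<bullet> h)) (at x)" for x
    proof -
      have "((\<lambda>t. 1 - smoothstep (t - R\<^sup>2)) has_real_derivative - smoothstep' ((norm x)\<^sup>2 - R\<^sup>2)) (at ((norm x)\<^sup>2))"
        by (auto intro!: derivative_eq_intros)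
      from has_derivative_norm_squared_compose[OF this] show ?thesis
        unfolding \<psi>_def[abs_def] d_def by simp
    qed
    show "continuous_on UNIV d" unfolding d_def by (intro continuous_intros)
    show "\<psi> x = 1" "d x = 0" if "x \<in> cbox a b" for x
      using R(1)[OF that] R(2) power_mono[OF R(1)[OF that], of 2] by (auto simp: \<psi>_def d_def smoothstep_simps)
    show "\<psi> x = 0" if "x \<notin> cbox c e" for x
    proof -
      have "norm x \<ge> R + 1" using that ce by force
      then have "(norm x)\<^sup>2 \<ge> (R + 1)\<^sup>2" using R(2) by (intro power_mono) auto
      then have "(norm x)\<^sup>2 - R\<^sup>2 \<ge> 1" using R(2) by (simp add: power2_eq_square algebra_simps)
      then show ?thesis by (simp add: \<psi>_def smoothstep_simps)
    qed
    show "cbox a b \<subseteq> cbox c e" using R ce by force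
  qed
qed

text \<open>Multiplying both maps by the same cutoff function gives two fields of compact support, whose Jacobians have
integral zero. Off the cube the two fields coincide and on the cube the cutoff is invisible, so the difference
of the integrals over the cube is zero.\<close>

lemma integral_det_eq_if_eq_outside:
  fixes A B :: "real^'n::finite \<Rightarrow> real^'n"
  assumes A: "C1_with A DA" and B: "C1_with B DB" and eq: "\<And>x. x \<notin> cbox a b \<Longrightarrow> A x = B x"
  shows "integral (cbox a b) (\<lambda>x. det (DA x)) = integral (cbox a b) (\<lambda>x. det (DB x))"
proof -
  obtain \<psi> :: "real^'n \<Rightarrow> real" and d c e where
    \<psi>: "\<And>x. (\<psi> has_derivative (\<lambda>h. d x \<bullet> h)) (at x)" "continuous_on UNIV d"
    "\<And>x. x \<in> cbox a b \<Longrightarrow> \<psi> x = 1" "\<And>x. x \<in> cbox a b \<Longrightarrow> d x = 0"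
    "\<And>x. x \<notin> cbox c e \<Longrightarrow> \<psi> x = 0" and sub: "cbox a b \<subseteq> cbox c e"
    using smooth_cutoff[of a b] by metis
  define DX where "DX A DA x = \<psi> x *\<^sub>R DA x + (\<chi> i j. A x $ i * d x $ j)" for A :: "real^'n \<Rightarrow> real^'n" and DA x
  have X: "C1_with (\<lambda>x. \<psi> x *\<^sub>R A x) (DX A DA)" "C1_with (\<lambda>x. \<psi> x *\<^sub>R B x) (DX B DB)"
    unfolding DX_def[abs_def] by (intro C1_with_scale A B \<psi>)+
  have int: "(\<lambda>x. det (DX A DA x)) integrable_on cbox c e" "(\<lambda>x. det (DX B DB x)) integrable_on cbox c e"
    by (intro integrable_continuous continuous_intros continuous_on_subset[OF C1_withD(2)[OF X(1)]]
        continuous_on_subset[OF C1_withD(2)[OF X(2)]], auto)+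
  have int': "(\<lambda>x. det (DA x)) integrable_on cbox a b" "(\<lambda>x. det (DB x)) integrable_on cbox a b"
    by (intro integrable_continuous continuous_intros continuous_on_subset[OF C1_withD(2)[OF A]]
        continuous_on_subset[OF C1_withD(2)[OF B]], auto)+
  have zero: "integral (cbox c e) (\<lambda>x. det (DX A DA x)) = 0" "integral (cbox c e) (\<lambda>x. det (DX B DB x)) = 0"
    by (rule integral_det_compact_support[OF X(1)], simp add: \<psi>(5), rule integral_det_compact_support[OF X(2)], simp add: \<psi>(5))
  have out: "DX A DA x = DX B DB x" if "x \<notin> cbox a b" for x
  proof -
    have "DA x = DB x"
      by (rule C1_with_derivative_eq[OF A B, of "- cbox a b"]) (use that eq in \<open>auto simp: closed_cbox open_Compl\<close>)
    then show ?thesis using eq[OF that] by (simp add: DX_def)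
  qed
  have inn: "DX A DA x = DA x" "DX B DB x = DB x" if "x \<in> cbox a b" for x
    using \<psi>(3,4)[OF that] by (simp_all add: DX_def vec_eq_iff)
  have "0 = integral (cbox c e) (\<lambda>x. det (DX A DA x) - det (DX B DB x))"
    using zero int by (simp add: integral_diff)
  also have "\<dots> = integral (cbox c e) (\<lambda>x. if x \<in> cbox a b then det (DA x) - det (DB x) else 0)"
    by (intro arg_cong[where f="integral (cbox c e)"] ext) (use inn out in auto)
  also have "\<dots> = integral (cbox a b) (\<lambda>x. det (DA x) - det (DB x))"
    using sub by (simp add: integral_restrict_Int Int_absorb2)
  finally show ?thesis using int' by (simp add: integral_diff)
qed

text \<open>Replacing \<open>P2 \<circ> g\<close> by \<open>P1 \<circ> g\<close> on the cube keeps the map \<open>C\<^sup>1\<close>, because near the boundary of the cube both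
compositions agree. The modified map coincides with \<open>P2 \<circ> g\<close> off the cube, so the previous lemma applies.\<close>

lemma degree_identity_C1:
  fixes g P1 P2 :: "real^'n::finite \<Rightarrow> real^'n"
  assumes g: "C1_with g G" and P1: "C1_with P1 DP1" and P2: "C1_with P2 DP2"
    and W: "open W" "g ` frontier (cbox a b) \<subseteq> W" and eq: "\<And>y. y \<in> W \<Longrightarrow> P1 y = P2 y"
  shows "integral (cbox a b) (\<lambda>x. det (DP1 (g x)) * det (G x)) = integral (cbox a b) (\<lambda>x. det (DP2 (g x)) * det (G x))"
proof -
  let ?Q = "cbox a b"
  note c1 = C1_with_compose[OF P1 g] and c2 = C1_with_compose[OF P2 g]
  define A where "A x = (if x \<in> ?Q then P1 (g x) else P2 (g x))" for x
  define DA where "DA x = (if x \<in> ?Q then DP1 (g x) ** G x else DP2 (g x) ** G x)" for x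
  define U where "U = g -` W"
  have oU: "open U" unfolding U_def by (rule open_vimage[OF W(1) C1_withD(3)[OF g]])
  have DPeq: "DP1 (g x) = DP2 (g x)" if "x \<in> U" for x
    by (rule C1_with_derivative_eq[OF P1 P2 W(1)]) (use that eq in \<open>auto simp: U_def\<close>)
  have loc: "\<exists>V. open V \<and> x \<in> V \<and> ((\<forall>y\<in>V. A y = P1 (g y) \<and> DA y = DP1 (g y) ** G y) \<or> (\<forall>y\<in>V. A y = P2 (g y) \<and> DA y = DP2 (g y) ** G y))" for x
  proof -
    have cases: "x \<in> interior ?Q \<or> x \<in> - ?Q \<or> x \<in> U"
      using W(2) by (auto simp: U_def frontier_def closure_closed)
    then show ?thesis
    proof (elim disjE)
      assume x: "x \<in> interior ?Q"
      have "\<forall>y\<in>interior ?Q. A y = P1 (g y) \<and> DA y = DP1 (g y) ** G y"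
        using interior_subset[of ?Q] by (auto simp: A_def DA_def)
      with x show ?thesis using open_interior by metis
    next
      assume x: "x \<in> - ?Q"
      have "\<forall>y\<in>- ?Q. A y = P2 (g y) \<and> DA y = DP2 (g y) ** G y" by (auto simp: A_def DA_def)
      with x show ?thesis using open_Compl[OF closed_cbox] by metis
    next
      assume x: "x \<in> U"
      have "\<forall>y\<in>U. A y = P2 (g y) \<and> DA y = DP2 (g y) ** G y"
        using DPeq eq by (auto simp: A_def DA_def U_def)
      with x show ?thesis using oU by metis
    qed
  qed
  have "C1_with A DA"
    unfolding C1_with_def
  proof (intro conjI allI continuous_at_imp_continuous_on ballI)
    fix x
    obtain V where V: "open V" "x \<in> V" and or: "(\<forall>y\<in>V. A y = P1 (g y) \<and> DA y = DP1 (g y) ** G y) \<or> (\<forall>y\<in>V. A y = P2 (g y) \<and> DA y = DP2 (g y) ** G y)"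
      using loc by blast
    obtain B DB where B: "C1_with B DB" "\<And>y. y \<in> V \<Longrightarrow> A y = B y" "\<And>y. y \<in> V \<Longrightarrow> DA y = DB y"
      using or
    proof (elim disjE)
      assume "\<forall>y\<in>V. A y = P1 (g y) \<and> DA y = DP1 (g y) ** G y"
      then show thesis using that[OF c1] by simp
    next
      assume "\<forall>y\<in>V. A y = P2 (g y) \<and> DA y = DP2 (g y) ** G y"
      then show thesis using that[OF c2] by simp
    qed
    show "(A has_derivative (*v) (DA x)) (at x)"
      unfolding B(3)[OF V(2)] by (rule has_derivative_transform_within_open[OF C1_withD(1)[OF B(1)] V]) (simp add: B(2))
    have "isCont DB x" using C1_withD(2)[OF B(1)] by (simp add: continuous_on_eq_continuous_at)
    moreover have "\<forall>\<^sub>F y in nhds x. DA y = DB y"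
      unfolding eventually_nhds using V B(3) by blast
    ultimately show "isCont DA x" by (simp add: isCont_cong)
  qed
  from integral_det_eq_if_eq_outside[OF this c2, of a b]
  have "integral ?Q (\<lambda>x. det (DA x)) = integral ?Q (\<lambda>x. det (DP2 (g x) ** G x))" by (simp add: A_def)
  moreover have "integral ?Q (\<lambda>x. det (DA x)) = integral ?Q (\<lambda>x. det (DP1 (g x) ** G x))"
    by (rule integral_cong) (simp add: DA_def)
  ultimately show ?thesis by (simp add: det_mul)
qed

section \<open>Radial maps of the target and their Jacobians\<close>

text \<open>An orthogonal change of coordinates that takes a coordinate axis to the direction of \<open>y\<close> makes the matrix
diagonal.\<close>

lemma det_scalar_plus_rank_one:
  fixes y :: "real^'n::finite"
  shows "det (c *\<^sub>R mat 1 + (\<chi> i j. y $ i * (k * y $ j)) :: real^'n^'n) = c ^ (CARD('n) - 1) * (c + k * (norm y)\<^sup>2)"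
proof -
  obtain l :: 'n where True by simp
  let ?e = "axis l 1 :: real^'n"
  obtain f :: "real^'n \<Rightarrow> real^'n" where f: "orthogonal_transformation f" "f (norm y *\<^sub>R ?e) = y"
    using orthogonal_transformation_exists[of "norm y *\<^sub>R ?e" y] by (auto simp: norm_axis_1)
  define R where "R = matrix f"
  have fR: "f = (*v) R" unfolding R_def
    using f(1) by (simp add: matrix_works orthogonal_transformation_def fun_eq_iff)
  have oR: "orthogonal_matrix R" using f(1) by (simp add: R_def orthogonal_transformation_matrix)
  then have RR: "R ** transpose R = mat 1" by (simp add: orthogonal_matrix_def)
  define D where "D = (c *\<^sub>R mat 1 + (\<chi> i j. ?e $ i * (k * (norm y)\<^sup>2 * ?e $ j)) :: real^'n^'n)"
  have rank1: "(c *\<^sub>R mat 1 + (\<chi> i j. y $ i * (k * y $ j))) *v h = c *\<^sub>R h + (k * (y \<bullet> h)) *\<^sub>R y" for y h :: "real^'n" and k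
    by (simp add: matrix_vector_mult_add_rdistrib flip: scaleR_matrix_vector_assoc)
      (simp add: vec_eq_iff matrix_vector_mult_def inner_vec_def sum_distrib_left sum_distrib_right mult_ac)
  have D: "D *v h = c *\<^sub>R h + (k * (norm y)\<^sup>2 * (?e \<bullet> h)) *\<^sub>R ?e" for h
    unfolding D_def by (rule rank1)
  have "c *\<^sub>R mat 1 + (\<chi> i j. y $ i * (k * y $ j)) = R ** D ** transpose R"
  proof (subst matrix_eq, intro allI)
    fix h
    have yh: "y \<bullet> h = norm y * (?e \<bullet> (transpose R *v h))"
      by (subst f(2)[symmetric], simp add: fR matrix_vector_mult_scaleR)
        (metis dot_lmul_matrix inner_commute transpose_matrix_vector)
    have y: "norm y *\<^sub>R (R *v ?e) = y" using f(2) by (simp add: fR matrix_vector_mult_scaleR)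
    have "R *v (D *v (transpose R *v h)) = c *\<^sub>R (R *v (transpose R *v h)) + (k * (norm y)\<^sup>2 * (?e \<bullet> (transpose R *v h))) *\<^sub>R (R *v ?e)"
      unfolding D by (simp add: matrix_vector_right_distrib matrix_vector_mult_scaleR)
    also have "R *v (transpose R *v h) = h" by (simp add: matrix_vector_mul_assoc RR del: transpose_matrix_vector)
    also have "(k * (norm y)\<^sup>2 * (?e \<bullet> (transpose R *v h))) *\<^sub>R (R *v ?e) = (k * (y \<bullet> h)) *\<^sub>R (norm y *\<^sub>R (R *v ?e))"
      by (simp add: yh power2_eq_square)
    finally show "(c *\<^sub>R mat 1 + (\<chi> i j. y $ i * (k * y $ j))) *v h = R ** D ** transpose R *v h"
      unfolding rank1 y by (simp add: matrix_vector_mul_assoc[symmetric])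
  qed
  then have "det (c *\<^sub>R mat 1 + (\<chi> i j. y $ i * (k * y $ j)) :: real^'n^'n) = det R * det D * det (transpose R)"
    by (simp add: det_mul)
  also have "\<dots> = det (R ** transpose R) * det D" by (simp only: det_mul mult_ac)
  also have "\<dots> = (\<Prod>i\<in>UNIV. D $ i $ i)"
    unfolding RR det_I by (simp, rule det_diagonal) (auto simp: D_def mat_def axis_def)
  also have "\<dots> = (\<Prod>i\<in>UNIV. if i = l then c + k * (norm y)\<^sup>2 else c)"
    by (intro prod.cong) (auto simp: D_def mat_def axis_def)
  also have "\<dots> = (c + k * (norm y)\<^sup>2) * (\<Prod>i\<in>UNIV - {l}. c)"
    by (subst prod.remove[of _ l]) auto
  finally show ?thesis by (simp add: card_Diff_singleton)
qed

lemma C1_with_id: "C1_with (\<lambda>x. x) (\<lambda>x::real^'n::finite. mat 1)"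
  by (simp add: C1_with_def)

text \<open>Every radial map used below is given by a profile \<open>\<phi>\<close> of the squared norm; the squared norm is used since it
is smooth at the origin.\<close>

lemma radial_map:
  fixes \<phi> :: "real \<Rightarrow> real"
  assumes \<phi>: "\<And>t. (\<phi> has_real_derivative \<phi>' t) (at t)" and c: "continuous_on UNIV \<phi>'"
  obtains DP where "C1_with (\<lambda>y::real^'n::finite. \<phi> ((norm y)\<^sup>2) *\<^sub>R y) DP"
    "\<And>y. det (DP y) = \<phi> ((norm y)\<^sup>2) ^ (CARD('n) - 1) * (\<phi> ((norm y)\<^sup>2) + 2 * (norm y)\<^sup>2 * \<phi>' ((norm y)\<^sup>2))"
proof -
  define d where "d y = (2 * \<phi>' ((norm y)\<^sup>2)) *\<^sub>R y" for y :: "real^'n"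
  have der: "((\<lambda>y. \<phi> ((norm y)\<^sup>2)) has_derivative (\<lambda>h. d y \<bullet> h)) (at y)" for y
    using has_derivative_norm_squared_compose[OF \<phi>, of y] by (simp add: d_def)
  have cd: "continuous_on UNIV d"
    unfolding d_def by (intro continuous_intros continuous_on_compose2[OF c]) auto
  show ?thesis
  proof (rule that)
    show "C1_with (\<lambda>y::real^'n::finite. \<phi> ((norm y)\<^sup>2) *\<^sub>R y) (\<lambda>y. \<phi> ((norm y)\<^sup>2) *\<^sub>R mat 1 + (\<chi> i j. y $ i * d y $ j))"
      by (rule C1_with_scale[OF C1_with_id der cd])
    show "det (\<phi> ((norm y)\<^sup>2) *\<^sub>R mat 1 + (\<chi> i j. y $ i * d y $ j)) = 
      \<phi> ((norm y)\<^sup>2) ^ (CARD('n) - 1) * (\<phi> ((norm y)\<^sup>2) + 2 * (norm y)\<^sup>2 * \<phi>' ((norm y)\<^sup>2))" for y :: "real^'n"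
      using det_scalar_plus_rank_one[of "\<phi> ((norm y)\<^sup>2)" y "2 * \<phi>' ((norm y)\<^sup>2)"] by (simp add: d_def mult_ac)
  qed
qed

text \<open>The identity on the ball of radius \<open>m\<close>, with a radial profile that decreases strictly beyond it. Compared
with the identity through the degree identity, such a map shows that the Jacobian of \<open>f\<close> vanishes where
\<open>|f| > m\<close>, provided that \<open>|f| < m\<close> on the boundary.\<close>

lemma radial_contraction:
  fixes m :: real
  obtains P DP where "C1_with (P :: real^'n::finite \<Rightarrow> real^'n) DP"
    "\<And>y. norm y \<le> m \<Longrightarrow> P y = y" "\<And>y. det (DP y) \<le> 1" "\<And>y. norm y > m \<Longrightarrow> m \<ge> 0 \<Longrightarrow> det (DP y) < 1"
proof -
  define \<phi> where "\<phi> t = 1 / (1 + pos2 (t - m\<^sup>2))" for t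
  define \<phi>' where "\<phi>' t = - (2 * max 0 (t - m\<^sup>2)) / (1 + pos2 (t - m\<^sup>2))\<^sup>2" for t
  have p: "pos2 t \<ge> 0" for t by (simp add: pos2_def)
  have nz: "1 + pos2 t \<noteq> 0" for t using p[of t] by linarith
  have der: "(\<phi> has_real_derivative \<phi>' t) (at t)" for t
    unfolding \<phi>_def[abs_def] \<phi>'_def using nz[of "t - m\<^sup>2"]
    by (auto intro!: derivative_eq_intros simp: power2_eq_square)
  have cont: "continuous_on UNIV \<phi>'"
    unfolding \<phi>'_def by (intro continuous_intros ballI) (simp add: nz)
  obtain DP where DP: "C1_with (\<lambda>y::real^'n::finite. \<phi> ((norm y)\<^sup>2) *\<^sub>R y) DP"
    "\<And>y. det (DP y) = \<phi> ((norm y)\<^sup>2) ^ (CARD('n) - 1) * (\<phi> ((norm y)\<^sup>2) + 2 * (norm y)\<^sup>2 * \<phi>' ((norm y)\<^sup>2))"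
    by (rule radial_map[where 'n='n, OF der cont], rule that)
  have phi: "0 < \<phi> t" "\<phi> t \<le> 1" for t
    using p[of "t - m\<^sup>2"] by (auto simp: \<phi>_def field_simps intro: add_pos_nonneg)
  have phi': "\<phi>' t \<le> 0" "t > m\<^sup>2 \<Longrightarrow> \<phi>' t < 0" for t
    using p[of "t - m\<^sup>2"] nz[of "t - m\<^sup>2"] by (auto simp: \<phi>'_def intro!: divide_nonpos_nonneg divide_neg_pos)
  have pow: "\<phi> t ^ k \<le> 1" "0 < \<phi> t ^ k" for t k using phi[of t] by (auto intro: power_le_one)
  show ?thesis
  proof (rule that[OF DP(1)])
    show "\<phi> ((norm y)\<^sup>2) *\<^sub>R y = y" if "norm y \<le> m" for y :: "real^'n"
      using power_mono[OF that, of 2] by (simp add: \<phi>_def pos2_def max_def)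
    fix y :: "real^'n"
    have A: "\<phi> t ^ (CARD('n) - 1) * a \<le> max 0 a" for a t
      using pow[where k="CARD('n) - 1" and t=t] by (cases "a \<ge> 0") (auto intro: mult_left_le_one_le simp: mult_nonneg_nonpos)
    have "2 * (norm y)\<^sup>2 * \<phi>' ((norm y)\<^sup>2) \<le> 0" using phi'(1) by (simp add: mult_nonneg_nonpos)
    then show "det (DP y) \<le> 1"
      unfolding DP(2) using phi(2)[of "(norm y)\<^sup>2"] by (intro order_trans[OF A]) auto
    assume y: "norm y > m" "m \<ge> 0"
    then have "(norm y)\<^sup>2 > m\<^sup>2" "norm y > 0" by (auto intro: power_strict_mono)
    then have "2 * (norm y)\<^sup>2 * \<phi>' ((norm y)\<^sup>2) < 0" using phi'(2) by (simp add: mult_pos_neg)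
    then show "det (DP y) < 1"
      unfolding DP(2) using phi(2)[of "(norm y)\<^sup>2"] by (intro le_less_trans[OF A]) auto
  qed
qed

text \<open>A smoothed version of the map that scales the ball of radius \<open>R\<close> to the unit ball and projects the rest of
the space to the unit sphere. Outside the ball of radius \<open>R\<close> the map does not depend on \<open>R\<close>; hence the
integral of \<open>det (DP (f x)) det (Df x)\<close> will not depend on \<open>R\<close> either, although \<open>det DP\<close> is of size
\<open>R\<^sup>-\<^sup>n\<close> on the ball of radius \<open>R / 2\<close>.\<close>

lemma radial_squash:
  fixes R :: real
  assumes R: "R > 0"
  obtains P DP where "C1_with (P :: real^'n::finite \<Rightarrow> real^'n) DP"
    "\<And>y. norm y \<ge> R \<Longrightarrow> P y = y /\<^sub>R norm y" "\<And>y. det (DP y) \<ge> 0" 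
    "\<And>y. norm y \<ge> R \<Longrightarrow> det (DP y) = 0" "\<And>y. norm y \<le> R / 2 \<Longrightarrow> det (DP y) \<ge> 1 / (2 * R ^ CARD('n))"
proof -
  define u where "u t = t / R\<^sup>2 + pos2 (1 - t / R\<^sup>2)" for t
  define u' where "u' t = (1 - 2 * max 0 (1 - t / R\<^sup>2)) / R\<^sup>2" for t
  define \<phi> where "\<phi> t = 1 / (R * sqrt (u t))" for t
  define \<phi>' where "\<phi>' t = - u' t / (2 * R * u t * sqrt (u t))" for t
  have u: "u t > 0" for t
  proof (cases "t / R\<^sup>2 < 1")
    case True
    then have "u t = (t / R\<^sup>2 - 1 / 2)\<^sup>2 + 3 / 4"
      unfolding u_def pos2_def by (simp only: max_def) (simp add: power2_eq_square algebra_simps)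
    then show ?thesis by (metis add_nonneg_pos zero_le_power2 zero_less_divide_iff zero_less_numeral)
  next
    case False
    moreover from False have "t / R\<^sup>2 > 0" by linarith
    ultimately show ?thesis unfolding u_def by (intro add_pos_nonneg) (simp_all add: pos2_def)
  qed
  have du: "(u has_real_derivative u' t) (at t)" for t
    unfolding u_def[abs_def] u'_def using R by (auto intro!: derivative_eq_intros simp: field_simps)
  have der: "(\<phi> has_real_derivative \<phi>' t) (at t)" for t
    unfolding \<phi>_def[abs_def] \<phi>'_def using R u[of t]
    by (auto intro!: derivative_eq_intros DERIV_real_sqrt[THEN DERIV_chain2] du simp: field_simps power2_eq_square)
  have cu: "continuous_on UNIV u" unfolding u_def by (intro continuous_intros) (use R in auto)
  have cont: "continuous_on UNIV \<phi>'"
    unfolding \<phi>'_def u'_def using u R by (intro continuous_intros cu) (auto simp: less_imp_neq[symmetric])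
  obtain DP where DP: "C1_with (\<lambda>y::real^'n::finite. \<phi> ((norm y)\<^sup>2) *\<^sub>R y) DP"
    "\<And>y. det (DP y) = \<phi> ((norm y)\<^sup>2) ^ (CARD('n) - 1) * (\<phi> ((norm y)\<^sup>2) + 2 * (norm y)\<^sup>2 * \<phi>' ((norm y)\<^sup>2))"
    by (rule radial_map[where 'n='n, OF der cont], rule that)
  have key: "\<phi> t + 2 * t * \<phi>' t = \<phi> t * (max 0 (1 - t / R\<^sup>2) * (1 + t / R\<^sup>2) / u t)" for t
  proof -
    have "u t - t * u' t = max 0 (1 - t / R\<^sup>2) * (1 + t / R\<^sup>2)"
      using R by (auto simp: u_def u'_def pos2_def max_def field_simps power2_eq_square)
    moreover have "\<phi> t + 2 * t * \<phi>' t = \<phi> t * ((u t - t * u' t) / u t)"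
      using u[of t] R by (simp add: \<phi>_def \<phi>'_def field_simps)
    ultimately show ?thesis by simp
  qed
  have phi: "\<phi> t > 0" for t using u[of t] R by (simp add: \<phi>_def)
  have big: "u ((norm y)\<^sup>2) = (norm y / R)\<^sup>2" "max 0 (1 - (norm y)\<^sup>2 / R\<^sup>2) = 0" if "norm y \<ge> R" for y :: "real^'n"
    using power_mono[OF that, of 2] R by (auto simp: u_def pos2_def max_def field_simps)
  have det: "det (DP y) = \<phi> ((norm y)\<^sup>2) ^ CARD('n) * (max 0 (1 - (norm y)\<^sup>2 / R\<^sup>2) * (1 + (norm y)\<^sup>2 / R\<^sup>2) / u ((norm y)\<^sup>2))" for y
    unfolding DP(2) key using power_eq_if[of "\<phi> ((norm y)\<^sup>2)" "CARD('n)"] by simp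
  show ?thesis
  proof (rule that[OF DP(1)])
    fix y :: "real^'n"
    show "\<phi> ((norm y)\<^sup>2) *\<^sub>R y = y /\<^sub>R norm y" if "norm y \<ge> R"
    proof -
      have "sqrt (u ((norm y)\<^sup>2)) = norm y / R"
        unfolding big(1)[OF that] real_sqrt_abs using R by simp
      then show ?thesis using that R by (simp add: \<phi>_def field_simps)
    qed
    show "det (DP y) \<ge> 0" unfolding det 
      using u[of "(norm y)\<^sup>2"] phi[of "(norm y)\<^sup>2"] R by (intro mult_nonneg_nonneg zero_le_power divide_nonneg_pos) auto
    show "det (DP y) = 0" if "norm y \<ge> R" unfolding det using big[OF that] by simp
    show "det (DP y) \<ge> 1 / (2 * R ^ CARD('n))" if y: "norm y \<le> R / 2"
    proof -
      define q where "q = (norm y)\<^sup>2 / R\<^sup>2"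
      have q: "0 \<le> q" "q \<le> 1/4"
        using power_mono[OF y, of 2] R by (auto simp: q_def field_simps)
      have uq: "u ((norm y)\<^sup>2) = 1 - q + q * q"
      proof -
        have "u ((norm y)\<^sup>2) = q + pos2 (1 - q)" by (simp add: u_def q_def)
        then show ?thesis using q by (simp add: pos2_def power2_eq_square algebra_simps)
      qed
      have u1: "0 < u ((norm y)\<^sup>2)" "u ((norm y)\<^sup>2) \<le> 1" 
        using u[of "(norm y)\<^sup>2"] q mult_left_le[of q q] by (auto simp: uq)
      have "1 / R \<le> \<phi> ((norm y)\<^sup>2)"
        using u1 R by (auto simp: \<phi>_def field_simps)
      then have "(1 / R) ^ CARD('n) \<le> \<phi> ((norm y)\<^sup>2) ^ CARD('n)" using R by (intro power_mono) auto
      moreover have "1 / 2 \<le> max 0 (1 - q) * (1 + q) / u ((norm y)\<^sup>2)"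
      proof -
        have "1 / 2 \<le> (1 - q) * (1 + q)" using q mult_mono[of q "1/4" q "1/4"] by (simp add: algebra_simps)
        also have "\<dots> \<le> (1 - q) * (1 + q) / u ((norm y)\<^sup>2)" using u1 q by (simp add: pos_le_divide_eq mult_left_le)
        finally show ?thesis using q by simp
      qed
      ultimately have "(1 / R) ^ CARD('n) * (1 / 2) \<le> \<phi> ((norm y)\<^sup>2) ^ CARD('n) * (max 0 (1 - q) * (1 + q) / u ((norm y)\<^sup>2))"
        using R phi[of "(norm y)\<^sup>2"] by (intro mult_mono) auto
      then show ?thesis unfolding det q_def[symmetric] by (simp add: power_one_over field_simps)
    qed
  qed
qed

text \<open>A \<open>C\<^sup>1\<close> function that climbs from 0 to 1 on the dyadic ring \<open>R / 2 \<le> |y| \<le> R\<close>. Sums of such steps replace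
the logarithm of \<open>|y|\<close>, with the advantage that the gradients have disjoint supports.\<close>

definition ring_step :: "real \<Rightarrow> real^'n::finite \<Rightarrow> real" where
  "ring_step R y = smoothstep ((4 * (norm y)\<^sup>2 / R\<^sup>2 - 1) / 3)"

definition ring_grad :: "real \<Rightarrow> real^'n::finite \<Rightarrow> real^'n" where
  "ring_grad R y = (smoothstep' ((4 * (norm y)\<^sup>2 / R\<^sup>2 - 1) / 3) * (8 / (3 * R\<^sup>2))) *\<^sub>R y"

lemma ring_step:
  fixes y :: "real^'n::finite"
  assumes R: "R > 0"
  shows "(ring_step R has_derivative (\<lambda>h. ring_grad R y \<bullet> h)) (at y)"
    "continuous_on UNIV (ring_grad R :: real^'n \<Rightarrow> real^'n)"
    "norm y \<le> R / 2 \<Longrightarrow> ring_step R y = 0" "norm y \<ge> R \<Longrightarrow> ring_step R y = 1"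
    "ring_grad R y \<noteq> 0 \<Longrightarrow> R / 2 < norm y \<and> norm y < R"
    "norm (ring_grad R y) \<le> 4 / R"
proof -
  have "((\<lambda>t. smoothstep ((4 * t / R\<^sup>2 - 1) / 3)) has_real_derivative 
      smoothstep' ((4 * (norm y)\<^sup>2 / R\<^sup>2 - 1) / 3) * (4 / (3 * R\<^sup>2))) (at ((norm y)\<^sup>2))"
    using R by (auto intro!: derivative_eq_intros simp: field_simps power2_eq_square power4_eq_xxxx)
  from has_derivative_norm_squared_compose[OF this]
  show "(ring_step R has_derivative (\<lambda>h. ring_grad R y \<bullet> h)) (at y)"
    unfolding ring_step_def[abs_def] ring_grad_def by (simp add: mult_ac)
  show "continuous_on UNIV (ring_grad R :: real^'n \<Rightarrow> real^'n)"
    unfolding ring_grad_def using R by (intro continuous_intros) auto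
  have low: "(4 * (norm y)\<^sup>2 / R\<^sup>2 - 1) / 3 \<le> 0" if "norm y \<le> R / 2"
    using power_mono[OF that, of 2] R by (simp add: field_simps)
  have high: "(4 * (norm y)\<^sup>2 / R\<^sup>2 - 1) / 3 \<ge> 1" if "norm y \<ge> R"
    using power_mono[OF that, of 2] R by (simp add: field_simps)
  show "norm y \<le> R / 2 \<Longrightarrow> ring_step R y = 0" "norm y \<ge> R \<Longrightarrow> ring_step R y = 1"
    using low high by (auto simp: ring_step_def smoothstep_simps)
  show ne: "R / 2 < norm y \<and> norm y < R" if "ring_grad R y \<noteq> 0"
    using that low high by (force simp: ring_grad_def smoothstep_simps)
  show "norm (ring_grad R y) \<le> 4 / R"
  proof (cases "ring_grad R y = 0")
    case False
    have "norm (ring_grad R y) = smoothstep' ((4 * (norm y)\<^sup>2 / R\<^sup>2 - 1) / 3) * (8 / (3 * R\<^sup>2)) * norm y"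
      using smoothstep'_bounds by (simp add: ring_grad_def abs_mult)
    also have "\<dots> \<le> 3 / 2 * (8 / (3 * R\<^sup>2)) * R"
      using smoothstep'_bounds ne[OF False] R by (intro mult_mono) auto
    also have "\<dots> = 4 / R" using R by (simp add: power2_eq_square)
    finally show ?thesis .
  qed (use R in auto)
qed

section \<open>Smooth kernels\<close>

text \<open>Differentiability of order \<open>k\<close> on the line, in the recursive form that matches \<open>C_k\<close>.\<close>

fun smooth_real :: "nat \<Rightarrow> (real \<Rightarrow> real) \<Rightarrow> bool" where
  "smooth_real 0 f \<longleftrightarrow> continuous_on UNIV f"
| "smooth_real (Suc k) f \<longleftrightarrow> (\<exists>f'. (\<forall>t. (f has_real_derivative f' t) (at t)) \<and> smooth_real k f')"

lemma smooth_real_imp_continuous: "smooth_real k f \<Longrightarrow> continuous_on UNIV f"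
  by (cases k) (auto intro: DERIV_continuous_on has_field_derivative_at_within)

lemma smooth_real_decrease: "smooth_real (Suc k) f \<Longrightarrow> smooth_real k f"
proof (induction k arbitrary: f)
  case 0
  then show ?case using smooth_real_imp_continuous smooth_real.simps(1) by blast
qed (metis smooth_real.simps(2))

lemma smooth_real_add: "smooth_real k f \<Longrightarrow> smooth_real k g \<Longrightarrow> smooth_real k (\<lambda>t. f t + g t)"
proof (induction k arbitrary: f g)
  case (Suc k)
  obtain f' g' where "\<forall>t. (f has_real_derivative f' t) (at t)" "smooth_real k f'"
     "\<forall>t. (g has_real_derivative g' t) (at t)" "smooth_real k g'" using Suc.prems by auto
  then have "\<forall>t. ((\<lambda>t. f t + g t) has_real_derivative f' t + g' t) (at t)" "smooth_real k (\<lambda>t. f' t + g' t)"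
    using Suc.IH by (auto intro: DERIV_add)
  then show ?case by (auto simp only: smooth_real.simps)
qed (auto intro: continuous_intros)

lemma smooth_real_mult: "smooth_real k f \<Longrightarrow> smooth_real k g \<Longrightarrow> smooth_real k (\<lambda>t. f t * g t)"
proof (induction k arbitrary: f g)
  case (Suc k)
  obtain f' g' where "\<forall>t. (f has_real_derivative f' t) (at t)" "smooth_real k f'"
     "\<forall>t. (g has_real_derivative g' t) (at t)" "smooth_real k g'" using Suc.prems by auto
  moreover have "smooth_real k f" "smooth_real k g" using Suc.prems by (auto intro: smooth_real_decrease simp del: smooth_real.simps)
  ultimately have "\<forall>t. ((\<lambda>t. f t * g t) has_real_derivative f' t * g t + g' t * f t) (at t)"
    "smooth_real k (\<lambda>t. f' t * g t + g' t * f t)"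
    using Suc.IH by (auto intro!: DERIV_mult smooth_real_add)
  then show ?case by (auto simp only: smooth_real.simps)
qed (auto intro: continuous_intros)

lemma smooth_real_const: "smooth_real k (\<lambda>_. c)"
  by (induction k arbitrary: c) (auto intro!: exI[of _ "\<lambda>_. 0"])

lemma smooth_real_affine: "smooth_real k f \<Longrightarrow> smooth_real k (\<lambda>t. f (c * t + d))"
proof (induction k arbitrary: f)
  case 0
  then show ?case by (auto intro!: continuous_intros continuous_on_compose2[of UNIV f])
next
  case (Suc k)
  then obtain f' where f': "\<forall>t. (f has_real_derivative f' t) (at t)" "smooth_real k f'" by auto
  have "\<forall>t. ((\<lambda>t. f (c * t + d)) has_real_derivative f' (c * t + d) * c) (at t)"
    by (rule allI, rule DERIV_chain2[OF f'(1)[rule_format]]) (auto intro!: derivative_eq_intros)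
  moreover have "smooth_real k (\<lambda>t. f' (c * t + d) * c)"
    by (rule smooth_real_mult[OF Suc.IH[OF f'(2)] smooth_real_const])
  ultimately show ?case unfolding smooth_real.simps by (intro exI[of _ "\<lambda>t. f' (c * t + d) * c"] conjI)
qed

text \<open>The functions \<open>q(1/t) exp(-1/t)\<close>, extended by 0 to \<open>t \<le> 0\<close>. With a polynomial factor \<open>q\<close> the class is closed
under differentiation, which gives smoothness of all orders at once.\<close>

definition exp_flat :: "real poly \<Rightarrow> real \<Rightarrow> real" where
  "exp_flat q t = (if t > 0 then poly q (1 / t) * exp (- (1 / t)) else 0)"

lemma tendsto_poly_exp_neg: "((\<lambda>u. poly q u * exp (- u)) \<longlongrightarrow> (0::real)) at_top"
proof -
  have "((\<lambda>u. \<Sum>i\<le>degree q. coeff q i * (u ^ i / exp u)) \<longlongrightarrow> (\<Sum>i\<le>degree q. coeff q i * (0::real))) at_top"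
    by (intro tendsto_intros tendsto_power_div_exp_0)
  moreover have "(\<Sum>i\<le>degree q. coeff q i * (u ^ i / exp u)) = poly q u * exp (- u)" for u :: real
    by (simp add: poly_altdef exp_minus sum_distrib_right divide_inverse mult.assoc)
  ultimately show ?thesis by simp
qed

lemma DERIV_exp_flat:
  "(exp_flat q has_real_derivative exp_flat ([:0, 0, 1:] * (q - pderiv q)) t) (at t)"
proof -
  consider "t < 0" | "t > 0" | "t = 0" by linarith
  then show ?thesis
  proof cases
    case 1
    have "((\<lambda>_. 0) has_real_derivative exp_flat ([:0, 0, 1:] * (q - pderiv q)) t) (at t)" using 1 by (simp add: exp_flat_def)
    then show ?thesis
      by (rule has_field_derivative_transform_within_open[where S="{..<0}"]) (use 1 in \<open>auto simp: exp_flat_def\<close>)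
  next
    case 2
    have "((\<lambda>t. poly q (1 / t) * exp (- (1 / t))) has_real_derivative
       (poly (pderiv q) (1 / t) * (- (1 / t\<^sup>2))) * exp (- (1 / t)) + (exp (- (1 / t)) * (1 / t\<^sup>2)) * poly q (1 / t)) (at t)"
      using 2 by (intro DERIV_mult poly_DERIV[THEN DERIV_chain2] DERIV_exp[THEN DERIV_chain2])
        (auto intro!: derivative_eq_intros simp: power2_eq_square)
    moreover have "(poly (pderiv q) (1 / t) * (- (1 / t\<^sup>2))) * exp (- (1 / t)) + (exp (- (1 / t)) * (1 / t\<^sup>2)) * poly q (1 / t)
      = exp_flat ([:0, 0, 1:] * (q - pderiv q)) t"
      using 2 by (simp add: exp_flat_def power2_eq_square algebra_simps)
    ultimately have "((\<lambda>t. poly q (1 / t) * exp (- (1 / t))) has_real_derivative exp_flat ([:0, 0, 1:] * (q - pderiv q)) t) (at t)"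
      by simp
    then show ?thesis
      by (rule has_field_derivative_transform_within_open[where S="{0<..}"]) (use 2 in \<open>auto simp: exp_flat_def\<close>)
  next
    case 3
    have "((\<lambda>h. (exp_flat q h - exp_flat q 0) / h) \<longlongrightarrow> 0) (at_right 0)"
    proof -
      have "((\<lambda>h::real. poly ([:0,1:] * q) (inverse h) * exp (- inverse h)) \<longlongrightarrow> 0) (at_right 0)"
        by (rule filterlim_compose[OF tendsto_poly_exp_neg filterlim_inverse_at_top_right])
      moreover have "\<forall>\<^sub>F h in at_right 0. poly ([:0,1:] * q) (inverse h) * exp (- inverse h) = (exp_flat q h - exp_flat q 0) / h"
        using eventually_at_right_less[of 0] by eventually_elim (auto simp: exp_flat_def field_simps)
      ultimately show ?thesis by (rule Lim_transform_eventually)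
    qed
    moreover have "((\<lambda>h. (exp_flat q h - exp_flat q 0) / h) \<longlongrightarrow> 0) (at_left 0)"
      by (rule tendsto_eventually) (auto simp: eventually_at_filter exp_flat_def)
    ultimately have "((\<lambda>h. (exp_flat q h - exp_flat q 0) / h) \<longlongrightarrow> 0) (at 0)"
      by (simp add: filterlim_at_split)
    with 3 show ?thesis by (simp add: DERIV_def exp_flat_def)
  qed
qed

lemma smooth_real_exp_flat: "smooth_real k (exp_flat q)"
proof (induction k arbitrary: q)
  case 0
  show ?case by (auto intro: DERIV_continuous_on has_field_derivative_at_within DERIV_exp_flat)
next
  case (Suc k)
  then show ?case using DERIV_exp_flat by auto
qed

definition bump :: "real \<Rightarrow> real" where "bump t = exp_flat 1 (1 + t) * exp_flat 1 (1 - t)"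

lemma bump: "smooth_real k bump" "0 \<le> bump t" "\<bar>t\<bar> \<ge> 1 \<Longrightarrow> bump t = 0" "bump 0 > 0"
proof -
  have "smooth_real k (\<lambda>t. exp_flat 1 (1 * t + 1))" "smooth_real k (\<lambda>t. exp_flat 1 ((-1) * t + 1))"
    by (rule smooth_real_affine[OF smooth_real_exp_flat])+
  from smooth_real_mult[OF this] show "smooth_real k bump"
    by (simp add: bump_def[abs_def] add.commute)
qed (auto simp: bump_def exp_flat_def)

lemma has_derivative_prod_component:
  fixes b :: "'n::finite \<Rightarrow> real \<Rightarrow> real"
  assumes b: "\<And>i t. (b i has_real_derivative b' i t) (at t)"
  shows "((\<lambda>x::real^'n. \<Prod>i\<in>UNIV. b i (x$i)) has_derivative
    (\<lambda>h. \<Sum>j\<in>UNIV. (\<Prod>i\<in>UNIV. (if i = j then b' j else b i) (x$i)) * h$j)) (at x)"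
proof -
  have bi: "((\<lambda>x::real^'n. b i (x$i)) has_derivative (\<lambda>h. b' i (x$i) * h$i)) (at x)" for i
    by (rule has_derivative_compose[OF bounded_linear_imp_has_derivative[OF bounded_linear_vec_nth]])
      (use b in \<open>simp add: has_field_derivative_def\<close>)
  have "((\<lambda>x::real^'n. \<Prod>i\<in>UNIV. b i (x$i)) has_derivative
    (\<lambda>h. \<Sum>j\<in>UNIV. (b' j (x$j) * h$j) * (\<Prod>i\<in>UNIV-{j}. b i (x$i)))) (at x)"
    by (rule has_derivative_prod) (rule bi)
  moreover have "(b' j (x$j) * h$j) * (\<Prod>i\<in>UNIV-{j}. b i (x$i)) = (\<Prod>i\<in>UNIV. (if i = j then b' j else b i) (x$i)) * h$j" for j h
    by (subst prod.remove[of UNIV j]) (auto intro!: prod.cong)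
  ultimately show ?thesis by simp
qed

lemma partial_deriv_prod_component:
  fixes b :: "'n::finite \<Rightarrow> real \<Rightarrow> real"
  assumes b: "\<And>i t. (b i has_real_derivative b' i t) (at t)"
  shows "partial_deriv j (\<lambda>x::real^'n. \<Prod>i\<in>UNIV. b i (x$i)) = (\<lambda>x. \<Prod>i\<in>UNIV. (if i = j then b' j else b i) (x$i))"
proof
  fix x :: "real^'n"
  show "partial_deriv j (\<lambda>x::real^'n. \<Prod>i\<in>UNIV. b i (x$i)) x = (\<Prod>i\<in>UNIV. (if i = j then b' j else b i) (x$i))"
    unfolding partial_deriv_def frechet_derivative_at[OF has_derivative_prod_component[OF b], symmetric]
    by (subst sum.remove[of _ j]) (auto simp: axis_def)
qed

text \<open>A partial derivative of a product of functions of one coordinate each is again such a product. Therefore the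
induction on \<open>k\<close> never leaves this class.\<close>

lemma C_k_prod_component:
  fixes b :: "'n::finite \<Rightarrow> real \<Rightarrow> real"
  assumes "\<And>i m. smooth_real m (b i)"
  shows "C_k k (\<lambda>x::real^'n. \<Prod>i\<in>UNIV. b i (x$i))"
  using assms
proof (induction k arbitrary: b)
  case 0
  have "continuous_on UNIV (b i)" for i using 0[of 0 i] by simp
  then have "continuous_on UNIV (\<lambda>x::real^'n. b i (x$i))" for i
    by (rule continuous_on_compose2) (auto intro: continuous_intros)
  then show ?case by (simp add: continuous_on_prod)
next
  case (Suc k)
  have "\<forall>i. \<exists>f'. \<forall>t. (b i has_real_derivative f' t) (at t)" using Suc.prems[of "Suc 0"] by auto
  then obtain b' where b': "\<And>i t. (b i has_real_derivative b' i t) (at t)" by metis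
  have sm: "smooth_real m (b' i)" for i m
  proof -
    obtain f' where f': "\<forall>t. (b i has_real_derivative f' t) (at t)" "smooth_real m f'"
      using Suc.prems[of "Suc m" i] by auto
    then have "f' = b' i" using b' DERIV_unique by blast
    then show ?thesis using f' by simp
  qed
  have "C_k k (partial_deriv j (\<lambda>x::real^'n. \<Prod>i\<in>UNIV. b i (x$i)))" for j
    unfolding partial_deriv_prod_component[OF b'] using Suc.prems sm by (intro Suc.IH) auto
  moreover have "(\<lambda>x::real^'n. \<Prod>i\<in>UNIV. b i (x$i)) differentiable (at x)" for x
    using has_derivative_prod_component[where b=b, OF b'] unfolding differentiable_def by blast
  ultimately show ?case by simp
qed

text \<open>The clause on test functions concerns reflected translates, because the value of a mollified weak derivative
at \<open>x\<close> is a pairing with the function \<open>y \<mapsto> K (x - y)\<close>.\<close>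

definition mollifier :: "real \<Rightarrow> (real^'n::finite \<Rightarrow> real) \<Rightarrow> (real^'n \<Rightarrow> real^'n) \<Rightarrow> bool" where
  "mollifier \<epsilon> K dK \<longleftrightarrow> (\<forall>z. 0 \<le> K z) \<and> continuous_on UNIV K \<and> (\<forall>z. z \<notin> cbox (\<chi> i. - \<epsilon>) (\<chi> i. \<epsilon>) \<longrightarrow> K z = 0 \<and> dK z = 0)
     \<and> (K has_integral 1) UNIV \<and> (\<forall>x. test_function (\<lambda>y. K (x - y))) 
     \<and> (\<forall>z. (K has_derivative (\<lambda>h. dK z \<bullet> h)) (at z)) \<and> continuous_on UNIV dK"

lemma mollifier_exists:
  assumes \<epsilon>: "\<epsilon> > 0"
  obtains K dK where "mollifier \<epsilon> (K :: real^'n::finite \<Rightarrow> real) dK"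
proof -
  obtain bump' where bump': "\<And>t. (bump has_real_derivative bump' t) (at t)" and cb': "continuous_on UNIV bump'"
    using bump(1)[of "Suc 0"] by auto
  define K0 where "K0 z = (\<Prod>i\<in>UNIV. bump (z$i / \<epsilon>))" for z :: "real^'n"
  let ?C = "cbox (\<chi> i. - \<epsilon>) (\<chi> i. \<epsilon>) :: (real^'n) set"
  have der: "((\<lambda>t. bump (t / \<epsilon>)) has_real_derivative bump' (t / \<epsilon>) * (1 / \<epsilon>)) (at t)" for t
    by (rule DERIV_chain2[OF bump']) (use \<epsilon> in \<open>auto intro!: derivative_eq_intros\<close>)
  define d0 where "d0 z = (\<chi> j. \<Prod>i\<in>UNIV. (if i = j then (\<lambda>t. bump' (t / \<epsilon>) * (1 / \<epsilon>)) else (\<lambda>t. bump (t / \<epsilon>))) (z$i))" for z :: "real^'n"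
  have derK: "(K0 has_derivative (\<lambda>h. d0 z \<bullet> h)) (at z)" for z
    using has_derivative_prod_component[of "\<lambda>_ t. bump (t / \<epsilon>)" "\<lambda>_ t. bump' (t / \<epsilon>) * (1 / \<epsilon>)" z] der
    by (simp add: K0_def[abs_def] d0_def inner_vec_def)
  have cbump: "continuous_on UNIV bump" using bump(1)[of 0] by simp
  have cd: "continuous_on UNIV d0"
  proof -
    have "continuous_on UNIV (\<lambda>t. bump (t / \<epsilon>))" "continuous_on UNIV (\<lambda>t. bump' (t / \<epsilon>) * (1 / \<epsilon>))"
      by (intro continuous_on_mult continuous_on_const continuous_on_compose2[OF cbump] continuous_on_compose2[OF cb'],
          use \<epsilon> in \<open>auto intro!: continuous_intros\<close>)+
    then have c: "continuous_on UNIV ((if i = j then (\<lambda>t. bump' (t / \<epsilon>) * (1 / \<epsilon>)) else (\<lambda>t. bump (t / \<epsilon>))))" for i j :: 'n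
      by simp
    show ?thesis unfolding d0_def
      by (intro continuous_on_vec_lambda continuous_on_prod continuous_on_compose2[OF c]) (auto intro: continuous_intros)
  qed
  have cK: "continuous_on UNIV K0"
    by (meson derK continuous_at_imp_continuous_on has_derivative_continuous)
  have K0: "K0 z \<ge> 0" for z unfolding K0_def by (intro prod_nonneg ballI bump(2))
  have supp: "K0 z = 0" if "z \<notin> ?C" for z
  proof -
    have "\<exists>i. \<not> (- \<epsilon> \<le> z$i \<and> z$i \<le> \<epsilon>)" using that by (simp add: mem_box_cart)
    then obtain i where "\<not> (- \<epsilon> \<le> z$i \<and> z$i \<le> \<epsilon>)" by blast
    then have "z$i < - \<epsilon> \<or> z$i > \<epsilon>" by linarith
    then have "\<bar>z$i / \<epsilon>\<bar> \<ge> 1" using \<epsilon> by (auto simp: field_simps abs_if)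
    then show ?thesis unfolding K0_def by (intro prod_zero bexI[of _ i] bump(3)) auto
  qed
  have dsupp: "d0 z = 0" if "z \<notin> ?C" for z
  proof -
    have "((\<lambda>_. 0) has_derivative (\<lambda>h. 0::real)) (at z)" by simp
    then have "(K0 has_derivative (\<lambda>h. 0)) (at z)"
      by (rule has_derivative_transform_within_open[where s="- ?C"]) (use that supp in \<open>auto simp: open_Compl closed_cbox\<close>)
    then have "(\<lambda>h. d0 z \<bullet> h) = (\<lambda>h. 0)" by (rule has_derivative_unique[OF derK])
    from fun_cong[OF this, of "d0 z"] show ?thesis by simp
  qed
  define Z where "Z = integral ?C K0"
  have intK: "K0 integrable_on ?C" by (intro integrable_continuous continuous_on_subset[OF cK]) auto
  have Z: "Z > 0"
  proof -
    have "Z \<noteq> 0"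
    proof
      assume "Z = 0"
      have "content ?C > 0" using \<epsilon> by (simp add: content_pos_lt_eq Basis_vec_def inner_axis)
      then have "K0 0 = 0"
        using has_integral_0_cbox_imp_0[of "\<chi> i. - \<epsilon>" "\<chi> i. \<epsilon>" K0 0] continuous_on_subset[OF cK] K0 intK \<epsilon> \<open>Z = 0\<close>
        by (auto simp: Z_def has_integral_integral content_pos_lt_eq mem_box_cart box_ne_empty Basis_vec_def inner_axis)
      moreover have "K0 0 > 0" unfolding K0_def using bump(4) by (simp add: prod_pos)
      ultimately show False by simp
    qed
    moreover have "Z \<ge> 0" unfolding Z_def by (rule integral_nonneg[OF intK K0])
    ultimately show ?thesis by simp
  qed
  have hasZ: "(K0 has_integral Z) UNIV"
    by (rule has_integral_on_superset[of K0 _ ?C]) (use intK supp in \<open>auto simp: Z_def has_integral_integral\<close>)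
  have test: "test_function (\<lambda>y. K0 (x - y) / Z)" for x
  proof -
    obtain l :: 'n where True by simp
    let ?b = "\<lambda>i t. (if i = l then 1 / Z else 1) * bump ((- 1 / \<epsilon>) * t + x$i / \<epsilon>)"
    have "smooth_real m (?b i)" for i m
      by (rule smooth_real_mult[OF smooth_real_const smooth_real_affine[OF bump(1)]])
    then have "C_k k (\<lambda>y::real^'n. \<Prod>i\<in>UNIV. ?b i (y$i))" for k by (rule C_k_prod_component)
    moreover have "(\<Prod>i\<in>UNIV. ?b i (y$i)) = K0 (x - y) / Z" for y :: "real^'n"
      unfolding prod.distrib K0_def by (simp add: diff_divide_distrib algebra_simps prod.delta)
    moreover have "closure {y. K0 (x - y) / Z \<noteq> 0} \<subseteq> cbox (x - (\<chi> i. \<epsilon>)) (x + (\<chi> i. \<epsilon>))"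
    proof (rule closure_minimal[OF _ closed_cbox], safe)
      fix y assume "K0 (x - y) / Z \<noteq> 0"
      then have "x - y \<in> ?C" using supp by fastforce
      then show "y \<in> cbox (x - (\<chi> i. \<epsilon>)) (x + (\<chi> i. \<epsilon>))"
        by (auto simp: mem_box_cart algebra_simps)
    qed
    then have "compact (closure {y. K0 (x - y) / Z \<noteq> 0})"
      by (meson bounded_cbox bounded_subset closed_closure compact_eq_bounded_closed)
    ultimately show ?thesis by (simp add: test_function_def)
  qed
  have "mollifier \<epsilon> (\<lambda>z. K0 z / Z) (\<lambda>z. d0 z /\<^sub>R Z)"
    unfolding mollifier_def
  proof (intro conjI allI impI)
    show "0 \<le> K0 z / Z" for z using K0 Z by simp
    show "continuous_on UNIV (\<lambda>z. K0 z / Z)" using cK Z by (intro continuous_intros) auto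
    show "((\<lambda>z. K0 z / Z) has_integral 1) UNIV" using has_integral_divide[OF hasZ, of Z] Z by simp
    have eq: "(\<lambda>h. (d0 z /\<^sub>R Z) \<bullet> h) = (\<lambda>h. inverse Z *\<^sub>R (d0 z \<bullet> h))" for z by simp
    show "((\<lambda>z. K0 z / Z) has_derivative (\<lambda>h. (d0 z /\<^sub>R Z) \<bullet> h)) (at z)" for z
      unfolding eq using has_derivative_scaleR_right[OF derK, of "inverse Z" z] by (simp add: divide_inverse mult.commute)
    show "continuous_on UNIV (\<lambda>z. d0 z /\<^sub>R Z)" using cd by (intro continuous_intros)
  qed (use supp dsupp test in auto)
  then show ?thesis by (rule that)
qed

section \<open>Morrey's inequality on slices of cubes\<close>

definition cube :: "real^'n::finite \<Rightarrow> real \<Rightarrow> (real^'n) set" where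
  "cube x \<rho> = cbox (x - (\<chi> i. \<rho>)) (x + (\<chi> i. \<rho>))"

lemma mem_cube: "z \<in> cube x \<rho> \<longleftrightarrow> (\<forall>i. \<bar>z$i - x$i\<bar> \<le> \<rho>)"
  by (auto simp: cube_def mem_box_cart abs_diff_le_iff algebra_simps)

lemma cube_mono: "\<rho> \<le> \<sigma> \<Longrightarrow> cube x \<rho> \<subseteq> cube x \<sigma>"
  unfolding subset_iff mem_cube by (meson order_trans)

lemma content_cube: "\<rho> \<ge> 0 \<Longrightarrow> content (cube x \<rho> :: (real^'n::finite) set) = (2 * \<rho>) ^ CARD('n)"
  by (simp add: cube_def content_cbox_if_cart box_ne_empty Basis_vec_def inner_axis interval_eq_empty_cart not_less)

lemma frontier_cube: "p \<in> frontier (cube x \<rho>) \<Longrightarrow> \<exists>i. \<bar>p$i - x$i\<bar> = \<rho>"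
proof -
  assume "p \<in> frontier (cube x \<rho>)"
  then have p: "p \<in> cube x \<rho>" "p \<notin> box (x - (\<chi> i. \<rho>)) (x + (\<chi> i. \<rho>))"
    by (auto simp: cube_def frontier_cbox)
  then obtain i where "\<not> (x$i - \<rho> < p$i \<and> p$i < x$i + \<rho>)" by (auto simp: mem_box_cart)
  moreover have "\<bar>p$i - x$i\<bar> \<le> \<rho>" using p by (simp add: mem_cube)
  ultimately show ?thesis by (intro exI[of _ i]) (auto simp: abs_if split: if_splits)
qed

text \<open>A weight \<open>\<kappa>\<close> on the target of size \<open>R\<^sup>-\<^sup>n\<close> on the ball of radius \<open>R / 2\<close>, for which the integral of \<open>\<kappa>(f) J\<close> over
any cube is at most \<open>C\<close>. The constant \<open>C\<close> plays the part of the degree of \<open>f\<close> at infinity.\<close>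

definition degree_weight ::
    "(real^'n::finite \<Rightarrow> real^'n) \<Rightarrow> (real^'n \<Rightarrow> real^'n^'n) \<Rightarrow> real \<Rightarrow> real \<Rightarrow> (real^'n \<Rightarrow> real) \<Rightarrow> bool" where
  "degree_weight f D C R \<kappa> \<longleftrightarrow> continuous_on UNIV \<kappa> \<and> (\<forall>y. 0 \<le> \<kappa> y) \<and>
    (\<forall>y. norm y \<le> R / 2 \<longrightarrow> 1 / (2 * R ^ CARD('n)) \<le> \<kappa> y) \<and>
    (\<forall>x \<rho>. integrable lborel (\<lambda>z. indicator (cube x \<rho>) z * (\<kappa> (f z) * det (D z))) \<and>
      (LINT z|lborel. indicator (cube x \<rho>) z * (\<kappa> (f z) * det (D z))) \<le> C)"

definition upd :: "'n::finite \<Rightarrow> real \<Rightarrow> real^'n \<Rightarrow> real^'n" where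
  "upd i s z = (\<chi> j. if j = i then s else z$j)"

lemma upd_nth [simp]: "upd i s z $ j = (if j = i then s else z$j)" by (simp add: upd_def)

lemma upd_upd_same [simp]: "upd i (z$i) (upd i s z) = z" "upd i (z$i) z = z"
  by (simp_all add: vec_eq_iff)

lemma continuous_on_upd [continuous_intros]:
  assumes "continuous_on S f" "continuous_on S h"
  shows "continuous_on S (\<lambda>x. upd i (f x) (h x))"
  unfolding upd_def
proof (intro continuous_on_vec_lambda)
  show "continuous_on S (\<lambda>x. if j = i then f x else h x $ j)" for j
    using assms by (cases "j = i") (auto intro: continuous_intros)
qed

text \<open>Averaging a function over all slices orthogonal to a coordinate axis. The slices are not integrated over a
space of lower dimension: the function is made constant in direction \<open>i\<close> and integrated over the whole box.
The map that exchanges the free variable \<open>s\<close> with the \<open>i\<close>-th coordinate permutes the coordinates of the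
product space and therefore preserves volumes of boxes.\<close>

lemma integral_upd_Fubini:
  fixes F :: "real^'n::finite \<Rightarrow> real"
  assumes F: "continuous_on UNIV F" and ne: "c$i \<le> e$i"
  shows "integral {c$i..e$i} (\<lambda>s. integral (cbox c e) (\<lambda>z. F (upd i s z))) = (e$i - c$i) * integral (cbox c e) F"
proof -
  let ?g = "\<lambda>(z, s). (upd i s z, z$i) :: (real^'n) \<times> real"
  let ?B = "cbox (c, c$i) (e, e$i)"
  have gg: "?g (?g x) = x" for x by (cases x) (auto simp: vec_eq_iff)
  have im: "?g ` cbox (u, \<alpha>) (v, \<beta>) = cbox (upd i \<alpha> u, u$i) (upd i \<beta> v, v$i)" for u v :: "real^'n" and \<alpha> \<beta>
  proof -
    have sub: "?g ` cbox (u, \<alpha>) (v, \<beta>) \<subseteq> cbox (upd i \<alpha> u, u$i) (upd i \<beta> v, v$i)" for u v :: "real^'n" and \<alpha> \<beta>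
      by (auto simp: cbox_Pair_eq mem_box_cart)
    have "?g ` cbox (upd i \<alpha> u, u$i) (upd i \<beta> v, v$i) \<subseteq> cbox (u, \<alpha>) (v, \<beta>)"
      using sub[of "upd i \<alpha> u" "u$i" "upd i \<beta> v" "v$i"] by simp
    then have "?g ` (?g ` cbox (upd i \<alpha> u, u$i) (upd i \<beta> v, v$i)) \<subseteq> ?g ` cbox (u, \<alpha>) (v, \<beta>)" by (rule image_mono)
    then show ?thesis using sub[of u \<alpha> v \<beta>] unfolding image_image gg by auto
  qed
  have im': "\<exists>w z. ?g ` cbox a b = cbox w z" for a b
    using im[of "fst a" "snd a" "fst b" "snd b"] by auto
  \<comment> \<open>The side lengths are merely permuted.\<close>
  have content: "content (?g ` cbox a b) = 1 * content (cbox a b)" for a b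
  proof -
    obtain u \<alpha> v \<beta> where ab: "a = (u, \<alpha>)" "b = (v, \<beta>)" by (cases a, cases b) auto
    have ne: "cbox u v = {} \<or> cbox \<alpha> \<beta> = {} \<longleftrightarrow> cbox (upd i \<alpha> u) (upd i \<beta> v) = {} \<or> cbox (u$i) (v$i) = {}"
      by (simp add: interval_eq_empty_cart not_le) metis
    have "(\<Prod>j\<in>UNIV. v$j - u$j) * (\<beta> - \<alpha>) = (\<Prod>j\<in>UNIV. upd i \<beta> v$j - upd i \<alpha> u$j) * (v$i - u$i)"
      by (simp add: prod.remove[of UNIV i] del: prod.If_cases)
    then show ?thesis
      unfolding ab im content_Pair content_cbox_if_cart using ne by (auto simp: content_real_if)
  qed
  have cF: "continuous_on S (\<lambda>(z, s). F (upd i s z))" for S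
    unfolding split_beta by (intro continuous_on_compose2[OF F] continuous_intros) auto
  have cF1: "continuous_on S (\<lambda>(z, s::real). F z)" for S
    unfolding split_beta by (intro continuous_on_compose2[OF F] continuous_intros) auto
  have "integral {c$i..e$i} (\<lambda>s. integral (cbox c e) (\<lambda>z. F (upd i s z))) = integral (cbox c e) (\<lambda>z. integral (cbox (c$i) (e$i)) (\<lambda>s. F (upd i s z)))"
    unfolding cbox_interval[symmetric]
    by (rule integral_swap_continuous[symmetric]) (rule cF)
  also have "\<dots> = integral ?B (\<lambda>(z, s). F (upd i s z))"
    using integral_prod_continuous[OF cF] by simp
  also have "\<dots> = integral ?B (\<lambda>(z, s::real). F z)"
  proof -
    have "((\<lambda>x. (\<lambda>(z, s::real). F z) (?g x)) has_integral (1 / 1) *\<^sub>R integral ?B (\<lambda>(z, s::real). F z)) (?g ` ?B)"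
    proof (rule has_integral_twiddle[OF zero_less_one gg gg _ im' im' content])
      have "continuous_on UNIV ?g" unfolding split_beta by (intro continuous_intros)
      then show "continuous (at x) ?g" for x
        unfolding continuous_on_eq_continuous_at[OF open_UNIV] by blast
      show "((\<lambda>(z, s::real). F z) has_integral integral ?B (\<lambda>(z, s::real). F z)) ?B"
        by (intro integrable_integral integrable_continuous cF1)
    qed
    moreover have "?g ` ?B = ?B" unfolding im by simp
    moreover have "(\<lambda>x. (\<lambda>(z, s::real). F z) (?g x)) = (\<lambda>(z, s). F (upd i s z))" by auto
    ultimately show ?thesis by (simp add: integral_unique)
  qed
  also have "\<dots> = integral (cbox c e) (\<lambda>z. integral (cbox (c$i) (e$i)) (\<lambda>s::real. F z))"
    using integral_prod_continuous[OF cF1] by simp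
  also have "\<dots> = (e$i - c$i) * integral (cbox c e) F"
    using ne by simp
  finally show ?thesis .
qed

text \<open>Contracting a slice towards one of its points \<open>p\<close> by the factor \<open>t\<close> multiplies its measure of dimension
\<open>n - 1\<close> by \<open>t\<^sup>n\<^sup>-\<^sup>1\<close>, and the contracted slice is contained in the original one.\<close>

lemma integral_slice_scale:
  fixes F :: "real^'n::finite \<Rightarrow> real"
  assumes F: "continuous_on UNIV F" "\<And>z. F z \<ge> 0" and t: "0 < t" "t \<le> 1" and p: "p \<in> cube x \<rho>" "p$i = s"
  shows "integral (cube x \<rho>) (\<lambda>z. F (p + t *\<^sub>R (upd i s z - p))) \<le> integral (cube x \<rho>) (\<lambda>z. F (upd i s z)) / t ^ (CARD('n) - 1)"
proof -
  define m where "m k = (if k = i then 1 else t)" for k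
  define c where "c = (\<chi> k. (1 - m k) * p$k)"
  define H where "H z = F (upd i s z)" for z
  have cH: "continuous_on S H" for S unfolding H_def by (intro continuous_on_compose2[OF F(1)] continuous_intros) auto
  let ?a = "x - (\<chi> i. \<rho>)" and ?b = "x + (\<chi> i. \<rho>)"
  define a' where "a' = (\<chi> k. m k * ?a$k + c$k)"
  define b' where "b' = (\<chi> k. m k * ?b$k + c$k)"
  have m: "m k > 0" "m k \<le> 1" for k using t by (auto simp: m_def)
  have sub: "cbox a' b' \<subseteq> cube x \<rho>"
  proof
    fix z assume z: "z \<in> cbox a' b'"
    show "z \<in> cube x \<rho>"
      unfolding mem_cube
    proof
      fix k
      have pk: "x$k - \<rho> \<le> p$k" "p$k \<le> x$k + \<rho>" using p(1) by (auto simp: mem_cube abs_diff_le_iff algebra_simps)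
      have "m k * (x$k - \<rho>) + (1 - m k) * p$k \<le> z$k" "z$k \<le> m k * (x$k + \<rho>) + (1 - m k) * p$k"
        using z by (auto simp: mem_box_cart a'_def b'_def c_def)
      moreover have "(1 - m k) * (x$k - \<rho>) \<le> (1 - m k) * p$k" "(1 - m k) * p$k \<le> (1 - m k) * (x$k + \<rho>)"
        using pk m[of k] by (auto intro: mult_left_mono)
      ultimately have "x$k - \<rho> \<le> z$k" "z$k \<le> x$k + \<rho>" by (auto simp: algebra_simps)
      then show "\<bar>z$k - x$k\<bar> \<le> \<rho>" by (simp add: abs_diff_le_iff)
    qed
  qed
  have iH: "H integrable_on cbox u v" for u v by (intro integrable_continuous cH)
  have "(H has_integral integral (cbox a' b') H) (cbox a' b')" using iH by blast
  then have "((\<lambda>z. H (z + c)) has_integral integral (cbox a' b') H) (cbox (a' - c) (b' - c))"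
    by (rule has_integral_shift_cbox)
  then have "((\<lambda>z. H ((\<chi> k. m k * z$k) + c)) has_integral integral (cbox a' b') H /\<^sub>R \<bar>prod m UNIV\<bar>) ((\<lambda>z. \<chi> k. z$k / m k) ` cbox (a' - c) (b' - c))"
    by (rule has_integral_stretch_cart) (use m in \<open>auto simp: less_imp_neq[symmetric]\<close>)
  moreover have "(\<lambda>z. \<chi> k. z$k / m k) ` cbox (a' - c) (b' - c) = cube x \<rho>"
  proof (intro set_eqI iffI)
    fix z assume "z \<in> (\<lambda>z. \<chi> k. z$k / m k) ` cbox (a' - c) (b' - c)"
    then obtain w where w: "z = (\<chi> k. w$k / m k)" "w \<in> cbox (a' - c) (b' - c)" by auto
    then have "\<And>k. m k * (x$k - \<rho>) \<le> w$k \<and> w$k \<le> m k * (x$k + \<rho>)" by (auto simp: mem_box_cart a'_def b'_def)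
    then show "z \<in> cube x \<rho>"
      using m unfolding cube_def mem_box_cart w(1) by (simp add: pos_le_divide_eq pos_divide_le_eq mult.commute)
  next
    fix z assume z: "z \<in> cube x \<rho>"
    have "z = (\<chi> k. (\<chi> k. m k * z$k)$k / m k)" using m(1) by (simp add: vec_eq_iff less_imp_neq[symmetric])
    moreover have "(\<chi> k. m k * z$k) \<in> cbox (a' - c) (b' - c)"
    proof -
      have "m k * (x$k - \<rho>) \<le> m k * z$k \<and> m k * z$k \<le> m k * (x$k + \<rho>)" for k
        using z m(1)[of k] unfolding cube_def mem_box_cart by (intro conjI mult_left_mono) auto
      then show ?thesis by (simp add: mem_box_cart a'_def b'_def)
    qed
    ultimately show "z \<in> (\<lambda>z. \<chi> k. z$k / m k) ` cbox (a' - c) (b' - c)" by (rule image_eqI)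
  qed
  moreover have "H ((\<chi> k. m k * z$k) + c) = F (p + t *\<^sub>R (upd i s z - p))" for z
  proof -
    have "upd i s ((\<chi> k. m k * z$k) + c) = p + t *\<^sub>R (upd i s z - p)"
      using p(2) by (auto simp: vec_eq_iff m_def c_def algebra_simps)
    then show ?thesis by (simp add: H_def)
  qed
  moreover have "\<bar>prod m UNIV\<bar> = t ^ (CARD('n) - 1)"
  proof -
    have "prod m UNIV = (\<Prod>k\<in>UNIV - {i}. t)" by (subst prod.remove[of UNIV i]) (auto simp: m_def)
    then show ?thesis using t by (simp add: card_Diff_singleton)
  qed
  ultimately have "integral (cube x \<rho>) (\<lambda>z. F (p + t *\<^sub>R (upd i s z - p))) = integral (cbox a' b') H / t ^ (CARD('n) - 1)"
    by (simp add: integral_unique divide_inverse mult.commute)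
  also have "\<dots> \<le> integral (cube x \<rho>) H / t ^ (CARD('n) - 1)"
    using t F(2) sub iH unfolding cube_def
    by (intro divide_right_mono integral_subset_le) (auto simp: H_def)
  finally show ?thesis unfolding H_def[abs_def] .
qed

text \<open>The graph of the \<open>n\<close>-th power lies above its tangents. This is the case of Jensen's inequality used below,
once for averages over cubes and once for mollification.\<close>

lemma power_tangent_le:
  fixes h c :: real
  assumes "h \<ge> 0" "c \<ge> 0" "n \<ge> 1"
  shows "c ^ n + real n * c ^ (n - 1) * (h - c) \<le> h ^ n"
proof (cases "c = 0")
  case True
  with assms show ?thesis by (cases "n = 1") (auto simp: power_0_left)
next
  case False
  then have c: "c > 0" using assms by simp
  have "1 + real n * (h / c - 1) \<le> (1 + (h / c - 1)) ^ n"
    using assms c by (intro Bernoulli_inequality) simp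
  then have "c ^ n * (1 + real n * (h / c - 1)) \<le> c ^ n * (h / c) ^ n" using c by (intro mult_left_mono) auto
  moreover have "c ^ n = c * c ^ (n - 1)" using assms(3) by (simp add: power_eq_if)
  then have "c ^ n * (1 + real n * (h / c - 1)) = c ^ n + real n * c ^ (n - 1) * (h - c)"
    using c by (simp add: field_simps)
  moreover have "c ^ n * (h / c) ^ n = h ^ n" using c by (simp add: power_divide)
  ultimately show ?thesis by simp
qed

lemma integral_average_power_le:
  fixes h :: "real^'n::finite \<Rightarrow> real"
  assumes h: "continuous_on (cbox a b) h" "\<And>z. h z \<ge> 0" and V: "content (cbox a b) > 0" and n: "n \<ge> 1"
  shows "(integral (cbox a b) h / content (cbox a b)) ^ n \<le> integral (cbox a b) (\<lambda>z. h z ^ n) / content (cbox a b)"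
proof -
  let ?V = "content (cbox a b)"
  define c where "c = integral (cbox a b) h / ?V"
  have ih: "h integrable_on cbox a b" by (intro integrable_continuous h)
  have c: "c \<ge> 0" using integral_nonneg[OF ih] h(2) V by (simp add: c_def)
  have lin: "((\<lambda>z. c ^ n + real n * c ^ (n - 1) * (h z - c)) has_integral
      (?V *\<^sub>R c ^ n + real n * c ^ (n - 1) * (integral (cbox a b) h - ?V *\<^sub>R c))) (cbox a b)"
    by (intro has_integral_add has_integral_mult_right has_integral_diff has_integral_const integrable_integral ih)
  have "integral (cbox a b) (\<lambda>z. c ^ n + real n * c ^ (n - 1) * (h z - c)) \<le> integral (cbox a b) (\<lambda>z. h z ^ n)"
  proof (rule integral_le)
    show "(\<lambda>z. c ^ n + real n * c ^ (n - 1) * (h z - c)) integrable_on cbox a b" using lin by blast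
    show "(\<lambda>z. h z ^ n) integrable_on cbox a b" by (intro integrable_continuous continuous_on_power h)
  qed (rule power_tangent_le[OF h(2) c n])
  also have "integral (cbox a b) (\<lambda>z. c ^ n + real n * c ^ (n - 1) * (h z - c)) = c ^ n * ?V + real n * c ^ (n - 1) * (integral (cbox a b) h - c * ?V)"
    using integral_unique[OF lin] by (simp add: mult.commute)
  also have "integral (cbox a b) h - c * ?V = 0" using V by (simp add: c_def)
  finally show ?thesis using V by (simp add: c_def[symmetric] field_simps)
qed


lemma power_powr_inverse:
  fixes a :: real
  assumes "0 \<le> a" "0 < n"
  shows "(a ^ n) powr (1 / real n) = a"
  using assms by (cases "a = 0") (simp_all add: powr_realpow[symmetric] powr_powr)

lemma le_powr_inverse_of_power_le:
  fixes a b :: real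
  assumes "0 \<le> a" "0 < n" "a ^ n \<le> b"
  shows "a \<le> b powr (1 / real n)"
  using powr_mono2[of "1 / real n" "a ^ n" b] power_powr_inverse[of a n] assms by simp

text \<open>The mean of \<open>g\<close> over the slice contracted to \<open>p\<close> by the factor \<open>t\<close> interpolates between \<open>g p\<close> at \<open>t = 0\<close> and
the mean of \<open>g\<close> over the slice at \<open>t = 1\<close>. By the inequalities of Jensen and \<open>integral_slice_scale\<close> its
derivative is at most a multiple of \<open>t\<close> to the power \<open>1/n - 1\<close>, which is integrable at 0. It is here that the
exponent \<open>n\<close> of the energy exceeds the dimension \<open>n - 1\<close> of the slice.\<close>

lemma morrey_slice:
  fixes g :: "real^'n::finite \<Rightarrow> real"
  assumes g: "\<And>x. (g has_derivative (\<lambda>h. d x \<bullet> h)) (at x)" and d: "continuous_on UNIV d"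
    and \<rho>: "\<rho> > 0" and p: "p \<in> cube x \<rho>" "p$i = s"
  shows "\<bar>g p - integral (cube x \<rho>) (\<lambda>z. g (upd i s z)) / content (cube x \<rho>)\<bar>
    \<le> 2 * real CARD('n) ^ 2 * \<rho> * (integral (cube x \<rho>) (\<lambda>z. norm (d (upd i s z)) ^ CARD('n)) / content (cube x \<rho>)) powr (1 / real CARD('n))"
proof -
  let ?n = "real CARD('n)"
  define V where "V = content (cube x \<rho>)"
  have V: "V > 0" unfolding V_def using \<rho> by (simp add: content_cube)
  define E where "E = integral (cube x \<rho>) (\<lambda>z. norm (d (upd i s z)) ^ CARD('n)) / V"
  have cg: "continuous_on UNIV g" by (meson g continuous_at_imp_continuous_on has_derivative_continuous)
  have n1: "?n \<ge> 1" by (simp add: Suc_leI)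
  have E: "E \<ge> 0" unfolding E_def using V
    by (intro divide_nonneg_pos integral_nonneg) (auto simp: cube_def intro!: integrable_continuous continuous_intros continuous_on_compose2[OF d])
  define m where "m t = integral (cube x \<rho>) (\<lambda>z. g (p + t *\<^sub>R (upd i s z - p))) / V" for t
  define m' where "m' t = integral (cube x \<rho>) (\<lambda>z. d (p + t *\<^sub>R (upd i s z - p)) \<bullet> (upd i s z - p)) / V" for t
  have der: "(m has_real_derivative m' t) (at t)" for t
  proof -
    have "((\<lambda>t. integral (cube x \<rho>) (\<lambda>z. g (p + t *\<^sub>R (upd i s z - p)))) has_real_derivative 
        integral (cube x \<rho>) (\<lambda>z. d (p + t *\<^sub>R (upd i s z - p)) \<bullet> (upd i s z - p))) (at t within UNIV)"
      unfolding cube_def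
    proof (rule leibniz_rule_field_derivative)
      show "((\<lambda>t. g (p + t *\<^sub>R (upd i s z - p))) has_real_derivative d (p + t *\<^sub>R (upd i s z - p)) \<bullet> (upd i s z - p)) (at t within UNIV)" for t z
      proof -
        have "((\<lambda>t. p + t *\<^sub>R (upd i s z - p)) has_derivative (\<lambda>h. h *\<^sub>R (upd i s z - p))) (at t)"
          by (auto intro!: derivative_eq_intros)
        from has_derivative_compose[OF this g] show ?thesis
          by (simp add: has_field_derivative_def mult_commute_abs)
      qed
      show "(\<lambda>z. g (p + t *\<^sub>R (upd i s z - p))) integrable_on cbox a b" for t a b
        by (intro integrable_continuous continuous_on_compose2[OF cg] continuous_intros) auto
      show "continuous_on (UNIV \<times> cbox a b) (\<lambda>(t, z). d (p + t *\<^sub>R (upd i s z - p)) \<bullet> (upd i s z - p))" for a b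
        unfolding split_beta by (intro continuous_intros continuous_on_compose2[OF d]) auto
    qed auto
    then show ?thesis unfolding m_def[abs_def] m'_def by (intro DERIV_cdivide) simp
  qed
  have bound: "\<bar>m' t\<bar> \<le> 2 * ?n * \<rho> * (E powr (1 / ?n) * t powr (1 / ?n - 1))" if t: "0 < t" "t \<le> 1" for t
  proof -
    let ?h = "\<lambda>z. norm (d (p + t *\<^sub>R (upd i s z - p)))"
    have ch: "continuous_on S ?h" for S by (intro continuous_intros continuous_on_compose2[OF d]) auto
    have dist: "norm (upd i s z - p) \<le> 2 * ?n * \<rho>" if z: "z \<in> cube x \<rho>" for z
    proof -
      have "norm (upd i s z - p) \<le> (\<Sum>j\<in>UNIV. \<bar>(upd i s z - p)$j\<bar>)" by (rule norm_le_l1_cart)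
      also have "\<dots> \<le> (\<Sum>j\<in>(UNIV::'n set). 2 * \<rho>)"
      proof (rule sum_mono)
        fix j
        have "\<bar>z$j - x$j\<bar> \<le> \<rho>" "\<bar>p$j - x$j\<bar> \<le> \<rho>" using z p(1) by (auto simp: mem_cube)
        then show "\<bar>(upd i s z - p)$j\<bar> \<le> 2 * \<rho>" using p(2) \<rho> by (auto simp: abs_if split: if_splits)
      qed
      finally show ?thesis by (simp add: mult_ac)
    qed
    have "\<bar>integral (cube x \<rho>) (\<lambda>z. d (p + t *\<^sub>R (upd i s z - p)) \<bullet> (upd i s z - p))\<bar> \<le> integral (cube x \<rho>) (\<lambda>z. 2 * ?n * \<rho> * ?h z)"
      unfolding real_norm_def[symmetric] cube_def
    proof (rule integral_norm_bound_integral)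
      show "(\<lambda>z. d (p + t *\<^sub>R (upd i s z - p)) \<bullet> (upd i s z - p)) integrable_on cbox a b" for a b
        by (intro integrable_continuous continuous_intros continuous_on_compose2[OF d]) auto
      show "(\<lambda>z. 2 * ?n * \<rho> * ?h z) integrable_on cbox a b" for a b
        by (intro integrable_continuous continuous_intros ch)
      fix z assume z: "z \<in> cbox (x - (\<chi> i. \<rho>)) (x + (\<chi> i. \<rho>))"
      have "norm (d (p + t *\<^sub>R (upd i s z - p)) \<bullet> (upd i s z - p)) \<le> ?h z * norm (upd i s z - p)"
        by (simp add: Cauchy_Schwarz_ineq2)
      also have "\<dots> \<le> ?h z * (2 * ?n * \<rho>)" using dist[of z] z by (intro mult_left_mono) (simp_all add: cube_def)
      finally show "norm (d (p + t *\<^sub>R (upd i s z - p)) \<bullet> (upd i s z - p)) \<le> 2 * ?n * \<rho> * ?h z" by (simp add: mult_ac)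
    qed
    also have "\<dots> = 2 * ?n * \<rho> * integral (cube x \<rho>) ?h" by simp
    finally have 1: "\<bar>m' t\<bar> \<le> 2 * ?n * \<rho> * (integral (cube x \<rho>) ?h / V)"
      using V by (simp add: m'_def divide_right_mono)
    have ih: "0 \<le> integral (cube x \<rho>) ?h / V" 
      using V unfolding cube_def by (intro divide_nonneg_pos integral_nonneg integrable_continuous ch) auto
    have "(integral (cube x \<rho>) ?h / V) ^ CARD('n) \<le> integral (cube x \<rho>) (\<lambda>z. ?h z ^ CARD('n)) / V"
      using V unfolding V_def cube_def by (intro integral_average_power_le ch) (auto simp: Suc_leI)
    also have "\<dots> \<le> (integral (cube x \<rho>) (\<lambda>z. norm (d (upd i s z)) ^ CARD('n)) / t ^ (CARD('n) - 1)) / V"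
      using V by (intro divide_right_mono integral_slice_scale[where F="\<lambda>w. norm (d w) ^ CARD('n)"] p t continuous_intros d) auto
    also have "\<dots> = E / t ^ (CARD('n) - 1)" by (simp add: E_def)
    finally have "(integral (cube x \<rho>) ?h / V) \<le> (E / t ^ (CARD('n) - 1)) powr (1 / ?n)"
      by (rule le_powr_inverse_of_power_le[OF ih zero_less_card_finite])
    also have "\<dots> = E powr (1 / ?n) * t powr (1 / ?n - 1)"
    proof -
      have "(t ^ (CARD('n) - 1)) powr (1 / ?n) = t powr ((?n - 1) * (1 / ?n))"
        using t n1 by (simp add: powr_realpow[symmetric] powr_powr of_nat_diff Suc_leI)
      also have "(?n - 1) * (1 / ?n) = - (1 / ?n - 1)" using n1 by (simp add: field_simps)
      finally have T: "(t ^ (CARD('n) - 1)) powr (1 / ?n) = inverse (t powr (1 / ?n - 1))" by (simp only: powr_minus)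
      have "(E / t ^ (CARD('n) - 1)) powr (1 / ?n) = E powr (1 / ?n) / (t ^ (CARD('n) - 1)) powr (1 / ?n)"
        by (rule powr_divide)
      then show ?thesis unfolding T by (simp add: divide_inverse)
    qed
    finally have "2 * ?n * \<rho> * (integral (cube x \<rho>) ?h / V) \<le> 2 * ?n * \<rho> * (E powr (1 / ?n) * t powr (1 / ?n - 1))"
      using \<rho> by (intro mult_left_mono) auto
    with 1 show ?thesis by linarith
  qed
  \<comment> \<open>A primitive of the bound for the derivative of \<open>m\<close>, vanishing at 0; then \<open>\<psi> - m\<close> and \<open>\<psi> + m\<close> are increasing.\<close>
  define \<psi> where "\<psi> t = 2 * ?n * \<rho> * (E powr (1 / ?n) * (?n * t powr (1 / ?n)))" for t
  have derpsi: "(\<psi> has_real_derivative 2 * ?n * \<rho> * (E powr (1 / ?n) * t powr (1 / ?n - 1))) (at t)" if "t > 0" for t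
  proof -
    have "((\<lambda>t. ?n * t powr (1 / ?n)) has_real_derivative ?n * (1 / ?n * t powr (1 / ?n - 1))) (at t)"
      using that by (intro DERIV_cmult has_real_derivative_powr)
    then have "((\<lambda>t. ?n * t powr (1 / ?n)) has_real_derivative t powr (1 / ?n - 1)) (at t)" by simp
    then show ?thesis unfolding \<psi>_def[abs_def] by (intro DERIV_cmult)
  qed
  have cm: "continuous_on {0..1} m" using der by (meson DERIV_continuous_on has_field_derivative_at_within)
  have cpsi: "continuous_on {0..1} \<psi>" unfolding \<psi>_def
    by (intro continuous_on_mult continuous_on_const continuous_on_powr' continuous_on_id) auto
  have "\<psi> 0 - m 0 \<le> \<psi> 1 - m 1"
  proof (rule DERIV_nonneg_imp_increasing_open[where f="\<lambda>t. \<psi> t - m t"])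
    show "\<exists>y. ((\<lambda>t. \<psi> t - m t) has_real_derivative y) (at t) \<and> 0 \<le> y" if "0 < t" "t < 1" for t
      by (rule exI, rule conjI, rule DERIV_diff[OF derpsi[OF that(1)] der]) (use bound[of t] that in auto)
  qed (auto intro!: continuous_intros cm cpsi)
  moreover have "\<psi> 0 + m 0 \<le> \<psi> 1 + m 1"
  proof (rule DERIV_nonneg_imp_increasing_open[where f="\<lambda>t. \<psi> t + m t"])
    show "\<exists>y. ((\<lambda>t. \<psi> t + m t) has_real_derivative y) (at t) \<and> 0 \<le> y" if "0 < t" "t < 1" for t
      by (rule exI, rule conjI, rule DERIV_add[OF derpsi[OF that(1)] der]) (use bound[of t] that in auto)
  qed (auto intro!: continuous_intros cm cpsi)
  moreover have "\<psi> 0 = 0" using n1 by (simp add: \<psi>_def)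
  moreover have "m 0 = g p" using V by (simp add: m_def) (simp add: V_def cube_def)
  moreover have "m 1 = integral (cube x \<rho>) (\<lambda>z. g (upd i s z)) / V" by (simp add: m_def)
  moreover have "\<psi> 1 = 2 * ?n ^ 2 * \<rho> * E powr (1 / ?n)" by (simp add: \<psi>_def power2_eq_square)
  ultimately show ?thesis unfolding V_def[symmetric] E_def[symmetric] by (simp add: abs_le_iff)
qed

section \<open>A Loewner-type lower bound for the energy\<close>

definition slice_energy :: "(real^'n::finite \<Rightarrow> real^'n) \<Rightarrow> real^'n \<Rightarrow> real \<Rightarrow> 'n \<Rightarrow> real \<Rightarrow> real" where
  "slice_energy d x \<rho> i s = integral (cube x \<rho>) (\<lambda>z. norm (d (upd i s z)) ^ CARD('n))"

lemma slice_energy_nonneg: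
  assumes "continuous_on UNIV d"
  shows "slice_energy d x \<rho> i s \<ge> 0"
  unfolding slice_energy_def cube_def
  by (intro integral_nonneg integrable_continuous continuous_intros continuous_on_compose2[OF assms]) auto

text \<open>Both values are compared with the mean over the slice. The side length of the cube cancels, because the
exponent \<open>n\<close> is the conformally invariant one.\<close>

lemma osc_face_le:
  fixes g :: "real^'n::finite \<Rightarrow> real"
  assumes g: "\<And>x. (g has_derivative (\<lambda>h. d x \<bullet> h)) (at x)" and d: "continuous_on UNIV d"
    and \<rho>: "\<rho> > 0" and p: "p \<in> cube x \<rho>" "p$i = s" and q: "q \<in> cube x \<rho>" "q$i = s"
  shows "\<bar>g p - g q\<bar> \<le> 2 * real CARD('n) ^ 2 * slice_energy d x \<rho> i s powr (1 / real CARD('n))"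
proof -
  let ?n = "real CARD('n)"
  let ?A = "slice_energy d x \<rho> i s"
  let ?r = "(?A / content (cube x \<rho>)) powr (1 / ?n)"
  have n: "?n > 0" by simp
  have "(2 * \<rho>) * ?r = ?A powr (1 / ?n)"
  proof -
    have "((2 * \<rho>) ^ CARD('n)) powr (1 / ?n) = 2 * \<rho>"
      using \<rho> by (intro power_powr_inverse) auto
    then show ?thesis
      using \<rho> slice_energy_nonneg[OF d, of x \<rho> i s] by (simp add: content_cube powr_divide)
  qed
  moreover have "\<bar>g p - g q\<bar> \<le> 2 * (2 * ?n ^ 2 * \<rho> * ?r)"
    using morrey_slice[OF g d \<rho> p] morrey_slice[OF g d \<rho> q] by (simp add: slice_energy_def abs_if split: if_splits)
  moreover have "2 * (2 * ?n ^ 2 * \<rho> * ?r) = 2 * ?n ^ 2 * ((2 * \<rho>) * ?r)" by (simp add: mult_ac)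
  ultimately show ?thesis by simp
qed

text \<open>Any two points of the boundary of a cube are joined by a chain of at most three steps, each within a single
face: points on faces orthogonal to different axes are joined through a point common to both faces, and points on
opposite faces through a face orthogonal to a second axis. This needs dimension at least two.\<close>

lemma osc_cube_boundary_le:
  fixes g :: "real^'n::finite \<Rightarrow> real"
  assumes n2: "CARD('n) \<ge> 2" and g: "\<And>x. (g has_derivative (\<lambda>h. d x \<bullet> h)) (at x)" and d: "continuous_on UNIV d"
    and \<rho>: "\<rho> > 0" and p: "p \<in> cube x \<rho>" "\<bar>p$i - x$i\<bar> = \<rho>" and q: "q \<in> cube x \<rho>" "\<bar>q$j - x$j\<bar> = \<rho>"
    and m: "0 \<le> m" "m \<le> \<bar>g p - g q\<bar>"
  shows "m ^ CARD('n) \<le> (6 * real CARD('n) ^ 2) ^ CARD('n) * (\<Sum>i\<in>UNIV. slice_energy d x \<rho> i (x$i + \<rho>) + slice_energy d x \<rho> i (x$i - \<rho>))"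
proof -
  let ?n = "real CARD('n)"
  define B where "B = (\<Sum>i\<in>UNIV. slice_energy d x \<rho> i (x$i + \<rho>) + slice_energy d x \<rho> i (x$i - \<rho>))"
  define \<beta> where "\<beta> = 2 * ?n ^ 2 * B powr (1 / ?n)"
  note nn = slice_energy_nonneg[OF d]
  have B0: "B \<ge> 0" unfolding B_def by (intro sum_nonneg add_nonneg_nonneg nn)
  have face: "\<bar>g u - g v\<bar> \<le> \<beta>" if uv: "u \<in> cube x \<rho>" "v \<in> cube x \<rho>" "u$k = v$k" "\<bar>u$k - x$k\<bar> = \<rho>" for u v k
  proof -
    have "u$k = x$k + \<rho> \<or> u$k = x$k - \<rho>" using uv(4) by (auto simp: abs_if split: if_splits)
    then have "slice_energy d x \<rho> k (u$k) \<le> slice_energy d x \<rho> k (x$k + \<rho>) + slice_energy d x \<rho> k (x$k - \<rho>)"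
      using nn by auto
    also have "\<dots> \<le> B" unfolding B_def by (rule member_le_sum) (auto intro: add_nonneg_nonneg nn)
    finally have "slice_energy d x \<rho> k (u$k) powr (1 / ?n) \<le> B powr (1 / ?n)" using nn by (intro powr_mono2) auto
    then have "2 * ?n ^ 2 * slice_energy d x \<rho> k (u$k) powr (1 / ?n) \<le> \<beta>" unfolding \<beta>_def by (intro mult_left_mono) auto
    with osc_face_le[OF g d \<rho> uv(1) refl uv(2) uv(3)[symmetric]] show ?thesis by linarith
  qed
  have updm: "upd k s u \<in> cube x \<rho>" if "u \<in> cube x \<rho>" "\<bar>s - x$k\<bar> = \<rho>" for u k s
    using that by (auto simp: mem_cube)
  have \<beta>0: "\<beta> \<ge> 0" by (simp add: \<beta>_def)
  have "\<bar>g p - g q\<bar> \<le> 3 * \<beta>"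
  proof (cases "i = j")
    case False
    define w where "w = upd j (q$j) p"
    have "\<bar>g p - g w\<bar> \<le> \<beta>" by (rule face[of _ _ i]) (use False p q updm in \<open>auto simp: w_def\<close>)
    moreover have "\<bar>g w - g q\<bar> \<le> \<beta>" by (rule face[of _ _ j]) (use False p q updm in \<open>auto simp: w_def\<close>)
    ultimately show ?thesis using \<beta>0 by linarith
  next
    case True
    obtain k where k: "k \<noteq> i" 
    proof -
      have "\<not> (UNIV :: 'n set) \<subseteq> {i}" using n2 card_mono[of "{i}" "UNIV :: 'n set"] by auto
      then show thesis using that by blast
    qed
    define w where "w = upd k (x$k + \<rho>) p"
    define w' where "w' = upd k (x$k + \<rho>) q"
    have "\<bar>g p - g w\<bar> \<le> \<beta>" by (rule face[of _ _ i]) (use k p q \<rho> updm in \<open>auto simp: w_def\<close>)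
    moreover have "\<bar>g w - g w'\<bar> \<le> \<beta>" by (rule face[of _ _ k]) (use k p q \<rho> updm in \<open>auto simp: w_def w'_def\<close>)
    moreover have "\<bar>g w' - g q\<bar> \<le> \<beta>" by (rule face[of _ _ j]) (use True k p q \<rho> updm in \<open>auto simp: w'_def\<close>)
    ultimately show ?thesis by linarith
  qed
  with m have "m \<le> 3 * \<beta>" by linarith
  then have "m ^ CARD('n) \<le> (6 * ?n ^ 2 * B powr (1 / ?n)) ^ CARD('n)" using m(1) by (intro power_mono) (auto simp: \<beta>_def)
  also have "\<dots> = (6 * ?n ^ 2) ^ CARD('n) * (B powr (1 / ?n)) ^ CARD('n)" by (rule power_mult_distrib)
  also have "(B powr (1 / ?n)) ^ CARD('n) = B"
    using B0 by (cases "B = 0") (auto simp: powr_realpow[symmetric] powr_powr)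
  finally show ?thesis by (simp add: B_def)
qed

text \<open>The bound for the boundary of a single cube is integrated over the half side \<open>\<rho>\<close>. As \<open>\<rho>\<close> varies, the faces
with a given normal sweep out slices of the largest cube, and Fubini turns the integral of the energies of the
slices into the energy of that cube.\<close>

lemma loewner_cubes:
  fixes g :: "real^'n::finite \<Rightarrow> real"
  assumes n2: "CARD('n) \<ge> 2" and g: "\<And>x. (g has_derivative (\<lambda>h. d x \<bullet> h)) (at x)" and d: "continuous_on UNIV d"
    and r: "0 < \<rho>1" "\<rho>1 \<le> \<rho>2" and m: "0 \<le> m"
    and osc: "\<And>\<rho>. \<rho>1 \<le> \<rho> \<Longrightarrow> \<rho> \<le> \<rho>2 \<Longrightarrow> \<exists>p\<in>frontier (cube x \<rho>). \<exists>q\<in>frontier (cube x \<rho>). m \<le> \<bar>g p - g q\<bar>"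
  shows "(\<rho>2 - \<rho>1) * m ^ CARD('n) \<le> (6 * real CARD('n) ^ 2) ^ CARD('n) * (4 * real CARD('n) * \<rho>2) * integral (cube x \<rho>2) (\<lambda>z. norm (d z) ^ CARD('n))"
proof -
  let ?n = "real CARD('n)" and ?N = "CARD('n)"
  let ?k = "(6 * ?n ^ 2) ^ ?N"
  define A where "A i s = slice_energy d x \<rho>2 i s" for i s
  define I where "I = integral (cube x \<rho>2) (\<lambda>z. norm (d z) ^ CARD('n))"
  have cA: "continuous_on S (A i)" for S i
  proof -
    have "continuous_on UNIV (\<lambda>s. A i s)"
      unfolding A_def slice_energy_def cube_def
      by (rule integral_continuous_on_param) (auto simp: split_beta intro!: continuous_intros continuous_on_compose2[OF d])
    then show ?thesis by (rule continuous_on_subset) auto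
  qed
  have fsub: "frontier (cube x \<rho>) \<subseteq> cube x \<rho>" for \<rho> by (simp add: cube_def frontier_cbox)
  have point: "m ^ ?N \<le> ?k * (\<Sum>i\<in>UNIV. A i (x$i + \<rho>) + A i (x$i - \<rho>))" if \<rho>: "\<rho>1 \<le> \<rho>" "\<rho> \<le> \<rho>2" for \<rho>
  proof -
    obtain p q where pq: "p \<in> frontier (cube x \<rho>)" "q \<in> frontier (cube x \<rho>)" "m \<le> \<bar>g p - g q\<bar>" using osc[OF \<rho>] by blast
    obtain i j where ij: "\<bar>p$i - x$i\<bar> = \<rho>" "\<bar>q$j - x$j\<bar> = \<rho>" using frontier_cube[OF pq(1)] frontier_cube[OF pq(2)] by blast
    have "m ^ ?N \<le> ?k * (\<Sum>i\<in>UNIV. slice_energy d x \<rho> i (x$i + \<rho>) + slice_energy d x \<rho> i (x$i - \<rho>))"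
      by (rule osc_cube_boundary_le[OF n2 g d _ _ ij(1) _ ij(2) m pq(3)]) (use \<rho> r pq fsub in auto)
    also have "\<dots> \<le> ?k * (\<Sum>i\<in>UNIV. A i (x$i + \<rho>) + A i (x$i - \<rho>))"
    proof -
      have "slice_energy d x \<rho> i s \<le> A i s" for i s
        unfolding A_def slice_energy_def
        by (rule integral_subset_le[OF cube_mono[OF \<rho>(2)]])
          (auto simp: cube_def intro!: integrable_continuous continuous_intros continuous_on_compose2[OF d])
      then show ?thesis by (intro mult_left_mono sum_mono add_mono) auto
    qed
    finally show ?thesis .
  qed
  have fub: "integral {x$i - \<rho>2..x$i + \<rho>2} (A i) = 2 * \<rho>2 * I" for i
    using integral_upd_Fubini[of "\<lambda>z. norm (d z) ^ ?N" "x - (\<chi> i. \<rho>2)" i "x + (\<chi> i. \<rho>2)"] r d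
    by (simp add: A_def[abs_def] slice_energy_def I_def cube_def[symmetric] continuous_on_power continuous_on_norm)
  have A0: "A i s \<ge> 0" for i s unfolding A_def by (rule slice_energy_nonneg[OF d])
  have iA: "A i integrable_on {a..b}" for i a b by (rule integrable_continuous_real[OF cA])
  have ip: "((\<lambda>\<rho>. A i (x$i + \<rho>)) has_integral integral {x$i + \<rho>1..x$i + \<rho>2} (A i)) {\<rho>1..\<rho>2}" for i
    using has_integral_shift_Icc_real[of "A i" "x$i" _ \<rho>1 \<rho>2] iA by (auto simp: o_def has_integral_integral add.commute)
  have im: "((\<lambda>\<rho>. A i (x$i - \<rho>)) has_integral integral {x$i - \<rho>2..x$i - \<rho>1} (A i)) {\<rho>1..\<rho>2}" for i
  proof -
    have "((\<lambda>u. A i (x$i + u)) has_integral integral {x$i - \<rho>2..x$i - \<rho>1} (A i)) {-\<rho>2..-\<rho>1}"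
      using has_integral_shift_Icc_real[of "A i" "x$i" _ "-\<rho>2" "-\<rho>1"] iA by (auto simp: o_def has_integral_integral add.commute)
    then show ?thesis
      using has_integral_reflect_real[of "\<lambda>u. A i (x$i + u)" _ "-\<rho>1" "-\<rho>2"] by simp
  qed
  have le: "integral {a..b} (A i) \<le> 2 * \<rho>2 * I" if "{a..b} \<subseteq> {x$i - \<rho>2..x$i + \<rho>2}" for a b i
    unfolding fub[of i, symmetric] using that A0 by (intro integral_subset_le iA) auto
  have h1: "((\<lambda>\<rho>. ?k * (\<Sum>i\<in>UNIV. A i (x$i + \<rho>) + A i (x$i - \<rho>))) has_integral
     ?k * (\<Sum>i\<in>UNIV. integral {x$i + \<rho>1..x$i + \<rho>2} (A i) + integral {x$i - \<rho>2..x$i - \<rho>1} (A i))) {\<rho>1..\<rho>2}"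
    by (intro has_integral_mult_right has_integral_sum has_integral_add ip im) auto
  have h2: "((\<lambda>\<rho>. m ^ ?N) has_integral (\<rho>2 - \<rho>1) * m ^ ?N) {\<rho>1..\<rho>2}"
    using has_integral_const_real[of "m ^ ?N" \<rho>1 \<rho>2] r by simp
  have "(\<rho>2 - \<rho>1) * m ^ ?N \<le> ?k * (\<Sum>i\<in>UNIV. integral {x$i + \<rho>1..x$i + \<rho>2} (A i) + integral {x$i - \<rho>2..x$i - \<rho>1} (A i))"
    by (rule has_integral_le[OF h2 h1]) (use point in auto)
  also have "\<dots> \<le> ?k * (\<Sum>i\<in>(UNIV::'n set). 2 * \<rho>2 * I + 2 * \<rho>2 * I)"
    using r by (intro mult_left_mono sum_mono add_mono le) auto
  also have "\<dots> = ?k * (4 * ?n * \<rho>2) * I" by simp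
  finally show ?thesis by (simp add: I_def)
qed

section \<open>Mollification of continuous functions\<close>

definition conv :: "(real^'n::finite \<Rightarrow> real) \<Rightarrow> (real^'n \<Rightarrow> real) \<Rightarrow> real^'n \<Rightarrow> real" where
  "conv K u x = (LINT y|lborel. u y * K (x - y))"

definition loc_integrable :: "(real^'n::finite \<Rightarrow> real) \<Rightarrow> bool" where
  "loc_integrable u \<longleftrightarrow> u \<in> borel_measurable borel \<and> (\<forall>a b. set_integrable lborel (cbox a b) u)"

lemma loc_integrable_continuous:
  fixes u :: "real^'n::finite \<Rightarrow> real"
  assumes "continuous_on UNIV u" shows "loc_integrable u"
  unfolding loc_integrable_def set_integrable_def
  using borel_integrable_compact[OF compact_cbox continuous_on_subset[OF assms subset_UNIV]] borel_measurable_continuous_onI[OF assms]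
  by auto

lemma mollifierD:
  assumes "mollifier \<epsilon> K dK"
  shows "0 \<le> K z" "continuous_on UNIV K" "z \<notin> cbox (\<chi> i. - \<epsilon>) (\<chi> i. \<epsilon>) \<Longrightarrow> K z = 0" 
    "z \<notin> cbox (\<chi> i. - \<epsilon>) (\<chi> i. \<epsilon>) \<Longrightarrow> dK z = 0" "(K has_integral 1) UNIV" "test_function (\<lambda>y. K (x - y))"
    "(K has_derivative (\<lambda>h. dK z \<bullet> h)) (at z)" "continuous_on UNIV dK"
  using assms by (auto simp: mollifier_def)

lemma integrable_conv_continuous:
  fixes u k :: "real^'n::finite \<Rightarrow> real"
  assumes u: "loc_integrable u" and k: "continuous_on UNIV k" "\<And>z. z \<notin> cbox (\<chi> i. - \<epsilon>) (\<chi> i. \<epsilon>) \<Longrightarrow> k z = 0"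
  shows "integrable lborel (\<lambda>y. u y * k (x - y))"
proof -
  let ?C = "cbox (\<chi> i. - \<epsilon>) (\<chi> i. \<epsilon>) :: (real^'n) set"
  let ?B = "cbox (x - (\<chi> i. \<epsilon>)) (x + (\<chi> i. \<epsilon>))"
  have "compact (k ` ?C)" by (intro compact_continuous_image continuous_on_subset[OF k(1)]) auto
  then obtain M where M: "\<And>z. z \<in> ?C \<Longrightarrow> norm (k z) \<le> M" by (meson bounded_iff compact_imp_bounded imageI)
  have ku[measurable]: "u \<in> borel_measurable borel" "k \<in> borel_measurable borel"
    using u k by (auto simp: loc_integrable_def intro: borel_measurable_continuous_onI)
  show ?thesis
  proof (rule Bochner_Integration.integrable_bound[of _ "\<lambda>y. max M 0 * (indicator ?B y *\<^sub>R u y)"])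
    show "integrable lborel (\<lambda>y. max M 0 * (indicator ?B y *\<^sub>R u y))"
      using u by (intro integrable_mult_right) (simp add: loc_integrable_def set_integrable_def)
    show "AE y in lborel. norm (u y * k (x - y)) \<le> norm (max M 0 * (indicator ?B y *\<^sub>R u y))"
    proof (rule AE_I2)
      fix y
      show "norm (u y * k (x - y)) \<le> norm (max M 0 * (indicator ?B y *\<^sub>R u y))"
      proof (cases "y \<in> ?B")
        case True
        have "\<bar>k (x - y)\<bar> \<le> max M 0" using M[of "x - y"] k(2)[of "x - y"] by (cases "x - y \<in> ?C") auto
        then show ?thesis using True by (simp add: abs_mult mult.commute[of "max M 0"] mult_left_mono)
      next
        case False
        have "x - y \<notin> ?C" 
        proof
          assume "x - y \<in> ?C"
          then have "\<forall>i. - \<epsilon> \<le> x$i - y$i \<and> x$i - y$i \<le> \<epsilon>" by (simp add: mem_box_cart)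
          then have "\<forall>i. x$i - \<epsilon> \<le> y$i \<and> y$i \<le> x$i + \<epsilon>" by (simp add: algebra_simps)
          then show False using False by (simp add: mem_box_cart)
        qed
        then show ?thesis using k(2) by simp
      qed
    qed
  qed measurable
qed

lemma distr_lborel_reflect: "distr lborel borel (\<lambda>y::'a::euclidean_space. x - y) = lborel"
proof -
  have "density (distr lborel borel (\<lambda>y. x - y)) (\<lambda>_. 1) = (lborel :: 'a measure)"
    using lborel_affine[of "-1" x] by simp
  then show ?thesis by (simp add: density_1)
qed

lemma integral_lborel_reflect:
  fixes f :: "'a::euclidean_space \<Rightarrow> real"
  assumes f: "f \<in> borel_measurable borel"
  shows "(LINT y|lborel. f (x - y)) = (LINT y|lborel. f y)"
proof -
  have "(LINT y|lborel. f y) = (LINT y|distr lborel borel (\<lambda>y. x - y). f y)" by (simp add: distr_lborel_reflect)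
  also have "\<dots> = (LINT y|lborel. f (x - y))" by (rule integral_distr) (use f in measurable)
  finally show ?thesis by simp
qed

lemma integral_mollifier:
  fixes K :: "real^'n::finite \<Rightarrow> real"
  assumes K: "mollifier \<epsilon> K dK"
  shows "(LINT y|lborel. K (x - y)) = 1" "integrable lborel (\<lambda>y. K (x - y))" "integrable lborel K" "(LINT y|lborel. K (y - x)) = 1" "integrable lborel (\<lambda>y. K (y - x))"
proof -
  have m[measurable]: "K \<in> borel_measurable borel" using mollifierD(2)[OF K] by (rule borel_measurable_continuous_onI)
  have i: "integrable lborel (\<lambda>y. K (x - y))" for x
    using integrable_conv_continuous[where u="\<lambda>_. 1" and k=K and \<epsilon>=\<epsilon> and x=x,
        OF loc_integrable_continuous[OF continuous_on_const] mollifierD(2,3)[OF K]] by simp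
  then show "integrable lborel (\<lambda>y. K (x - y))" .
  have "integrable (distr lborel borel (\<lambda>y. 0 - y)) K"
    by (subst integrable_distr_eq) (use i[of 0] in auto)
  then show iK: "integrable lborel K" unfolding distr_lborel_reflect .
  have one: "(LINT y|lborel. K y) = 1"
    using integral_lborel[OF iK] mollifierD(5)[OF K] by (simp add: integral_unique)
  then show "(LINT y|lborel. K (x - y)) = 1" by (simp add: integral_lborel_reflect[OF m])
  have d: "distr lborel borel (\<lambda>y. y - x) = lborel"
  proof -
    have "density (distr lborel borel (\<lambda>y. y - x)) (\<lambda>_. 1) = (lborel :: (real^'n) measure)"
      using lborel_affine[of 1 "- x"] by simp
    then show ?thesis by (simp add: density_1)
  qed
  have "integrable (distr lborel borel (\<lambda>y. y - x)) K" unfolding d by (rule iK)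
  then show "integrable lborel (\<lambda>y. K (y - x))" by (subst (asm) integrable_distr_eq) auto
  have "(LINT y|lborel. K (y - x)) = (LINT y|distr lborel borel (\<lambda>y. y - x). K y)"
    by (rule integral_distr[symmetric]) auto
  then show "(LINT y|lborel. K (y - x)) = 1" unfolding d one .
qed

text \<open>For \<open>x\<close> in a unit neighbourhood of \<open>x0\<close> the integration takes place over one fixed compact box, so
theorems on parameter integrals over boxes apply.\<close>

lemma conv_eq_integral:
  fixes u k :: "real^'n::finite \<Rightarrow> real"
  assumes u: "continuous_on UNIV u" and k: "continuous_on UNIV k" "\<And>z. z \<notin> cbox (\<chi> i. - \<epsilon>) (\<chi> i. \<epsilon>) \<Longrightarrow> k z = 0"
    and x: "x \<in> box (x0 - (\<chi> i. 1)) (x0 + (\<chi> i. 1))"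
  shows "conv k u x = integral (cbox (x0 - (\<chi> i. 1 + \<epsilon>)) (x0 + (\<chi> i. 1 + \<epsilon>))) (\<lambda>y. u y * k (x - y))"
proof -
  let ?B = "cbox (x0 - (\<chi> i. 1 + \<epsilon>)) (x0 + (\<chi> i. 1 + \<epsilon>))"
  have "continuous_on ?B (\<lambda>y. u y * k (x - y))"
    by (intro continuous_intros continuous_on_compose2[OF u] continuous_on_compose2[OF k(1)]) auto
  then have i: "set_integrable lborel ?B (\<lambda>y. u y * k (x - y))"
    unfolding set_integrable_def by (intro borel_integrable_compact) auto
  have "conv k u x = (LINT y:?B|lborel. u y * k (x - y))"
    unfolding conv_def set_lebesgue_integral_def
  proof (intro Bochner_Integration.integral_cong refl)
    fix y
    show "u y * k (x - y) = indicator ?B y *\<^sub>R (u y * k (x - y))"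
    proof (cases "y \<in> ?B")
      case False
      have "x - y \<notin> cbox (\<chi> i. - \<epsilon>) (\<chi> i. \<epsilon>)"
      proof
        assume "x - y \<in> cbox (\<chi> i. - \<epsilon>) (\<chi> i. \<epsilon>)"
        then have 1: "\<forall>i. - \<epsilon> \<le> x$i - y$i \<and> x$i - y$i \<le> \<epsilon>" by (simp add: mem_box_cart)
        have 2: "\<forall>i. x0$i - 1 < x$i \<and> x$i < x0$i + 1" using x by (simp add: mem_box_cart)
        have "x0$i - (1 + \<epsilon>) \<le> y$i \<and> y$i \<le> x0$i + (1 + \<epsilon>)" for i using spec[OF 1, of i] spec[OF 2, of i] by linarith
        then show False using False by (simp add: mem_box_cart)
      qed
      then show ?thesis using k(2) by simp
    qed simp
  qed
  also have "\<dots> = integral ?B (\<lambda>y. u y * k (x - y))" by (rule set_borel_integral_eq_integral[OF i])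
  finally show ?thesis .
qed

lemma conv_continuous_kernel:
  fixes u k :: "real^'n::finite \<Rightarrow> real"
  assumes u: "continuous_on UNIV u" and k: "continuous_on UNIV k" "\<And>z. z \<notin> cbox (\<chi> i. - \<epsilon>) (\<chi> i. \<epsilon>) \<Longrightarrow> k z = 0"
  shows "continuous_on UNIV (conv k u)"
proof -
  have "isCont (conv k u) x0" for x0
  proof -
    let ?U = "box (x0 - (\<chi> i. 1)) (x0 + (\<chi> i. 1))"
    let ?I = "\<lambda>x. integral (cbox (x0 - (\<chi> i. 1 + \<epsilon>)) (x0 + (\<chi> i. 1 + \<epsilon>))) (\<lambda>y. u y * k (x - y))"
    have "continuous_on ?U ?I"
      by (rule integral_continuous_on_param)
        (auto simp: split_beta intro!: continuous_intros continuous_on_compose2[OF u] continuous_on_compose2[OF k(1)])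
    moreover have "continuous_on ?U (conv k u) \<longleftrightarrow> continuous_on ?U ?I"
      by (intro continuous_on_cong refl conv_eq_integral[OF u k])
    ultimately have "continuous_on ?U (conv k u)" by blast
    moreover have "x0 \<in> ?U" by (simp add: mem_box_cart)
    ultimately show ?thesis by (metis continuous_on_eq_continuous_at open_box)
  qed
  then show ?thesis by (simp add: continuous_at_imp_continuous_on)
qed

lemma conv_has_derivative:
  fixes u :: "real^'n::finite \<Rightarrow> real"
  assumes u: "continuous_on UNIV u" and K: "mollifier \<epsilon> K dK"
  shows "(conv K u has_derivative (\<lambda>h. (\<chi> j. conv (\<lambda>z. dK z $ j) u x0) \<bullet> h)) (at x0)"
proof -
  let ?U = "box (x0 - (\<chi> i. 1)) (x0 + (\<chi> i. 1))" and ?B = "cbox (x0 - (\<chi> i. 1 + \<epsilon>)) (x0 + (\<chi> i. 1 + \<epsilon>))"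
  let ?I = "\<lambda>x. integral ?B (\<lambda>y. u y * K (x - y))"
  let ?f = "\<lambda>x y. u y *\<^sub>R blinfun_inner_right (dK (x - y))"
  have x0: "x0 \<in> ?U" by (simp add: mem_box_cart)
  have cf: "continuous_on S (\<lambda>(x, y). ?f x y)" for S
    unfolding split_beta
    by (intro continuous_intros continuous_on_compose2[OF u] bounded_linear.continuous_on[OF bounded_linear_blinfun_inner_right]
        continuous_on_compose2[OF mollifierD(8)[OF K]]) auto
  have cfx: "continuous_on S (?f x)" for S x
    by (intro continuous_intros continuous_on_compose2[OF u] bounded_linear.continuous_on[OF bounded_linear_blinfun_inner_right]
        continuous_on_compose2[OF mollifierD(8)[OF K]]) auto
  have "(?I has_derivative blinfun_apply (integral ?B (?f x0))) (at x0 within ?U)"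
  proof (rule leibniz_rule)
    show "((\<lambda>x. u y * K (x - y)) has_derivative blinfun_apply (?f x y)) (at x within ?U)" for x y
    proof -
      have "((\<lambda>x. x - y) has_derivative (\<lambda>h. h)) (at x)" by (auto intro!: derivative_eq_intros)
      from has_derivative_mult_right[OF has_derivative_compose[OF this mollifierD(7)[OF K]], of "u y"]
      show ?thesis by (simp add: has_derivative_at_withinI scaleR_blinfun.rep_eq)
    qed
    show "(\<lambda>y. u y * K (x - y)) integrable_on ?B" for x
      by (intro integrable_continuous continuous_intros continuous_on_compose2[OF u] continuous_on_compose2[OF mollifierD(2)[OF K]]) auto
  qed (use x0 cf in \<open>auto simp: convex_box\<close>)
  then have "(?I has_derivative blinfun_apply (integral ?B (?f x0))) (at x0)"
    using x0 by (simp add: at_within_open[OF _ open_box])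
  then have 1: "(conv K u has_derivative blinfun_apply (integral ?B (?f x0))) (at x0)"
    by (rule has_derivative_transform_within_open[OF _ open_box x0]) (rule conv_eq_integral[OF u mollifierD(2,3)[OF K], symmetric])
  have "blinfun_apply (integral ?B (?f x0)) h = (\<chi> j. conv (\<lambda>z. dK z $ j) u x0) \<bullet> h" for h
  proof -
    have "blinfun_apply (integral ?B (?f x0)) h = integral ?B (\<lambda>y. blinfun_apply (?f x0 y) h)"
      by (rule blinfun_apply_integral) (intro integrable_continuous cfx)
    also have "\<dots> = integral ?B (\<lambda>y. \<Sum>j\<in>UNIV. (u y * dK (x0 - y) $ j) * h $ j)"
      by (simp add: scaleR_blinfun.rep_eq inner_vec_def sum_distrib_left mult.assoc)
    also have "\<dots> = (\<Sum>j\<in>UNIV. integral ?B (\<lambda>y. u y * dK (x0 - y) $ j) * h $ j)"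
      by (subst integral_sum) (auto intro!: integrable_continuous continuous_intros continuous_on_compose2[OF u] continuous_on_compose2[OF mollifierD(8)[OF K]])
    also have "\<dots> = (\<Sum>j\<in>UNIV. conv (\<lambda>z. dK z $ j) u x0 * h $ j)"
    proof (intro sum.cong refl)
      fix j
      have "conv (\<lambda>z. dK z $ j) u x0 = integral ?B (\<lambda>y. u y * dK (x0 - y) $ j)"
        by (rule conv_eq_integral[OF u _ _ x0]) (use mollifierD(4,8)[OF K] in \<open>auto intro!: continuous_intros\<close>)
      then show "integral ?B (\<lambda>y. u y * dK (x0 - y) $ j) * h $ j = conv (\<lambda>z. dK z $ j) u x0 * h $ j" by simp
    qed
    finally show ?thesis by (simp add: inner_vec_def)
  qed
  then show ?thesis using 1 by presburger
qed

text \<open>The reflected kernel is a test function, and differentiating it in the integration variable changes the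
sign; the definition of the weak derivative then moves the derivative from the kernel to \<open>u\<close>.\<close>

lemma conv_weak_derivative:
  fixes u g :: "real^'n::finite \<Rightarrow> real"
  assumes u: "continuous_on UNIV u" and K: "mollifier \<epsilon> K dK"
    and weak: "\<And>\<phi>. test_function \<phi> \<Longrightarrow> (LINT x|lborel. u x * partial_deriv j \<phi> x) = - (LINT x|lborel. g x * \<phi> x)"
  shows "conv (\<lambda>z. dK z $ j) u = conv K g"
proof
  fix x
  have "partial_deriv j (\<lambda>y. K (x - y)) y = - dK (x - y) $ j" for y
  proof -
    have "((\<lambda>y. x - y) has_derivative (\<lambda>h. - h)) (at y)" by (auto intro!: derivative_eq_intros)
    from has_derivative_compose[OF this mollifierD(7)[OF K]] have "((\<lambda>y. K (x - y)) has_derivative (\<lambda>h. dK (x - y) \<bullet> (- h))) (at y)" .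
    from frechet_derivative_at[OF this, symmetric] show ?thesis
      by (simp add: partial_deriv_def inner_axis)
  qed
  with weak[OF mollifierD(6)[OF K, of x]] show "conv (\<lambda>z. dK z $ j) u x = conv K g x"
    by (simp add: conv_def)
qed

lemma conv_uniform_limit:
  fixes u :: "real^'n::finite \<Rightarrow> real"
  assumes u: "continuous_on UNIV u" and K: "\<And>k::nat. mollifier (\<epsilon> k) (K k) (dK k)" and \<epsilon>: "\<epsilon> \<longlonglongrightarrow> 0" and C: "compact C"
  shows "uniform_limit C (\<lambda>k. conv (K k) u) u sequentially"
proof (rule uniform_limitI)
  fix e :: real assume e: "e > 0"
  let ?I = "cbox (\<chi> i. - 1) (\<chi> i. 1) :: (real^'n) set"
  define C' where "C' = {x + y |x y. x \<in> C \<and> y \<in> ?I}"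
  have "compact C'" unfolding C'_def by (intro compact_sums C) auto
  then have uc: "uniformly_continuous_on C' u"
    by (intro compact_uniformly_continuous continuous_on_subset[OF u]) auto
  have "e / 2 > 0" using e by simp
  then obtain \<delta> where \<delta>: "\<delta> > 0" "\<forall>x\<in>C'. \<forall>y\<in>C'. dist y x < \<delta> \<longrightarrow> dist (u y) (u x) < e / 2"
    using uc unfolding uniformly_continuous_on_def by blast
  let ?n = "real CARD('n)"
  have "min 1 (\<delta> / (2 * ?n)) > 0" using \<delta>(1) by simp
  then have "\<forall>\<^sub>F k in sequentially. dist (\<epsilon> k) 0 < min 1 (\<delta> / (2 * ?n))" using \<epsilon> by (rule tendstoD[rotated])
  then show "\<forall>\<^sub>F k in sequentially. \<forall>x\<in>C. dist (conv (K k) u x) (u x) < e"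
  proof eventually_elim
    case (elim k)
    then have ek: "\<epsilon> k < 1" "\<epsilon> k < \<delta> / (2 * ?n)" by (auto simp: dist_real_def)
    show ?case
    proof
      fix x assume x: "x \<in> C"
      note Kk = K[of k]
      have diff: "\<bar>u y - u x\<bar> * K k (x - y) \<le> e / 2 * K k (x - y)" for y
      proof (cases "x - y \<in> cbox (\<chi> i. - \<epsilon> k) (\<chi> i. \<epsilon> k)")
        case True
        then have yi: "\<bar>(y - x)$i\<bar> \<le> \<epsilon> k" for i by (auto simp: mem_box_cart abs_le_iff algebra_simps)
        have "norm (y - x) \<le> (\<Sum>i\<in>UNIV. \<bar>(y - x)$i\<bar>)" by (rule norm_le_l1_cart)
        also have "\<dots> \<le> (\<Sum>i\<in>(UNIV::'n set). \<epsilon> k)" by (intro sum_mono yi)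
        also have "\<dots> = ?n * \<epsilon> k" by simp
        also have "\<dots> < \<delta>" using ek(2) \<delta>(1) by (simp add: field_simps) 
        finally have "dist y x < \<delta>" by (simp add: dist_norm)
        moreover have "x \<in> C'"
        proof -
          have "0 \<in> ?I" by (simp add: mem_box_cart)
          then have "x + 0 \<in> C'" unfolding C'_def using x by blast
          then show ?thesis by simp
        qed
        moreover have "y \<in> C'"
        proof -
          have "- 1 \<le> (y - x)$i \<and> (y - x)$i \<le> 1" for i using yi[of i] ek(1) by linarith
          then have "y - x \<in> ?I" by (simp add: mem_box_cart)
          then have "x + (y - x) \<in> C'" unfolding C'_def using x by blast
          then show ?thesis by simp
        qed
        ultimately have "\<bar>u y - u x\<bar> \<le> e / 2" using \<delta>(2) by (simp add: dist_real_def less_imp_le)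
        then show ?thesis using mollifierD(1)[OF Kk] by (intro mult_right_mono) auto
      qed (simp add: mollifierD(3)[OF Kk])
      have i1: "integrable lborel (\<lambda>y. u y * K k (x - y))"
        by (rule integrable_conv_continuous[OF loc_integrable_continuous[OF u] mollifierD(2,3)[OF Kk]])
      note i2 = integral_mollifier(2)[OF Kk, of x]
      have "conv (K k) u x - u x = (LINT y|lborel. u y * K k (x - y)) - (LINT y|lborel. u x * K k (x - y))"
        using integral_mollifier(1)[OF Kk, of x] by (simp add: conv_def)
      also have "\<dots> = (LINT y|lborel. (u y - u x) * K k (x - y))"
        using i1 i2 by (subst Bochner_Integration.integral_diff[symmetric]) (auto simp: algebra_simps)
      finally have "\<bar>conv (K k) u x - u x\<bar> \<le> (LINT y|lborel. \<bar>(u y - u x) * K k (x - y)\<bar>)"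
        using integral_abs_bound by metis
      also have "\<dots> \<le> (LINT y|lborel. e / 2 * K k (x - y))"
      proof (rule integral_mono)
        have "integrable lborel (\<lambda>y. u y * K k (x - y) - u x * K k (x - y))" using i1 i2 by simp
        then show "integrable lborel (\<lambda>y. \<bar>(u y - u x) * K k (x - y)\<bar>)"
          by (simp add: left_diff_distrib)
        show "integrable lborel (\<lambda>y. e / 2 * K k (x - y))" using i2 by simp
        show "\<bar>(u y - u x) * K k (x - y)\<bar> \<le> e / 2 * K k (x - y)" for y
          using diff[of y] mollifierD(1)[OF Kk] by (simp add: abs_mult)
      qed
      also have "\<dots> = e / 2" using integral_mollifier(1)[OF Kk, of x] by simp
      finally show "dist (conv (K k) u x) (u x) < e" using e by (simp add: dist_real_def)
    qed
  qed
qed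

text \<open>Jensen's inequality for the probability density \<open>K (x - y)\<close>.\<close>

lemma conv_power_le:
  fixes u :: "real^'n::finite \<Rightarrow> real"
  assumes u: "loc_integrable u" and un: "loc_integrable (\<lambda>x. \<bar>u x\<bar> ^ n)" and K: "mollifier \<epsilon> K dK" and n: "n \<ge> 1"
  shows "\<bar>conv K u x\<bar> ^ n \<le> conv K (\<lambda>x. \<bar>u x\<bar> ^ n) x"
proof -
  have i1: "integrable lborel (\<lambda>y. u y * K (x - y))"
    by (rule integrable_conv_continuous[OF u mollifierD(2,3)[OF K]])
  have i2: "integrable lborel (\<lambda>y. \<bar>u y\<bar> ^ n * K (x - y))"
    by (rule integrable_conv_continuous[OF un mollifierD(2,3)[OF K]])
  have "\<bar>u y * K (x - y)\<bar> = \<bar>u y\<bar> * K (x - y)" for y using mollifierD(1)[OF K] by (simp add: abs_mult)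
  then have i3: "integrable lborel (\<lambda>y. \<bar>u y\<bar> * K (x - y))" using integrable_abs[OF i1] by simp
  note i4 = integral_mollifier(1,2)[OF K, of x]
  define c where "c = (LINT y|lborel. \<bar>u y\<bar> * K (x - y))"
  have c: "c \<ge> 0" unfolding c_def using mollifierD(1)[OF K] by (intro integral_nonneg_AE) auto
  have "\<bar>conv K u x\<bar> \<le> c"
    unfolding conv_def c_def using integral_abs_bound[of lborel "\<lambda>y. u y * K (x - y)"] mollifierD(1)[OF K]
    by (simp add: abs_mult)
  then have "\<bar>conv K u x\<bar> ^ n \<le> c ^ n" by (intro power_mono) auto
  also have "c ^ n = (LINT y|lborel. (c ^ n - real n * c ^ (n - 1) * c) * K (x - y) + real n * c ^ (n - 1) * (\<bar>u y\<bar> * K (x - y)))"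
    using i3 i4 by (simp add: c_def[symmetric])
  also have "\<dots> \<le> (LINT y|lborel. \<bar>u y\<bar> ^ n * K (x - y))"
  proof (rule integral_mono)
    show "integrable lborel (\<lambda>y. (c ^ n - real n * c ^ (n - 1) * c) * K (x - y) + real n * c ^ (n - 1) * (\<bar>u y\<bar> * K (x - y)))"
      using i3 i4 by simp
    fix y
    have "(c ^ n + real n * c ^ (n - 1) * (\<bar>u y\<bar> - c)) * K (x - y) \<le> \<bar>u y\<bar> ^ n * K (x - y)"
      using power_tangent_le[of "\<bar>u y\<bar>" c n] c n mollifierD(1)[OF K] by (intro mult_right_mono) auto
    then show "(c ^ n - real n * c ^ (n - 1) * c) * K (x - y) + real n * c ^ (n - 1) * (\<bar>u y\<bar> * K (x - y)) \<le> \<bar>u y\<bar> ^ n * K (x - y)"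
      by (simp add: algebra_simps)
  qed (rule i2)
  finally show ?thesis by (simp add: conv_def)
qed

section \<open>Mollification of locally integrable functions\<close>

text \<open>Dominated convergence with a majorant that is fixed only up to errors tending to 0 in mean. Truncating \<open>Fk\<close>
at the levels \<open>H\<close> and \<open>- H\<close> changes it by at most the error, and the truncated functions are dominated by \<open>H\<close>.
It is used with mollified \<open>n\<close>-th powers as majorants, and makes convergence of the mollified derivatives in the
norm of the \<open>n\<close>-th powers unnecessary.\<close>

lemma integral_dominated_convergence_perturbed:
  fixes F :: "'a \<Rightarrow> real"
  assumes Fk: "\<And>k. Fk k \<in> borel_measurable M" and F: "F \<in> borel_measurable M"
    and lim: "AE x in M. (\<lambda>k. Fk k x) \<longlonglongrightarrow> F x"
    and H: "integrable M H" "\<And>x. \<bar>F x\<bar> \<le> H x" and h: "\<And>k. integrable M (h k)" "(\<lambda>k. LINT x|M. h k x) \<longlonglongrightarrow> 0"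
    and bound: "\<And>k x. \<bar>Fk k x\<bar> \<le> H x + h k x" and h0: "\<And>k x. 0 \<le> h k x"
  shows "integrable M F" "\<And>k. integrable M (Fk k)" "(\<lambda>k. LINT x|M. Fk k x) \<longlonglongrightarrow> (LINT x|M. F x)"
proof -
  have H0: "0 \<le> H x" for x using H(2)[of x] by linarith
  show iF: "integrable M F" by (rule Bochner_Integration.integrable_bound[OF H(1) F]) (use H(2) H0 in auto)
  show iFk: "integrable M (Fk k)" for k
  proof (rule Bochner_Integration.integrable_bound[of _ "\<lambda>x. H x + h k x"])
    show "AE x in M. norm (Fk k x) \<le> norm (H x + h k x)" 
      using bound[of k] H0 h0[of k] by (intro AE_I2) (simp add: abs_of_nonneg add_nonneg_nonneg)
  qed (use H h Fk in auto)
  \<comment> \<open>Truncation at the levels \<open>H\<close> and \<open>- H\<close>.\<close>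
  define C where "C k x = max (- H x) (min (H x) (Fk k x))" for k x
  have Cm: "C k \<in> borel_measurable M" for k unfolding C_def using Fk H(1) by measurable
  have cl: "AE x in M. (\<lambda>k. C k x) \<longlonglongrightarrow> F x"
    using lim
  proof eventually_elim
    case (elim x)
    have "(\<lambda>k. C k x) \<longlonglongrightarrow> max (- H x) (min (H x) (F x))" unfolding C_def by (intro tendsto_intros elim)
    moreover have "max (- H x) (min (H x) (F x)) = F x" using H(2)[of x] by (auto simp: abs_le_iff max_def min_def)
    ultimately show ?case by simp
  qed
  have Cb: "\<bar>C k x\<bar> \<le> H x" for k x using H0[of x] by (auto simp: C_def abs_le_iff max_def min_def)
  have iC: "integrable M (C k)" for k
    by (rule Bochner_Integration.integrable_bound[OF H(1) Cm]) (use Cb H0 in auto)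
  have lC: "(\<lambda>k. LINT x|M. C k x) \<longlonglongrightarrow> (LINT x|M. F x)"
    by (rule integral_dominated_convergence[OF F Cm H(1) cl]) (use Cb in auto)
  have diff: "\<bar>Fk k x - C k x\<bar> \<le> h k x" for k x
    using bound[of k x] h0[of k x] H0[of x] by (auto simp: C_def abs_le_iff max_def min_def)
  have "(\<lambda>k. (LINT x|M. Fk k x) - (LINT x|M. C k x)) \<longlonglongrightarrow> 0"
  proof (rule Lim_null_comparison[OF _ h(2)], rule always_eventually, rule allI)
    fix k
    have "norm ((LINT x|M. Fk k x) - (LINT x|M. C k x)) = \<bar>LINT x|M. (Fk k x - C k x)\<bar>"
      using iFk iC by simp
    also have "\<dots> \<le> (LINT x|M. \<bar>Fk k x - C k x\<bar>)" by (rule integral_abs_bound)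
    also have "\<dots> \<le> (LINT x|M. h k x)" by (intro integral_mono) (use iFk iC h diff in auto)
    finally show "norm ((LINT x|M. Fk k x) - (LINT x|M. C k x)) \<le> (LINT x|M. h k x)" .
  qed
  from tendsto_add[OF this lC] show "(\<lambda>k. LINT x|M. Fk k x) \<longlonglongrightarrow> (LINT x|M. F x)" by simp
qed

text \<open>Truncation makes the function bounded; a bounded measurable function is an almost everywhere limit of
continuous functions, which may be truncated at the same level and then converge in mean.\<close>

lemma continuous_L1_dense:
  fixes u :: "real^'n::finite \<Rightarrow> real"
  assumes u: "loc_integrable u" and e: "e > 0"
  obtains g where "continuous_on UNIV g" "(LINT x|lborel. indicator (cbox a b) x * \<bar>u x - g x\<bar>) < e"
proof -
  let ?B = "cbox a b"
  have um[measurable]: "u \<in> borel_measurable borel" using u by (simp add: loc_integrable_def)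
  have iu: "integrable lborel (\<lambda>x. indicator ?B x * \<bar>u x\<bar>)"
  proof -
    have "integrable lborel (\<lambda>x. indicator ?B x *\<^sub>R u x)" using u by (simp add: loc_integrable_def set_integrable_def)
    from integrable_abs[OF this] show ?thesis by (simp add: abs_mult)
  qed
  define cl where "cl M t = max (- M) (min M t)" for M t :: real
  have clm: "continuous_on UNIV (cl M)" for M unfolding cl_def by (intro continuous_intros)
  have clb: "\<bar>cl M t\<bar> \<le> M" if "M \<ge> 0" for M t using that by (auto simp: cl_def)
  have clm'[measurable]: "cl M \<in> borel_measurable borel" for M using clm by (rule borel_measurable_continuous_onI)
  have iB: "integrable lborel (\<lambda>x. indicator ?B x * c :: real)" for c
    by (intro integrable_mult_left integrable_real_indicator) (auto simp: emeasure_lborel_cbox_eq)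
  have "(\<lambda>k::nat. LINT x|lborel. indicator ?B x * \<bar>u x - cl (real k) (u x)\<bar>) \<longlonglongrightarrow> integral\<^sup>L (lborel :: (real^'n) measure) (\<lambda>x. 0::real)"
  proof (rule integral_dominated_convergence[OF _ _ iu])
    show "AE x in lborel. (\<lambda>k::nat. indicator ?B x * \<bar>u x - cl (real k) (u x)\<bar>) \<longlonglongrightarrow> 0"
    proof (rule AE_I2, rule tendsto_eventually)
      fix x
      show "\<forall>\<^sub>F k in sequentially. indicator ?B x * \<bar>u x - cl (real k) (u x)\<bar> = 0"
        using eventually_ge_at_top[of "nat \<lceil>\<bar>u x\<bar>\<rceil>"]
      proof eventually_elim
        case (elim k)
        then have "\<bar>u x\<bar> \<le> real k" by linarith
        then have "cl (real k) (u x) = u x" by (auto simp: cl_def)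
        then show ?case by simp
      qed
    qed
    show "AE x in lborel. norm (indicator ?B x * \<bar>u x - cl (real k) (u x)\<bar>) \<le> indicator ?B x * \<bar>u x\<bar>" for k
      by (rule AE_I2) (auto simp: cl_def indicator_def)
  qed measurable
  then have "\<forall>\<^sub>F k in sequentially. (LINT x|lborel. indicator ?B x * \<bar>u x - cl (real k) (u x)\<bar>) < e / 2"
    using e by (intro order_tendstoD(2)) auto
  then obtain k where k: "(LINT x|lborel. indicator ?B x * \<bar>u x - cl (real k) (u x)\<bar>) < e / 2"
    by (auto simp: eventually_sequentially)
  have "u \<in> borel_measurable lebesgue" using um by (simp add: measurable_completion)
  then have "u measurable_on UNIV" by (rule lebesgue_measurable_imp_measurable_on) simp
  then obtain N g where N: "negligible N" "\<And>n. continuous_on UNIV (g n)" "\<And>x. x \<notin> N \<Longrightarrow> (\<lambda>n. g n x) \<longlonglongrightarrow> u x"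
    unfolding measurable_on_def by auto
  have gm[measurable]: "g n \<in> borel_measurable borel" for n using N(2) by (rule borel_measurable_continuous_onI)
  have "AE x in lebesgue. x \<notin> N" using N(1) by (simp add: AE_not_in negligible_iff_null_sets)
  then have aeN: "AE x in lborel. x \<notin> N" by (simp add: AE_completion_iff)
  have "(\<lambda>n. LINT x|lborel. indicator ?B x * \<bar>cl (real k) (u x) - cl (real k) (g n x)\<bar>) \<longlonglongrightarrow> integral\<^sup>L (lborel :: (real^'n) measure) (\<lambda>x. 0::real)"
  proof (rule integral_dominated_convergence[OF _ _ iB[of "2 * real k"]])
    show "AE x in lborel. (\<lambda>n. indicator ?B x * \<bar>cl (real k) (u x) - cl (real k) (g n x)\<bar>) \<longlonglongrightarrow> 0"
      using aeN
    proof eventually_elim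
      case (elim x)
      have "(\<lambda>n. cl (real k) (g n x)) \<longlonglongrightarrow> cl (real k) (u x)" unfolding cl_def by (intro tendsto_intros N(3) elim)
      then have "(\<lambda>n. indicator ?B x * \<bar>cl (real k) (u x) - cl (real k) (g n x)\<bar>) \<longlonglongrightarrow> indicator ?B x * \<bar>cl (real k) (u x) - cl (real k) (u x)\<bar>"
        by (intro tendsto_intros)
      then show ?case by simp
    qed
    show "AE x in lborel. norm (indicator ?B x * \<bar>cl (real k) (u x) - cl (real k) (g n x)\<bar>) \<le> indicator ?B x * (2 * real k)" for n
    proof (rule AE_I2)
      fix x
      have "\<bar>cl (real k) (u x)\<bar> \<le> real k" "\<bar>cl (real k) (g n x)\<bar> \<le> real k" by (simp_all add: clb)
      then show "norm (indicator ?B x * \<bar>cl (real k) (u x) - cl (real k) (g n x)\<bar>) \<le> indicator ?B x * (2 * real k)"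
        by (auto simp: indicator_def)
    qed
  qed measurable
  then have "\<forall>\<^sub>F n in sequentially. (LINT x|lborel. indicator ?B x * \<bar>cl (real k) (u x) - cl (real k) (g n x)\<bar>) < e / 2"
    using e by (intro order_tendstoD(2)) auto
  then obtain n where n: "(LINT x|lborel. indicator ?B x * \<bar>cl (real k) (u x) - cl (real k) (g n x)\<bar>) < e / 2"
    by (auto simp: eventually_sequentially)
  define w where "w x = cl (real k) (g n x)" for x
  have cw: "continuous_on UNIV w" unfolding w_def by (intro continuous_on_compose2[OF clm N(2)]) auto
  have [measurable]: "w \<in> borel_measurable borel" unfolding w_def by measurable
  have i1: "integrable lborel (\<lambda>x. indicator ?B x * \<bar>u x - cl (real k) (u x)\<bar>)"
    by (rule Bochner_Integration.integrable_bound[OF iu]) (auto simp: cl_def indicator_def)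
  have i2: "integrable lborel (\<lambda>x. indicator ?B x * \<bar>cl (real k) (u x) - w x\<bar>)"
  proof (rule Bochner_Integration.integrable_bound[OF iB[of "2 * real k"]])
    show "AE x in lborel. norm (indicator ?B x * \<bar>cl (real k) (u x) - w x\<bar>) \<le> norm (indicator ?B x * (2 * real k))"
    proof (rule AE_I2)
      fix x
      have "\<bar>cl (real k) (u x)\<bar> \<le> real k" "\<bar>w x\<bar> \<le> real k" by (simp_all add: clb w_def)
      then show "norm (indicator ?B x * \<bar>cl (real k) (u x) - w x\<bar>) \<le> norm (indicator ?B x * (2 * real k))"
        by (auto simp: indicator_def)
    qed
  qed measurable
  have "(LINT x|lborel. indicator ?B x * \<bar>u x - w x\<bar>) \<le> (LINT x|lborel. indicator ?B x * \<bar>u x - cl (real k) (u x)\<bar> + indicator ?B x * \<bar>cl (real k) (u x) - w x\<bar>)"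
  proof (rule integral_mono_AE')
    show "integrable lborel (\<lambda>x. indicator ?B x * \<bar>u x - cl (real k) (u x)\<bar> + indicator ?B x * \<bar>cl (real k) (u x) - w x\<bar>)"
      using i1 i2 by simp
  qed (auto simp: indicator_def)
  also have "\<dots> < e" using i1 i2 k n by (simp add: w_def)
  finally show ?thesis using cw that by blast
qed

lemma conv_borel_measurable:
  fixes u :: "real^'n::finite \<Rightarrow> real"
  assumes [measurable]: "u \<in> borel_measurable borel" and K: "mollifier \<epsilon> K dK"
  shows "conv K u \<in> borel_measurable borel"
proof -
  have [measurable]: "K \<in> borel_measurable borel" using mollifierD(2)[OF K] by (rule borel_measurable_continuous_onI)
  show ?thesis unfolding conv_def[abs_def] by measurable
qed

text \<open>Tonelli's theorem, since the kernel has integral 1 in either variable.\<close>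

lemma conv_contraction_L1:
  fixes v :: "real^'n::finite \<Rightarrow> real"
  assumes v: "integrable lborel v" and K: "mollifier \<epsilon> K dK"
  shows "integrable lborel (conv K v)" "(LINT x|lborel. \<bar>conv K v x\<bar>) \<le> (LINT x|lborel. \<bar>v x\<bar>)"
proof -
  have [measurable]: "K \<in> borel_measurable borel" using mollifierD(2)[OF K] by (rule borel_measurable_continuous_onI)
  have [measurable]: "v \<in> borel_measurable borel" using v by auto
  have K0: "0 \<le> K z" for z using mollifierD(1)[OF K] .
  have int: "integrable lborel (conv K w)" "(LINT x|lborel. conv K w x) = (LINT x|lborel. w x)"
    if w: "integrable lborel w" for w :: "real^'n \<Rightarrow> real"
  proof -
    have [measurable]: "w \<in> borel_measurable borel" using w by auto
    have I: "integrable (lborel \<Otimes>\<^sub>M lborel) (\<lambda>(y, x). w y * K (x - y))"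
    proof (rule lborel_pair.Fubini_integrable)
      have "(\<lambda>y. LINT x|lborel. norm ((\<lambda>(y, x). w y * K (x - y)) (y, x))) = (\<lambda>y. \<bar>w y\<bar>)"
        using K0 integral_mollifier(4)[OF K] by (simp add: abs_mult)
      then show "integrable lborel (\<lambda>y. LINT x|lborel. norm ((\<lambda>(y, x). w y * K (x - y)) (y, x)))"
        using w by simp
      show "AE y in lborel. integrable lborel (\<lambda>x. (\<lambda>(y, x). w y * K (x - y)) (y, x))"
        using integral_mollifier(5)[OF K] by simp
    qed measurable
    show "integrable lborel (conv K w)"
      using lborel_pair.integrable_snd[OF I] by (simp add: conv_def[abs_def])
    show "(LINT x|lborel. conv K w x) = (LINT x|lborel. w x)"
      using lborel_pair.Fubini_integral[OF I] integral_mollifier(4)[OF K] by (simp add: conv_def)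
  qed
  show i: "integrable lborel (conv K v)" by (rule int(1)[OF v])
  have iv: "integrable lborel (\<lambda>x. \<bar>v x\<bar>)" using v by simp
  have "\<bar>conv K v x\<bar> \<le> conv K (\<lambda>x. \<bar>v x\<bar>) x" for x
    using integral_abs_bound[of lborel "\<lambda>y. v y * K (x - y)"] K0 by (simp add: conv_def abs_mult)
  then have "(LINT x|lborel. \<bar>conv K v x\<bar>) \<le> (LINT x|lborel. conv K (\<lambda>x. \<bar>v x\<bar>) x)"
    using i int(1)[OF iv] by (intro integral_mono) auto
  then show "(LINT x|lborel. \<bar>conv K v x\<bar>) \<le> (LINT x|lborel. \<bar>v x\<bar>)" using int(2)[OF iv] by simp
qed

lemma conv_local:
  fixes u v :: "real^'n::finite \<Rightarrow> real"
  assumes K: "mollifier \<epsilon> K dK" and eq: "\<And>y. y \<in> cbox (x - (\<chi> i. \<epsilon>)) (x + (\<chi> i. \<epsilon>)) \<Longrightarrow> u y = v y"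
  shows "conv K u x = conv K v x"
  unfolding conv_def
proof (intro Bochner_Integration.integral_cong refl)
  fix y
  show "u y * K (x - y) = v y * K (x - y)"
  proof (cases "x - y \<in> cbox (\<chi> i. - \<epsilon>) (\<chi> i. \<epsilon>)")
    case True
    then have 1: "- \<epsilon> \<le> x$i - y$i \<and> x$i - y$i \<le> \<epsilon>" for i by (simp add: mem_box_cart)
    have "x$i - \<epsilon> \<le> y$i \<and> y$i \<le> x$i + \<epsilon>" for i using 1[of i] by linarith
    then have "y \<in> cbox (x - (\<chi> i. \<epsilon>)) (x + (\<chi> i. \<epsilon>))" by (simp add: mem_box_cart)
    then show ?thesis using eq by simp
  qed (simp add: mollifierD(3)[OF K])
qed

text \<open>For continuous functions mollification converges uniformly on compact sets. The general case follows by
approximation in mean, which mollification does not spoil because it is a contraction in mean.\<close>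

lemma conv_L1_limit:
  fixes u :: "real^'n::finite \<Rightarrow> real"
  assumes u: "loc_integrable u" and K: "\<And>k::nat. mollifier (\<epsilon> k) (K k) (dK k)" and \<epsilon>: "\<epsilon> \<longlonglongrightarrow> 0" "\<And>k. \<epsilon> k \<le> 1"
  shows "integrable lborel (\<lambda>x. indicator (cbox a b) x * \<bar>conv (K k) u x - u x\<bar>)"
    "(\<lambda>k. LINT x|lborel. indicator (cbox a b) x * \<bar>conv (K k) u x - u x\<bar>) \<longlonglongrightarrow> 0"
proof -
  let ?B = "cbox a b"
  define B1 where "B1 = cbox (a - (\<chi> i. 1)) (b + (\<chi> i. 1))"
  have um[measurable]: "u \<in> borel_measurable borel" using u by (simp add: loc_integrable_def)
  have [measurable]: "B1 \<in> sets borel" by (simp add: B1_def)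
  have BB: "?B \<subseteq> B1" by (auto simp: B1_def mem_box_cart algebra_simps intro: order_trans[OF _ less_imp_le] add_increasing2)
    (smt (verit))+
  have near: "y \<in> B1" if "x \<in> ?B" "y \<in> cbox (x - (\<chi> i. \<epsilon> k)) (x + (\<chi> i. \<epsilon> k))" for x y k
  proof -
    have "a$i - 1 \<le> y$i \<and> y$i \<le> b$i + 1" for i
    proof -
      have "a$i \<le> x$i" "x$i \<le> b$i" "x$i - \<epsilon> k \<le> y$i" "y$i \<le> x$i + \<epsilon> k" using that by (auto simp: mem_box_cart)
      then show ?thesis using \<epsilon>(2)[of k] by linarith
    qed
    then show ?thesis by (simp add: B1_def mem_box_cart)
  qed
  have cm[measurable]: "conv (K k) w \<in> borel_measurable borel" if "w \<in> borel_measurable borel" for w k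
    by (rule conv_borel_measurable[OF that K])
  have key: "integrable lborel (\<lambda>x. indicator ?B x * \<bar>conv (K k) u x - u x\<bar>)
    \<and> (LINT x|lborel. indicator ?B x * \<bar>conv (K k) u x - u x\<bar>) \<le> 2 * (LINT x|lborel. indicator B1 x * \<bar>u x - g x\<bar>) + e * measure lborel ?B"
    if g: "continuous_on UNIV g" and e: "\<And>x. x \<in> ?B \<Longrightarrow> \<bar>conv (K k) g x - g x\<bar> \<le> e" and e0: "e \<ge> 0" for g e k
  proof -
    have gm[measurable]: "g \<in> borel_measurable borel" using g by (rule borel_measurable_continuous_onI)
    define v where "v x = indicator B1 x * (u x - g x)" for x
    have "set_integrable lborel B1 (\<lambda>x. u x - g x)"
      using u loc_integrable_continuous[OF g] unfolding B1_def loc_integrable_def by (intro set_integral_diff(1)) auto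
    then have iv: "integrable lborel v" by (simp add: set_integrable_def v_def[abs_def])
    note cv = conv_contraction_L1[OF iv K[of k]]
    have iu: "integrable lborel (\<lambda>y. u y * K k (x - y))" for x by (rule integrable_conv_continuous[OF u mollifierD(2,3)[OF K]])
    have ig: "integrable lborel (\<lambda>y. g y * K k (x - y))" for x
      by (rule integrable_conv_continuous[OF loc_integrable_continuous[OF g] mollifierD(2,3)[OF K]])
    have dec: "indicator ?B x * \<bar>conv (K k) u x - u x\<bar> \<le> \<bar>conv (K k) v x\<bar> + indicator ?B x * e + \<bar>v x\<bar>" for x
    proof (cases "x \<in> ?B")
      case True
      have "conv (K k) v x = conv (K k) (\<lambda>x. u x - g x) x"
        by (rule conv_local[OF K]) (use near[OF True] in \<open>simp add: v_def\<close>)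
      also have "\<dots> = conv (K k) u x - conv (K k) g x"
        unfolding conv_def using iu ig by (simp add: left_diff_distrib)
      finally have "conv (K k) u x - u x = conv (K k) v x + (conv (K k) g x - g x) - v x"
        using True BB by (auto simp: v_def)
      then show ?thesis using e[OF True] True by simp
    qed simp
    have iB: "integrable lborel (\<lambda>x. indicator ?B x * e)"
      by (intro integrable_mult_left integrable_real_indicator) (auto simp: emeasure_lborel_cbox_eq)
    have iR: "integrable lborel (\<lambda>x. \<bar>conv (K k) v x\<bar> + indicator ?B x * e + \<bar>v x\<bar>)" using cv(1) iB iv by simp
    have iL: "integrable lborel (\<lambda>x. indicator ?B x * \<bar>conv (K k) u x - u x\<bar>)"
      by (rule Bochner_Integration.integrable_bound[OF iR]) (use dec e0 in \<open>auto intro!: AE_I2 order_trans[OF dec]\<close>)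
    have "(LINT x|lborel. indicator ?B x * \<bar>conv (K k) u x - u x\<bar>) \<le> (LINT x|lborel. \<bar>conv (K k) v x\<bar> + indicator ?B x * e + \<bar>v x\<bar>)"
      by (rule integral_mono[OF iL iR dec])
    also have "\<dots> = (LINT x|lborel. \<bar>conv (K k) v x\<bar>) + measure lborel ?B * e + (LINT x|lborel. \<bar>v x\<bar>)"
      using cv(1) iB iv by simp
    also have "\<dots> \<le> 2 * (LINT x|lborel. \<bar>v x\<bar>) + e * measure lborel ?B" using cv(2) by (simp add: mult.commute)
    also have "(LINT x|lborel. \<bar>v x\<bar>) = (LINT x|lborel. indicator B1 x * \<bar>u x - g x\<bar>)"
      by (simp add: v_def abs_mult)
    finally show ?thesis using iL by simp
  qed
  show "integrable lborel (\<lambda>x. indicator ?B x * \<bar>conv (K k) u x - u x\<bar>)"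
  proof -
    have "conv (K k) (\<lambda>_. 0) x = 0" for x by (simp add: conv_def)
    then show ?thesis using key[of "\<lambda>_. 0" k 0] by simp
  qed
  show "(\<lambda>k. LINT x|lborel. indicator ?B x * \<bar>conv (K k) u x - u x\<bar>) \<longlonglongrightarrow> 0"
  proof (rule tendstoI)
    fix r :: real assume r: "r > 0"
    have r4: "r / 4 > 0" using r by simp
    obtain g where g: "continuous_on UNIV g" "(LINT x|lborel. indicator B1 x * \<bar>u x - g x\<bar>) < r / 4"
      unfolding B1_def by (rule continuous_L1_dense[OF u r4])
    define e where "e = r / (4 * (measure lborel ?B + 1))"
    have mB: "measure lborel ?B \<ge> 0" by simp
    have e: "e > 0" using r by (simp add: e_def add_nonneg_pos)
    have em: "e * measure lborel ?B \<le> r / 4" 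
    proof -
      have "m / (m + 1) \<le> 1" if "m \<ge> 0" for m :: real using that by simp
      from this[OF mB] have "r / 4 * (measure lborel ?B / (measure lborel ?B + 1)) \<le> r / 4 * 1"
        by (rule mult_left_mono) (use r in simp)
      then show ?thesis by (simp only: e_def times_divide_eq_left times_divide_eq_right divide_divide_eq_left mult_1_right mult_ac)
    qed
    have "\<forall>\<^sub>F k in sequentially. \<forall>x\<in>?B. dist (conv (K k) g x) (g x) < e"
      by (rule uniform_limitD[OF conv_uniform_limit[OF g(1) K \<epsilon>(1) compact_cbox] e])
    then show "\<forall>\<^sub>F k in sequentially. dist (LINT x|lborel. indicator ?B x * \<bar>conv (K k) u x - u x\<bar>) 0 < r"
    proof eventually_elim
      case (elim k)
      have "(LINT x|lborel. indicator ?B x * \<bar>conv (K k) u x - u x\<bar>) \<le> 2 * (LINT x|lborel. indicator B1 x * \<bar>u x - g x\<bar>) + e * measure lborel ?B"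
        using key[OF g(1), of k e] elim e by (simp add: dist_real_def less_imp_le)
      also have "\<dots> < r" using g(2) em r by linarith
      finally have lt: "(LINT x|lborel. indicator ?B x * \<bar>conv (K k) u x - u x\<bar>) < r" .
      moreover have "0 \<le> (LINT x|lborel. indicator ?B x * \<bar>conv (K k) u x - u x\<bar>)"
        by (intro Bochner_Integration.integral_nonneg) simp
      ultimately show ?case by (simp add: dist_real_def)
    qed
  qed
qed

section \<open>Weak derivatives and approximation of Sobolev maps\<close>

lemma mollifier_sequence:
  obtains K :: "nat \<Rightarrow> real^'n::finite \<Rightarrow> real" and dK
  where "\<forall>k. mollifier (1 / real (Suc k)) (K k) (dK k)"
proof -
  have "\<forall>k. \<exists>p. mollifier (1 / real (Suc k)) (fst p) (snd p :: real^'n \<Rightarrow> real^'n)"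
  proof
    fix k
    obtain K dK where "mollifier (1 / real (Suc k)) (K :: real^'n \<Rightarrow> real) dK"
      by (rule mollifier_exists[of "1 / real (Suc k)"]) auto
    then show "\<exists>p. mollifier (1 / real (Suc k)) (fst p) (snd p :: real^'n \<Rightarrow> real^'n)" by (intro exI[of _ "(K, dK)"]) simp
  qed
  from choice[OF this] obtain p where "\<forall>k. mollifier (1 / real (Suc k)) (fst (p k)) (snd (p k) :: real^'n \<Rightarrow> real^'n)" ..
  then show ?thesis using that[of "\<lambda>k. fst (p k)" "\<lambda>k. snd (p k)"] by blast
qed

lemma LIMSEQ_inverse_Suc: "(\<lambda>k. 1 / real (Suc k)) \<longlonglongrightarrow> 0"
  using LIMSEQ_inverse_real_of_nat by (simp add: inverse_eq_divide)

text \<open>The weak derivative of a continuous function, with a Borel measurable representative and integrals over the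
Borel measure, so that Tonelli's theorem applies.\<close>

definition weak_deriv :: "'n::finite \<Rightarrow> (real^'n \<Rightarrow> real) \<Rightarrow> (real^'n \<Rightarrow> real) \<Rightarrow> bool" where
  "weak_deriv j u g \<longleftrightarrow> continuous_on UNIV u \<and> loc_integrable g \<and>
    (\<forall>\<phi>. test_function \<phi> \<longrightarrow> (LINT x|lborel. u x * partial_deriv j \<phi> x) = - (LINT x|lborel. g x * \<phi> x))"

lemma weak_deriv_conv:
  assumes "weak_deriv j u g" "mollifier \<epsilon> K dK"
  shows "conv (\<lambda>z. dK z $ j) u = conv K g"
  using assms conv_weak_derivative[of u \<epsilon> K dK j g] by (simp add: weak_deriv_def)

text \<open>The mollifications of two weak derivatives coincide, and they converge in mean to both.\<close>

lemma weak_deriv_unique: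
  fixes u :: "real^'n::finite \<Rightarrow> real"
  assumes g1: "weak_deriv j u g1" and g2: "weak_deriv j u g2"
  shows "AE x in lborel. g1 x = g2 x"
proof -
  obtain K :: "nat \<Rightarrow> real^'n \<Rightarrow> real" and dK where "\<forall>k. mollifier (1 / real (Suc k)) (K k) (dK k)"
    by (rule mollifier_sequence)
  note K = spec[OF this]
  have l: "loc_integrable g1" "loc_integrable g2" using g1 g2 by (auto simp: weak_deriv_def)
  have e1: "1 / real (Suc k) \<le> 1" for k by simp
  have same: "conv (K k) g1 = conv (K k) g2" for k
    using weak_deriv_conv[OF g1 K] weak_deriv_conv[OF g2 K] by metis
  have box: "AE x in lborel. x \<in> cbox a b \<longrightarrow> g1 x = g2 x" for a b
  proof -
    let ?I = "\<lambda>f. LINT x|lborel. indicator (cbox a b) x * \<bar>f x\<bar>"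
    note c1 = conv_L1_limit[OF l(1) K LIMSEQ_inverse_Suc e1, of a b]
    note c2 = conv_L1_limit[OF l(2) K LIMSEQ_inverse_Suc e1, of a b]
    have int: "integrable lborel (\<lambda>x. indicator (cbox a b) x * \<bar>g1 x - g2 x\<bar>)"
    proof -
      have "set_integrable lborel (cbox a b) (\<lambda>x. g1 x - g2 x)"
        using l by (intro set_integral_diff(1)) (auto simp: loc_integrable_def)
      then have "integrable lborel (\<lambda>x. indicator (cbox a b) x *\<^sub>R (g1 x - g2 x))" by (simp add: set_integrable_def)
      from integrable_abs[OF this] show ?thesis by (simp add: abs_mult)
    qed
    have le: "?I (\<lambda>x. g1 x - g2 x) \<le> ?I (\<lambda>x. conv (K k) g1 x - g1 x) + ?I (\<lambda>x. conv (K k) g2 x - g2 x)" for k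
    proof -
      have "?I (\<lambda>x. g1 x - g2 x) \<le> (LINT x|lborel. indicator (cbox a b) x * \<bar>conv (K k) g1 x - g1 x\<bar> + indicator (cbox a b) x * \<bar>conv (K k) g2 x - g2 x\<bar>)"
        using c1(1)[of k] c2(1)[of k] by (intro integral_mono int) (auto simp: indicator_def same)
      also have "\<dots> = ?I (\<lambda>x. conv (K k) g1 x - g1 x) + ?I (\<lambda>x. conv (K k) g2 x - g2 x)"
        using c1(1)[of k] c2(1)[of k] by simp
      finally show ?thesis .
    qed
    have "(\<lambda>k. ?I (\<lambda>x. conv (K k) g1 x - g1 x) + ?I (\<lambda>x. conv (K k) g2 x - g2 x)) \<longlonglongrightarrow> 0 + 0"
      by (intro tendsto_add c1(2) c2(2))
    then have "?I (\<lambda>x. g1 x - g2 x) \<le> 0 + 0" by (rule LIMSEQ_le_const) (use le in blast)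
    moreover have "?I (\<lambda>x. g1 x - g2 x) \<ge> 0" by (intro Bochner_Integration.integral_nonneg) simp
    ultimately have "?I (\<lambda>x. g1 x - g2 x) = 0" by simp
    then have "AE x in lborel. indicator (cbox a b) x * \<bar>g1 x - g2 x\<bar> = 0"
      using integral_nonneg_eq_0_iff_AE[OF int] by simp
    then show ?thesis by eventually_elim auto
  qed
  have "AE x in lborel. \<forall>n::nat. x \<in> cbox (\<chi> i. - real n) (\<chi> i. real n) \<longrightarrow> g1 x = g2 x"
    unfolding AE_all_countable using box by blast
  then show ?thesis
  proof eventually_elim
    case (elim x)
    obtain n :: nat where n: "norm x \<le> real n" using real_arch_simple by blast
    have "\<bar>x$i\<bar> \<le> real n" for i using component_le_norm_cart[of x i] n by linarith
    then have "x \<in> cbox (\<chi> i. - real n) (\<chi> i. real n)" by (simp add: mem_box_cart abs_le_iff) (metis minus_le_iff)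
    then show ?case using elim by blast
  qed
qed

text \<open>Near \<open>x0\<close> the gradients of the mollified functions vanish, so these are constant on a common ball, and so is
their uniform limit.\<close>

lemma weak_deriv_zero_imp_locally_constant:
  fixes u :: "real^'n::finite \<Rightarrow> real"
  assumes w: "\<And>j. weak_deriv j u (g j)" and U: "open U" "x0 \<in> U"
    and zero: "\<And>j. AE x in lborel. x \<in> U \<longrightarrow> g j x = 0"
  obtains V where "open V" "x0 \<in> V" "\<And>x. x \<in> V \<Longrightarrow> u x = u x0"
proof -
  obtain r where r: "r > 0" "ball x0 r \<subseteq> U" using U openE by blast
  let ?n = "real CARD('n)"
  define \<delta> where "\<delta> = r / (2 * ?n)"
  have \<delta>: "\<delta> > 0" using r by (simp add: \<delta>_def)
  let ?V = "ball x0 (r / 2)"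
  have sub: "cbox (x - (\<chi> i. \<epsilon>)) (x + (\<chi> i. \<epsilon>)) \<subseteq> U" if x: "x \<in> ?V" and \<epsilon>: "\<epsilon> < \<delta>" for x \<epsilon>
  proof
    fix y assume "y \<in> cbox (x - (\<chi> i. \<epsilon>)) (x + (\<chi> i. \<epsilon>))"
    then have yi: "\<bar>(y - x)$i\<bar> \<le> \<epsilon>" for i by (auto simp: mem_box_cart abs_le_iff algebra_simps)
    have "norm (y - x) \<le> (\<Sum>i\<in>UNIV. \<bar>(y - x)$i\<bar>)" by (rule norm_le_l1_cart)
    also have "\<dots> \<le> (\<Sum>i\<in>(UNIV::'n set). \<epsilon>)" by (intro sum_mono yi)
    also have "\<dots> = ?n * \<epsilon>" by simp
    also have "\<dots> < ?n * \<delta>" using \<epsilon> by simp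
    also have "\<dots> = r / 2" by (simp add: \<delta>_def)
    finally have "dist x y < r / 2" by (simp add: dist_norm norm_minus_commute)
    then have "dist x0 y < r" using x dist_triangle[of x0 y x] by simp
    then show "y \<in> U" using r by auto
  qed
  obtain K :: "nat \<Rightarrow> real^'n \<Rightarrow> real" and dK where "\<forall>k. mollifier (1 / real (Suc k)) (K k) (dK k)"
    by (rule mollifier_sequence)
  note K = spec[OF this]
  have cu: "continuous_on UNIV u" using w by (auto simp: weak_deriv_def)
  have const: "conv (K k) u x = conv (K k) u x0" if k: "1 / real (Suc k) < \<delta>" and x: "x \<in> ?V" for k x
  proof -
    have "(conv (K k) u has_derivative (\<lambda>h. 0)) (at y within ?V)" if y: "y \<in> ?V" for y
    proof -
      have "conv (\<lambda>z. dK k z $ j) u y = 0" for j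
      proof -
        have "conv (\<lambda>z. dK k z $ j) u y = (LINT z|lborel. g j z * K k (y - z))"
          using weak_deriv_conv[OF w K] by (simp add: conv_def)
        also have "\<dots> = (LINT z|(lborel :: (real^'n) measure). 0)"
        proof (rule integral_cong_AE)
          have [measurable]: "K k \<in> borel_measurable borel" "g j \<in> borel_measurable borel"
            using mollifierD(2)[OF K] w by (auto simp: weak_deriv_def loc_integrable_def intro: borel_measurable_continuous_onI)
          show "(\<lambda>z. g j z * K k (y - z)) \<in> borel_measurable lborel" by measurable
          show "AE z in lborel. g j z * K k (y - z) = 0"
            using zero[of j]
          proof eventually_elim
            case (elim z)
            show ?case
            proof (cases "y - z \<in> cbox (\<chi> i. - (1 / real (Suc k))) (\<chi> i. 1 / real (Suc k))")
              case True
              then have 1: "- (1 / real (Suc k)) \<le> y$i - z$i \<and> y$i - z$i \<le> 1 / real (Suc k)" for i by (simp add: mem_box_cart)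
              have "y$i - 1 / real (Suc k) \<le> z$i \<and> z$i \<le> y$i + 1 / real (Suc k)" for i using 1[of i] by linarith
              then have "z \<in> cbox (y - (\<chi> i. 1 / real (Suc k))) (y + (\<chi> i. 1 / real (Suc k)))" by (simp add: mem_box_cart)
              then have "z \<in> U" using sub[OF y k] by blast
              with elim show ?thesis by simp
            next
              case False
              from mollifierD(3)[OF K this] show ?thesis by simp
            qed
          qed
        qed simp
        finally show ?thesis by simp
      qed
      then have "(\<chi> j. conv (\<lambda>z. dK k z $ j) u y) = 0" by (simp add: vec_eq_iff)
      with conv_has_derivative[OF cu K[of k], of y] have "(conv (K k) u has_derivative (\<lambda>h. 0)) (at y)" by simp
      then show ?thesis by (rule has_derivative_at_withinI)
    qed
    then obtain c where "\<And>y. y \<in> ?V \<Longrightarrow> conv (K k) u y = c"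
      using has_derivative_zero_constant[OF convex_ball, of x0 "r / 2" "conv (K k) u"] by blast
    then show ?thesis using x r by simp
  qed
  have lim: "(\<lambda>k. conv (K k) u x) \<longlonglongrightarrow> u x" for x
    using tendsto_uniform_limitI[OF conv_uniform_limit[OF cu K LIMSEQ_inverse_Suc, of "{x}"]] by simp
  have uc: "u x = u x0" if x: "x \<in> ?V" for x
  proof (rule LIMSEQ_unique[OF lim])
    have "\<forall>\<^sub>F k in sequentially. 1 / real (Suc k) < \<delta>" using LIMSEQ_inverse_Suc \<delta> by (intro order_tendstoD(2)) auto
    then have "\<forall>\<^sub>F k in sequentially. conv (K k) u x0 = conv (K k) u x"
      by eventually_elim (use const x in simp)
    with lim[of x0] show "(\<lambda>k. conv (K k) u x) \<longlonglongrightarrow> u x0" by (rule Lim_transform_eventually)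
  qed
  show ?thesis
  proof (rule that)
    show "open ?V" by simp
    show "x0 \<in> ?V" using r by simp
    show "u x = u x0" if "x \<in> ?V" for x using that by (rule uc)
  qed
qed

text \<open>Maps \<open>g k\<close> of class \<open>C\<^sup>1\<close> approximate the Sobolev map \<open>f\<close> with derivative \<open>D\<close> well enough to pass to the limit
in every integral of a continuous integrand that grows at most like the \<open>n\<close>-th power of the derivative. The
Jacobian determinant and the energy are of this kind.\<close>

definition approximates :: "(real^'n::finite) set \<Rightarrow> (real^'n \<Rightarrow> real^'n) \<Rightarrow> (real^'n \<Rightarrow> real^'n^'n) \<Rightarrow> (nat \<Rightarrow> real^'n \<Rightarrow> real^'n) \<Rightarrow> (nat \<Rightarrow> real^'n \<Rightarrow> real^'n^'n) \<Rightarrow> bool" where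
  "approximates B f D g G \<longleftrightarrow> (\<forall>k. C1_with (g k) (G k)) \<and> uniform_limit B g f sequentially \<and>
    (\<forall>\<kappa> F c. continuous_on UNIV \<kappa> \<longrightarrow> continuous_on UNIV F \<longrightarrow> 0 \<le> c \<longrightarrow> (\<forall>A. \<bar>F A\<bar> \<le> c * (\<Sum>i\<in>UNIV. \<Sum>j\<in>UNIV. \<bar>A$i$j\<bar> ^ CARD('n))) \<longrightarrow>
      integrable lborel (\<lambda>x. indicator B x * (\<kappa> (f x) * F (D x))) \<and>
      (\<lambda>k. LINT x|lborel. indicator B x * (\<kappa> (g k x) * F (G k x))) \<longlonglongrightarrow> (LINT x|lborel. indicator B x * (\<kappa> (f x) * F (D x))))"

lemma has_derivative_vec:
  fixes f :: "'a::real_normed_vector \<Rightarrow> real^'n::finite"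
  assumes "\<And>i. ((\<lambda>x. f x $ i) has_derivative (\<lambda>h. f' h $ i)) (at x)"
  shows "(f has_derivative f') (at x)"
  using assms by (subst has_derivative_componentwise_within) (auto simp: Basis_vec_def inner_axis)

lemma integral_sum_sum:
  fixes A :: "'i::finite \<Rightarrow> 'j::finite \<Rightarrow> 'a \<Rightarrow> real"
  assumes "\<And>i j. integrable M (A i j)"
  shows "(LINT x|M. (\<Sum>i\<in>UNIV. \<Sum>j\<in>UNIV. A i j x)) = (\<Sum>i\<in>UNIV. \<Sum>j\<in>UNIV. LINT x|M. A i j x)"
  using assms by (simp add: Bochner_Integration.integral_sum Bochner_Integration.integrable_sum)

text \<open>The mollified maps converge uniformly and, along a subsequence, their derivatives converge almost everywhere.
By Jensen's inequality the \<open>n\<close>-th powers of the mollified derivatives are bounded by the mollified \<open>n\<close>-th powers,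
which converge in mean. So the perturbed form of dominated convergence applies.\<close>

lemma sobolev_approximation:
  fixes f :: "real^'n::finite \<Rightarrow> real^'n" and D :: "real^'n \<Rightarrow> real^'n^'n"
  assumes w: "\<And>i j. weak_deriv j (\<lambda>x. f x $ i) (\<lambda>x. D x $ i $ j)"
    and Dn: "\<And>i j. loc_integrable (\<lambda>x. \<bar>D x $ i $ j\<bar> ^ CARD('n))"
  obtains g G where "approximates (cbox a b) f D g G"
proof -
  let ?B = "cbox a b" and ?N = "CARD('n)"
  obtain K :: "nat \<Rightarrow> real^'n \<Rightarrow> real" and dK where "\<forall>k. mollifier (1 / real (Suc k)) (K k) (dK k)"
    by (rule mollifier_sequence)
  note K = spec[OF this]
  have e1: "1 / real (Suc k) \<le> 1" for k by simp
  have N1: "?N \<ge> 1" by (simp add: Suc_leI)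
  have cf: "continuous_on UNIV (\<lambda>x. f x $ i)" and D1: "loc_integrable (\<lambda>x. D x $ i $ j)" for i j
    using w[of j i] by (auto simp: weak_deriv_def)
  have cfv: "continuous_on UNIV f"
    using continuous_on_vec_lambda[of UNIV "\<lambda>i x. f x $ i"] cf by simp
  have Dm[measurable]: "(\<lambda>x. D x $ i $ j) \<in> borel_measurable borel" for i j using D1 by (simp add: loc_integrable_def)
  define g where "g k x = (\<chi> i. conv (K k) (\<lambda>y. f y $ i) x)" for k x
  define G where "G k x = (\<chi> i j. conv (K k) (\<lambda>y. D y $ i $ j) x)" for k x
  have C1: "C1_with (g k) (G k)" for k
    unfolding C1_with_def
  proof (intro conjI allI)
    fix x
    show "(g k has_derivative (*v) (G k x)) (at x)"
    proof (rule has_derivative_vec)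
      fix i
      have eq: "(\<lambda>h. (G k x *v h) $ i) = (\<lambda>h. (\<chi> j. conv (\<lambda>z. dK k z $ j) (\<lambda>y. f y $ i) x) \<bullet> h)"
        using weak_deriv_conv[OF w K] by (simp add: G_def matrix_vector_mult_def inner_vec_def)
      show "((\<lambda>x. g k x $ i) has_derivative (\<lambda>h. (G k x *v h) $ i)) (at x)"
        unfolding eq using conv_has_derivative[OF cf[of i] K[of k], of x] by (simp add: g_def)
    qed
    have "continuous_on UNIV (conv (K k) (\<lambda>y. D y $ i $ j))" for i j
      unfolding weak_deriv_conv[OF w K, symmetric]
    proof (rule conv_continuous_kernel[OF cf])
      show "continuous_on UNIV (\<lambda>z. dK k z $ j)" by (intro continuous_intros mollifierD(8)[OF K])
      show "dK k z $ j = 0" if "z \<notin> cbox (\<chi> i. - (1 / real (Suc k))) (\<chi> i. 1 / real (Suc k))" for z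
        using mollifierD(4)[OF K that] by simp
    qed
    then show "continuous_on UNIV (G k)" unfolding G_def[abs_def] by (intro continuous_on_vec_lambda)
  qed
  have unif: "uniform_limit ?B g f sequentially"
  proof (rule uniform_limitI)
    fix e :: real assume e: "e > 0"
    have "\<forall>\<^sub>F k in sequentially. \<forall>x\<in>?B. dist (conv (K k) (\<lambda>y. f y $ i) x) (f x $ i) < e / (2 * real ?N)" for i
      by (rule uniform_limitD[OF conv_uniform_limit[OF cf K LIMSEQ_inverse_Suc compact_cbox]]) (use e in simp)
    then have "\<forall>\<^sub>F k in sequentially. \<forall>i\<in>UNIV. \<forall>x\<in>?B. dist (conv (K k) (\<lambda>y. f y $ i) x) (f x $ i) < e / (2 * real ?N)"
      by (intro eventually_ball_finite) auto
    then show "\<forall>\<^sub>F k in sequentially. \<forall>x\<in>?B. dist (g k x) (f x) < e"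
    proof eventually_elim
      case (elim k)
      show ?case
      proof
        fix x assume x: "x \<in> ?B"
        have "norm (g k x - f x) \<le> (\<Sum>i\<in>UNIV. \<bar>(g k x - f x) $ i\<bar>)" by (rule norm_le_l1_cart)
        also have "\<dots> \<le> (\<Sum>i\<in>(UNIV::'n set). e / (2 * real ?N))"
          using elim x by (intro sum_mono) (force simp: g_def dist_real_def less_imp_le)
        also have "\<dots> < e" using e by simp
        finally show "dist (g k x) (f x) < e" by (simp add: dist_norm)
      qed
    qed
  qed
  note cD = conv_L1_limit[OF D1 K LIMSEQ_inverse_Suc e1, of a b]
  note cDn = conv_L1_limit[OF Dn K LIMSEQ_inverse_Suc e1, of a b]
  define s where "s k x = (\<Sum>i\<in>UNIV. \<Sum>j\<in>UNIV. indicator ?B x * \<bar>G k x $ i $ j - D x $ i $ j\<bar>)" for k x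
  have s0: "s k x \<ge> 0" for k x unfolding s_def by (intro sum_nonneg) simp
  have ints: "integrable lborel (s k)" for k unfolding s_def[abs_def] G_def using cD(1) by (intro Bochner_Integration.integrable_sum) simp
  have "(\<lambda>k. LINT x|lborel. s k x) \<longlonglongrightarrow> (\<Sum>i\<in>(UNIV::'n set). \<Sum>j\<in>(UNIV::'n set). 0)"
  proof -
    have "(LINT x|lborel. s k x) = (\<Sum>i\<in>UNIV. \<Sum>j\<in>UNIV. LINT x|lborel. indicator ?B x * \<bar>conv (K k) (\<lambda>y. D y $ i $ j) x - D x $ i $ j\<bar>)" for k
      unfolding s_def G_def vec_lambda_beta by (rule integral_sum_sum[OF cD(1)])
    then show ?thesis by (simp only:) (intro tendsto_sum cD(2))
  qed
  then have "(\<lambda>k. LINT x|lborel. norm (s k x)) \<longlonglongrightarrow> 0" using s0 by simp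
  from tendsto_L1_AE_subseq[OF ints this] obtain r where r: "strict_mono r" "AE x in lborel. (\<lambda>k. s (r k) x) \<longlonglongrightarrow> 0" by blast
  have "compact (f ` ?B)" by (intro compact_continuous_image continuous_on_subset[OF cfv]) auto
  then obtain R where R: "\<And>x. x \<in> ?B \<Longrightarrow> norm (f x) \<le> R" by (meson bounded_iff compact_imp_bounded imageI)
  have "\<forall>\<^sub>F k in sequentially. \<forall>x\<in>?B. dist (g k x) (f x) < 1" using unif by (rule uniform_limitD) simp
  then obtain k0 where k0: "\<And>k x. k \<ge> k0 \<Longrightarrow> x \<in> ?B \<Longrightarrow> dist (g k x) (f x) < 1" by (auto simp: eventually_sequentially)
  \<comment> \<open>The shift makes all maps uniformly bounded on the box, so that \<open>\<kappa>\<close> is bounded along the sequence.\<close>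
  define q where "q k = r (k + k0)" for k
  have q: "strict_mono q" using r(1) by (simp add: q_def strict_mono_def)
  have qk: "q k \<ge> k0" for k using seq_suble[OF r(1), of "k + k0"] by (simp add: q_def)
  have fq: "filterlim q sequentially sequentially" using q by (rule filterlim_subseq)
  have aes: "AE x in lborel. (\<lambda>k. s (q k) x) \<longlonglongrightarrow> 0"
    using r(2)
  proof eventually_elim
    case (elim x)
    then show ?case unfolding q_def by (rule LIMSEQ_ignore_initial_segment)
  qed
  have gb: "norm (g (q k) x) \<le> R + 1" if "x \<in> ?B" for k x
  proof -
    have "norm (g (q k) x) \<le> norm (f x) + dist (g (q k) x) (f x)" by (simp add: dist_norm norm_triangle_sub)
    then show ?thesis using R[OF that] k0[OF qk that, of k] by linarith
  qed
  have unifq: "uniform_limit ?B (\<lambda>k. g (q k)) f sequentially" using filterlim_compose[OF unif fq] .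
  have "approximates ?B f D (\<lambda>k. g (q k)) (\<lambda>k. G (q k))"
    unfolding approximates_def
  proof (intro conjI allI impI)
    show "C1_with (g (q k)) (G (q k))" for k by (rule C1)
    show "uniform_limit ?B (\<lambda>k. g (q k)) f sequentially" by (rule unifq)
    fix \<kappa> :: "real^'n \<Rightarrow> real" and F :: "real^'n^'n \<Rightarrow> real" and c :: real
    assume \<kappa>: "continuous_on UNIV \<kappa>" and F: "continuous_on UNIV F" and c0: "0 \<le> c"
      and c: "\<forall>A. \<bar>F A\<bar> \<le> c * (\<Sum>i\<in>UNIV. \<Sum>j\<in>UNIV. \<bar>A$i$j\<bar> ^ ?N)"
    have "compact (\<kappa> ` cball 0 (R + 1))" by (intro compact_continuous_image continuous_on_subset[OF \<kappa>]) auto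
    then obtain M0 where M0: "\<And>y. y \<in> cball 0 (R + 1) \<Longrightarrow> norm (\<kappa> y) \<le> M0" by (meson bounded_iff compact_imp_bounded imageI)
    define M where "M = max M0 0"
    have M: "M \<ge> 0" "\<And>y. norm y \<le> R + 1 \<Longrightarrow> \<bar>\<kappa> y\<bar> \<le> M" using M0 by (force simp: M_def)+
    define H where "H x = (\<Sum>i\<in>UNIV. \<Sum>j\<in>UNIV. M * c * (indicator ?B x * \<bar>D x $ i $ j\<bar> ^ ?N))" for x
    define h where "h k x = (\<Sum>i\<in>UNIV. \<Sum>j\<in>UNIV. M * c * (indicator ?B x * \<bar>conv (K (q k)) (\<lambda>y. \<bar>D y $ i $ j\<bar> ^ ?N) x - \<bar>D x $ i $ j\<bar> ^ ?N\<bar>))" for k x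
    have Fm[measurable]: "F \<in> borel_measurable borel" and km[measurable]: "\<kappa> \<in> borel_measurable borel"
      using F \<kappa> by (auto intro: borel_measurable_continuous_onI)
    have Dmv[measurable]: "D \<in> borel_measurable borel"
    proof -
      have "(\<lambda>x. D x \<bullet> b) \<in> borel_measurable borel" if "b \<in> Basis" for b
        using that by (auto simp: Basis_vec_def inner_axis)
      then show ?thesis by (subst borel_measurable_euclidean_space) auto
    qed
    have fm[measurable]: "f \<in> borel_measurable borel" using cfv by (rule borel_measurable_continuous_onI)
    have gm[measurable]: "g k \<in> borel_measurable borel" "G k \<in> borel_measurable borel" for k
      using C1_withD(2,3)[OF C1] by (auto intro: borel_measurable_continuous_onI)
    have bF: "\<bar>indicator ?B x * (\<kappa> y * F A)\<bar> \<le> (\<Sum>i\<in>UNIV. \<Sum>j\<in>UNIV. M * c * (indicator ?B x * \<bar>A$i$j\<bar> ^ ?N))"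
      if "x \<in> ?B \<Longrightarrow> norm y \<le> R + 1" for x y A
    proof (cases "x \<in> ?B")
      case True
      have "\<bar>\<kappa> y * F A\<bar> \<le> M * (c * (\<Sum>i\<in>UNIV. \<Sum>j\<in>UNIV. \<bar>A$i$j\<bar> ^ ?N))"
        unfolding abs_mult using M that[OF True] c by (intro mult_mono) auto
      then show ?thesis using True by (simp add: sum_distrib_left mult.assoc)
    qed simp
    have perturbed: "\<And>k. (\<lambda>x. indicator ?B x * (\<kappa> (g (q k) x) * F (G (q k) x))) \<in> borel_measurable lborel"
      "(\<lambda>x. indicator ?B x * (\<kappa> (f x) * F (D x))) \<in> borel_measurable lborel"
      by measurable
    have lim: "AE x in lborel. (\<lambda>k. indicator ?B x * (\<kappa> (g (q k) x) * F (G (q k) x))) \<longlonglongrightarrow> indicator ?B x * (\<kappa> (f x) * F (D x))"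
      using aes
    proof eventually_elim
      case (elim x)
      show ?case
      proof (cases "x \<in> ?B")
        case True
        have "(\<lambda>k. G (q k) x $ i $ j) \<longlonglongrightarrow> D x $ i $ j" for i j
        proof (rule LIM_zero_cancel, rule Lim_null_comparison[OF _ elim], rule always_eventually, rule allI)
          fix k
          have "\<bar>G (q k) x $ i $ j - D x $ i $ j\<bar> \<le> (\<Sum>j\<in>UNIV. \<bar>G (q k) x $ i $ j - D x $ i $ j\<bar>)"
            by (rule member_le_sum) auto
          also have "\<dots> \<le> (\<Sum>i\<in>UNIV. \<Sum>j\<in>UNIV. \<bar>G (q k) x $ i $ j - D x $ i $ j\<bar>)"
            by (rule member_le_sum[of i UNIV "\<lambda>i. \<Sum>j\<in>UNIV. \<bar>G (q k) x $ i $ j - D x $ i $ j\<bar>"]) (auto intro: sum_nonneg)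
          finally show "norm (G (q k) x $ i $ j - D x $ i $ j) \<le> s (q k) x" using True by (simp add: s_def)
        qed
        then have "(\<lambda>k. G (q k) x) \<longlonglongrightarrow> D x" by (intro vec_tendstoI)
        then have "(\<lambda>k. F (G (q k) x)) \<longlonglongrightarrow> F (D x)"
          using F by (intro continuous_on_tendsto_compose[OF F]) auto
        moreover have "(\<lambda>k. g (q k) x) \<longlonglongrightarrow> f x" by (rule tendsto_uniform_limitI[OF unifq True])
        then have "(\<lambda>k. \<kappa> (g (q k) x)) \<longlonglongrightarrow> \<kappa> (f x)" by (intro continuous_on_tendsto_compose[OF \<kappa>]) auto
        ultimately show ?thesis by (intro tendsto_intros)
      qed simp
    qed
    have iH: "integrable lborel H"
      unfolding H_def[abs_def] using Dn
      by (intro Bochner_Integration.integrable_sum integrable_mult_right) (simp add: loc_integrable_def set_integrable_def)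
    have ih: "integrable lborel (h k)" for k
      unfolding h_def[abs_def] using cDn(1)
      by (intro Bochner_Integration.integrable_sum integrable_mult_right)
    have limh: "(\<lambda>k. LINT x|lborel. h k x) \<longlonglongrightarrow> 0"
    proof -
      have *: "(LINT x|lborel. h k x) = (\<Sum>i\<in>UNIV. \<Sum>j\<in>UNIV. M * c * (LINT x|lborel. indicator ?B x * \<bar>conv (K (q k)) (\<lambda>y. \<bar>D y $ i $ j\<bar> ^ ?N) x - \<bar>D x $ i $ j\<bar> ^ ?N\<bar>))" for k
        unfolding h_def by (subst integral_sum_sum) (rule integrable_mult_right[OF cDn(1)], simp)
      have "(\<lambda>k. LINT x|lborel. h k x) \<longlonglongrightarrow> (\<Sum>i\<in>(UNIV::'n set). \<Sum>j\<in>(UNIV::'n set). M * c * 0)"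
        unfolding * by (intro tendsto_sum tendsto_mult_left filterlim_compose[OF cDn(2) fq])
      then show ?thesis by simp
    qed
    have b1: "\<bar>indicator ?B x * (\<kappa> (f x) * F (D x))\<bar> \<le> H x" for x
      unfolding H_def by (rule bF) (use R in force)
    have b2: "\<bar>indicator ?B x * (\<kappa> (g (q k) x) * F (G (q k) x))\<bar> \<le> H x + h k x" for k x
    proof -
      have "\<bar>indicator ?B x * (\<kappa> (g (q k) x) * F (G (q k) x))\<bar> \<le> (\<Sum>i\<in>UNIV. \<Sum>j\<in>UNIV. M * c * (indicator ?B x * \<bar>G (q k) x$i$j\<bar> ^ ?N))"
        by (rule bF) (rule gb)
      also have "\<dots> \<le> (\<Sum>i\<in>UNIV. \<Sum>j\<in>UNIV. M * c * (indicator ?B x * (\<bar>D x $ i $ j\<bar> ^ ?N + \<bar>conv (K (q k)) (\<lambda>y. \<bar>D y $ i $ j\<bar> ^ ?N) x - \<bar>D x $ i $ j\<bar> ^ ?N\<bar>)))"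
      proof (intro sum_mono mult_left_mono)
        fix i j
        have "\<bar>G (q k) x$i$j\<bar> ^ ?N \<le> conv (K (q k)) (\<lambda>y. \<bar>D y $ i $ j\<bar> ^ ?N) x"
          unfolding G_def using conv_power_le[OF D1 Dn K N1] by simp
        also have "\<dots> \<le> \<bar>D x $ i $ j\<bar> ^ ?N + \<bar>conv (K (q k)) (\<lambda>y. \<bar>D y $ i $ j\<bar> ^ ?N) x - \<bar>D x $ i $ j\<bar> ^ ?N\<bar>" by simp
        finally show "\<bar>G (q k) x$i$j\<bar> ^ ?N \<le> \<bar>D x $ i $ j\<bar> ^ ?N + \<bar>conv (K (q k)) (\<lambda>y. \<bar>D y $ i $ j\<bar> ^ ?N) x - \<bar>D x $ i $ j\<bar> ^ ?N\<bar>" .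
      qed (use M c0 in auto)
      also have "\<dots> = H x + h k x"
        by (simp add: H_def h_def distrib_left sum.distrib)
      finally show ?thesis .
    qed
    have h0: "0 \<le> h k x" for k x unfolding h_def using M c0 by (intro sum_nonneg mult_nonneg_nonneg) auto
    note conc = integral_dominated_convergence_perturbed[OF perturbed lim iH b1 ih limh b2 h0]
    show "integrable lborel (\<lambda>x. indicator ?B x * (\<kappa> (f x) * F (D x)))" by (rule conc(1))
    show "(\<lambda>k. LINT x|lborel. indicator ?B x * (\<kappa> (g (q k) x) * F (G (q k) x))) \<longlonglongrightarrow> (LINT x|lborel. indicator ?B x * (\<kappa> (f x) * F (D x)))"
      by (rule conc(3))
  qed
  then show ?thesis by (rule that)
qed

section \<open>The degree identity, the maximum principle and the energy of a quasiregular map\<close>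

lemma Lp_loc_borel_representative:
  fixes g g' :: "real^'n::finite \<Rightarrow> real"
  assumes g: "g \<in> Lp_loc p" and g'[measurable]: "g' \<in> borel_measurable borel" and ae: "AE x in lborel. g x = g' x"
  shows "set_integrable lborel (cbox a b) (\<lambda>x. \<bar>g' x\<bar> powr p)"
proof -
  have gm: "g \<in> borel_measurable lebesgue" and i: "integrable lebesgue (\<lambda>x. indicator (cbox a b) x *\<^sub>R (\<bar>g x\<bar> powr p))"
    using g by (auto simp: Lp_loc_def set_integrable_def)
  have m: "(\<lambda>x. indicator (cbox a b) x *\<^sub>R (\<bar>g' x\<bar> powr p)) \<in> borel_measurable lborel" by measurable
  have "AE x in lebesgue. g x = g' x" using ae by (rule AE_completion)
  then have "AE x in lebesgue. indicator (cbox a b) x *\<^sub>R (\<bar>g x\<bar> powr p) = indicator (cbox a b) x *\<^sub>R (\<bar>g' x\<bar> powr p)"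
    by eventually_elim simp
  then have "integrable lebesgue (\<lambda>x. indicator (cbox a b) x *\<^sub>R (\<bar>g' x\<bar> powr p))"
    using i m by (intro integrable_cong_AE_imp[OF i]) (auto simp: measurable_completion)
  then show ?thesis unfolding set_integrable_def using integrable_completion[OF m] by simp
qed

lemma weak_deriv_representative:
  fixes u g g' :: "real^'n::finite \<Rightarrow> real"
  assumes w: "weak_partial_deriv j u g" and u: "continuous_on UNIV u"
    and g'[measurable]: "g' \<in> borel_measurable borel" and ae: "AE x in lborel. g x = g' x"
  shows "weak_deriv j u g'"
proof -
  have gL: "g \<in> Lp_loc 1" using w by (simp add: weak_partial_deriv_def)
  have gm: "g \<in> borel_measurable lebesgue" using gL by (simp add: Lp_loc_def)
  have [measurable]: "u \<in> borel_measurable borel" using u by (rule borel_measurable_continuous_onI)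
  have loc: "loc_integrable g'"
    unfolding loc_integrable_def
  proof (intro conjI allI)
    fix a b
    have "integrable lborel (\<lambda>x. \<bar>indicator (cbox a b) x *\<^sub>R g' x\<bar>)"
      using Lp_loc_borel_representative[OF gL g' ae, of a b] by (simp add: set_integrable_def abs_mult)
    then show "set_integrable lborel (cbox a b) g'"
      unfolding set_integrable_def by (subst (asm) integrable_abs_iff) auto
  qed (rule g')
  have aec: "AE x in lebesgue. g x = g' x" using ae by (rule AE_completion)
  have "(LINT x|lborel. u x * partial_deriv j \<phi> x) = - (LINT x|lborel. g' x * \<phi> x)" if \<phi>: "test_function \<phi>" for \<phi>
  proof -
    have "C_k 0 \<phi>" "C_k (Suc 0) \<phi>" using \<phi> by (auto simp: test_function_def simp del: C_k.simps)
    then have "continuous_on UNIV \<phi>" "continuous_on UNIV (partial_deriv j \<phi>)" by auto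
    then have [measurable]: "\<phi> \<in> borel_measurable borel" "partial_deriv j \<phi> \<in> borel_measurable borel"
      by (auto intro: borel_measurable_continuous_onI)
    have "(LINT x|lborel. u x * partial_deriv j \<phi> x) = (LINT x|lebesgue. u x * partial_deriv j \<phi> x)"
      by (rule integral_completion[symmetric]) measurable
    also have "\<dots> = - (LINT x|lebesgue. g x * \<phi> x)" using w \<phi> by (simp add: weak_partial_deriv_def)
    also have "(LINT x|lebesgue. g x * \<phi> x) = (LINT x|lebesgue. g' x * \<phi> x)"
    proof (rule integral_cong_AE)
      have "\<phi> \<in> borel_measurable lebesgue" "g' \<in> borel_measurable lebesgue" by (simp_all add: measurable_completion)
      then show "(\<lambda>x. g x * \<phi> x) \<in> borel_measurable lebesgue" "(\<lambda>x. g' x * \<phi> x) \<in> borel_measurable lebesgue"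
        using gm by (auto intro!: borel_measurable_times)
      show "AE x in lebesgue. g x * \<phi> x = g' x * \<phi> x" using aec by eventually_elim simp
    qed
    also have "\<dots> = (LINT x|lborel. g' x * \<phi> x)" by (rule integral_completion) measurable
    finally show ?thesis .
  qed
  then show ?thesis using u loc by (simp add: weak_deriv_def)
qed

text \<open>The weak derivative enters twice in the definition of quasiregularity, once in the Sobolev condition and once
in the distortion inequality. Here one Borel representative serves for both.\<close>

definition quasiregular_data :: "(real^'n::finite \<Rightarrow> real^'n) \<Rightarrow> real \<Rightarrow> (real^'n \<Rightarrow> real^'n^'n) \<Rightarrow> bool" where
  "quasiregular_data f K D \<longleftrightarrow> K \<ge> 1 \<and> (\<forall>i j. weak_deriv j (\<lambda>x. f x $ i) (\<lambda>x. D x $ i $ j))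
    \<and> (\<forall>i j. loc_integrable (\<lambda>x. \<bar>D x $ i $ j\<bar> ^ CARD('n)))
    \<and> (AE x in lborel. onorm (\<lambda>v. D x *v v) ^ CARD('n) \<le> K * det (D x))"

text \<open>The two weak derivatives in the definition agree almost everywhere by uniqueness, so the integrability of
one of them is inherited by the other.\<close>

lemma quasiregular_data_exists:
  fixes f :: "real^'n::finite \<Rightarrow> real^'n"
  assumes f: "quasiregular f"
  obtains K D where "quasiregular_data f K D"
proof -
  have cf: "continuous_on UNIV f" and fW: "f \<in> W1_loc (real CARD('n))" using f by (auto simp: quasiregular_def)
  have cfi: "continuous_on UNIV (\<lambda>x. f x $ i)" for i by (intro continuous_intros cf)
  obtain K D1 where K: "K \<ge> 1" and D1: "weak_jacobian f D1" "AE x in lebesgue. onorm (\<lambda>v. D1 x *v v) ^ CARD('n) \<le> K * det (D1 x)"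
    using f unfolding quasiregular_def by blast
  obtain D2 where D2: "weak_jacobian f D2" "\<And>i j. (\<lambda>x. D2 x $ i $ j) \<in> Lp_loc (real CARD('n))"
    using fW unfolding W1_loc_def by blast
  have rep: "\<exists>d. \<forall>i j. d i j \<in> borel_measurable borel \<and> (AE x in lborel. D x $ i $ j = d i j x)"
    if D: "weak_jacobian f D" for D
  proof -
    have "\<exists>d. d \<in> borel_measurable borel \<and> (AE x in lborel. D x $ i $ j = d x)" for i j
    proof -
      have "(\<lambda>x. D x $ i $ j) \<in> borel_measurable (completion lborel)"
        using D by (simp add: weak_jacobian_def weak_partial_deriv_def Lp_loc_def)
      from completion_ex_borel_measurable_real[OF this] show ?thesis by auto
    qed
    then have "\<forall>i. \<exists>d. \<forall>j. d j \<in> borel_measurable borel \<and> (AE x in lborel. D x $ i $ j = d j x)" by (intro allI choice) blast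
    then show ?thesis by (rule choice)
  qed
  obtain d1 where d1: "\<forall>i j. d1 i j \<in> borel_measurable borel \<and> (AE x in lborel. D1 x $ i $ j = d1 i j x)"
    using rep[OF D1(1)] by blast
  obtain d2 where d2: "\<forall>i j. d2 i j \<in> borel_measurable borel \<and> (AE x in lborel. D2 x $ i $ j = d2 i j x)"
    using rep[OF D2(1)] by blast
  have w1: "weak_deriv j (\<lambda>x. f x $ i) (d1 i j)" for i j
    by (rule weak_deriv_representative[OF _ cfi]) (use D1(1) d1 in \<open>auto simp: weak_jacobian_def\<close>)
  have w2: "weak_deriv j (\<lambda>x. f x $ i) (d2 i j)" for i j
    by (rule weak_deriv_representative[OF _ cfi]) (use D2(1) d2 in \<open>auto simp: weak_jacobian_def\<close>)
  define D where "D x = (\<chi> i j. d1 i j x)" for x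
  have "loc_integrable (\<lambda>x. \<bar>d1 i j x\<bar> ^ CARD('n))" for i j
  proof -
    have m1[measurable]: "d1 i j \<in> borel_measurable borel" using d1 by blast
    have ae: "AE x in lborel. D2 x $ i $ j = d1 i j x"
    proof -
      have "AE x in lborel. D2 x $ i $ j = d2 i j x" using d2 by blast
      then show ?thesis using weak_deriv_unique[OF w1[where i=i and j=j] w2[where i=i and j=j]] by eventually_elim simp
    qed
    have "\<bar>t\<bar> powr real CARD('n) = \<bar>t\<bar> ^ CARD('n)" for t :: real
      by (cases "t = 0") (auto simp: powr_realpow)
    then show ?thesis
      using Lp_loc_borel_representative[OF D2(2) m1 ae] by (simp add: loc_integrable_def)
  qed
  moreover have "AE x in lborel. onorm (\<lambda>v. D x *v v) ^ CARD('n) \<le> K * det (D x)"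
  proof -
    have a: "AE x in lborel. \<forall>i\<in>UNIV. \<forall>j\<in>UNIV. D1 x $ i $ j = d1 i j x"
      using d1 by (intro AE_finite_allI) auto
    have "AE x in lborel. onorm (\<lambda>v. D1 x *v v) ^ CARD('n) \<le> K * det (D1 x)" using D1(2) by (simp add: AE_completion_iff)
    with a show ?thesis
    proof eventually_elim
      case (elim x)
      then have "D1 x = D x" by (simp add: D_def vec_eq_iff)
      with elim show ?case by simp
    qed
  qed
  ultimately have "quasiregular_data f K D" using K w1 by (simp add: quasiregular_data_def D_def)
  then show ?thesis by (rule that)
qed

text \<open>The product is at most the \<open>n\<close>-th power of its largest factor.\<close>

lemma prod_le_sum_power:
  fixes a :: "'n::finite \<Rightarrow> real"
  assumes "\<And>i. a i \<ge> 0"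
  shows "(\<Prod>i\<in>UNIV. a i) \<le> (\<Sum>i\<in>UNIV. a i ^ CARD('n))"
proof -
  obtain k where k: "\<And>i. a i \<le> a k"
  proof -
    have "Max (range a) \<in> range a" by (rule Max_in) auto
    then obtain k where "Max (range a) = a k" by (rule rangeE)
    moreover have "a i \<le> Max (range a)" for i by (rule Max_ge) auto
    ultimately show thesis using that[of k] by simp
  qed
  have "(\<Prod>i\<in>UNIV. a i) \<le> (\<Prod>i\<in>(UNIV::'n set). a k)" by (intro prod_mono) (use assms k in auto)
  also have "\<dots> = a k ^ CARD('n)" by simp
  also have "\<dots> \<le> (\<Sum>i\<in>UNIV. a i ^ CARD('n))" by (rule member_le_sum) (use assms in auto)
  finally show ?thesis .
qed

lemma abs_det_le:
  fixes A :: "real^'n::finite^'n"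
  shows "\<bar>det A\<bar> \<le> real (card {p. p permutes (UNIV::'n set)}) * (\<Sum>i\<in>UNIV. \<Sum>j\<in>UNIV. \<bar>A$i$j\<bar> ^ CARD('n))"
proof -
  have "\<bar>det A\<bar> \<le> (\<Sum>p\<in>{p. p permutes (UNIV::'n set)}. \<bar>of_int (sign p) * (\<Prod>i\<in>UNIV. A$i$p i)\<bar>)"
    unfolding det_def by (rule sum_abs)
  also have "\<dots> \<le> (\<Sum>p\<in>{p. p permutes (UNIV::'n set)}. \<Sum>i\<in>UNIV. \<Sum>j\<in>UNIV. \<bar>A$i$j\<bar> ^ CARD('n))"
  proof (rule sum_mono)
    fix p
    have "\<bar>of_int (sign p) * (\<Prod>i\<in>UNIV. A$i$p i)\<bar> = (\<Prod>i\<in>UNIV. \<bar>A$i$p i\<bar>)"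
      by (simp add: abs_mult abs_prod sign_def)
    also have "\<dots> \<le> (\<Sum>i\<in>UNIV. \<bar>A$i$p i\<bar> ^ CARD('n))" by (rule prod_le_sum_power) simp
    also have "\<dots> \<le> (\<Sum>i\<in>UNIV. \<Sum>j\<in>UNIV. \<bar>A$i$j\<bar> ^ CARD('n))"
    proof (rule sum_mono)
      fix i
      show "\<bar>A$i$p i\<bar> ^ CARD('n) \<le> (\<Sum>j\<in>UNIV. \<bar>A$i$j\<bar> ^ CARD('n))"
        by (rule member_le_sum[of "p i" UNIV "\<lambda>j. \<bar>A$i$j\<bar> ^ CARD('n)"]) auto
    qed
    finally show "\<bar>of_int (sign p) * (\<Prod>i\<in>UNIV. A$i$p i)\<bar> \<le> (\<Sum>i\<in>UNIV. \<Sum>j\<in>UNIV. \<bar>A$i$j\<bar> ^ CARD('n))" .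
  qed
  finally show ?thesis by simp
qed

lemma integral_cbox_eq_LINT:
  fixes h :: "'a::euclidean_space \<Rightarrow> real"
  assumes "continuous_on UNIV h"
  shows "integral (cbox a b) h = (LINT x|lborel. indicator (cbox a b) x * h x)"
proof -
  have "set_integrable lborel (cbox a b) h"
    unfolding set_integrable_def by (rule borel_integrable_compact[OF compact_cbox continuous_on_subset[OF assms]]) simp
  from set_borel_integral_eq_integral(2)[OF this] show ?thesis by (simp add: set_lebesgue_integral_def)
qed

lemma approximatesD:
  fixes f :: "real^'n::finite \<Rightarrow> real^'n"
  assumes "approximates B f D g G" "continuous_on UNIV \<kappa>" "continuous_on UNIV F" "0 \<le> c"
    "\<And>A. \<bar>F A\<bar> \<le> c * (\<Sum>i\<in>UNIV. \<Sum>j\<in>UNIV. \<bar>A$i$j\<bar> ^ CARD('n))"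
  shows "integrable lborel (\<lambda>x. indicator B x * (\<kappa> (f x) * F (D x)))"
    "(\<lambda>k. LINT x|lborel. indicator B x * (\<kappa> (g k x) * F (G k x))) \<longlonglongrightarrow> (LINT x|lborel. indicator B x * (\<kappa> (f x) * F (D x)))"
proof -
  have "\<forall>A. \<bar>F A\<bar> \<le> c * (\<Sum>i\<in>UNIV. \<Sum>j\<in>UNIV. \<bar>A$i$j\<bar> ^ CARD('n))" using assms(5) by blast
  note * = assms(1)[unfolded approximates_def, THEN conjunct2, THEN conjunct2, rule_format, OF assms(2-4) spec[OF this]]
  show "integrable lborel (\<lambda>x. indicator B x * (\<kappa> (f x) * F (D x)))"
    "(\<lambda>k. LINT x|lborel. indicator B x * (\<kappa> (g k x) * F (G k x))) \<longlonglongrightarrow> (LINT x|lborel. indicator B x * (\<kappa> (f x) * F (D x)))"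
    using * by auto
qed

text \<open>On the compact image of the boundary the uniformly close \<open>C\<^sup>1\<close> approximations still take values in the open set
\<open>W\<close>, so the identity holds for them, and both sides are continuous along the approximation.\<close>

lemma degree_identity_sobolev:
  fixes f P1 P2 :: "real^'n::finite \<Rightarrow> real^'n"
  assumes q: "quasiregular_data f K D" and P1: "C1_with P1 DP1" and P2: "C1_with P2 DP2"
    and W: "open W" "f ` frontier (cbox a b) \<subseteq> W" and eq: "\<And>y. y \<in> W \<Longrightarrow> P1 y = P2 y"
  shows "integrable lborel (\<lambda>x. indicator (cbox a b) x * (det (DP1 (f x)) * det (D x)))"
    "(LINT x|lborel. indicator (cbox a b) x * (det (DP1 (f x)) * det (D x))) = (LINT x|lborel. indicator (cbox a b) x * (det (DP2 (f x)) * det (D x)))"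
proof -
  let ?B = "cbox a b"
  have w: "weak_deriv j (\<lambda>x. f x $ i) (\<lambda>x. D x $ i $ j)" and Dn: "loc_integrable (\<lambda>x. \<bar>D x $ i $ j\<bar> ^ CARD('n))" for i j
    using q by (auto simp: quasiregular_data_def)
  have cf: "continuous_on UNIV f"
    using continuous_on_vec_lambda[of UNIV "\<lambda>i x. f x $ i"] w by (simp add: weak_deriv_def)
  obtain g G where app: "approximates ?B f D g G" by (rule sobolev_approximation[OF w Dn])
  have C1: "C1_with (g k) (G k)" for k using app by (simp add: approximates_def)
  have unif: "uniform_limit ?B g f sequentially" using app by (simp add: approximates_def)
  let ?c = "real (card {p. p permutes (UNIV::'n set)})"
  have conv: "integrable lborel (\<lambda>x. indicator ?B x * (det (DP (f x)) * det (D x))) \<and>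
      (\<lambda>k. integral ?B (\<lambda>x. det (DP (g k x)) * det (G k x))) \<longlonglongrightarrow> (LINT x|lborel. indicator ?B x * (det (DP (f x)) * det (D x)))"
    if P: "C1_with P DP" for P :: "real^'n \<Rightarrow> real^'n" and DP
  proof -
    have c1: "continuous_on UNIV (\<lambda>y. det (DP y))" by (intro continuous_intros C1_withD(2)[OF P])
    have c2: "continuous_on UNIV (det :: real^'n^'n \<Rightarrow> real)" by (intro continuous_intros)
    have "integral ?B (\<lambda>x. det (DP (g k x)) * det (G k x)) = (LINT x|lborel. indicator ?B x * (det (DP (g k x)) * det (G k x)))" for k
      by (intro integral_cbox_eq_LINT continuous_intros continuous_on_compose2[OF C1_withD(2)[OF P] C1_withD(3)[OF C1]] C1_withD(2)[OF C1]) simp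
    then show ?thesis
      using approximatesD[OF app c1 c2 of_nat_0_le_iff abs_det_le] by simp
  qed
  show "integrable lborel (\<lambda>x. indicator ?B x * (det (DP1 (f x)) * det (D x)))" using conv[OF P1] by blast
  have "compact (f ` frontier ?B)" 
    by (intro compact_continuous_image continuous_on_subset[OF cf] compact_frontier) auto
  then obtain e where e: "e > 0" "(\<Union>y\<in>f ` frontier ?B. ball y e) \<subseteq> W"
    by (rule compact_subset_open_imp_ball_epsilon_subset[OF _ W])
  have "\<forall>\<^sub>F k in sequentially. \<forall>x\<in>?B. dist (g k x) (f x) < e" by (rule uniform_limitD[OF unif e(1)])
  then have "\<forall>\<^sub>F k in sequentially. integral ?B (\<lambda>x. det (DP1 (g k x)) * det (G k x)) = integral ?B (\<lambda>x. det (DP2 (g k x)) * det (G k x))"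
  proof eventually_elim
    case (elim k)
    have fr: "frontier ?B \<subseteq> ?B" by (simp add: frontier_cbox)
    show ?case
    proof (rule degree_identity_C1[OF C1 P1 P2 W(1) _ eq])
      show "g k ` frontier ?B \<subseteq> W"
      proof safe
        fix x assume x: "x \<in> frontier ?B"
        then have "dist (g k x) (f x) < e" using elim fr by blast
        then have "g k x \<in> ball (f x) e" by (simp add: dist_commute)
        then show "g k x \<in> W" using e(2) x by blast
      qed
    qed
  qed
  then have "(\<lambda>k. integral ?B (\<lambda>x. det (DP2 (g k x)) * det (G k x))) \<longlonglongrightarrow> (LINT x|lborel. indicator ?B x * (det (DP1 (f x)) * det (D x)))"
    by (rule Lim_transform_eventually[OF conjunct2[OF conv[OF P1]]])
  then show "(LINT x|lborel. indicator ?B x * (det (DP1 (f x)) * det (D x))) = (LINT x|lborel. indicator ?B x * (det (DP2 (f x)) * det (D x)))"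
    by (rule LIMSEQ_unique) (rule conjunct2[OF conv[OF P2]])
qed

text \<open>The distortion inequality forces the Jacobian to be nonnegative, and every entry of a matrix is bounded by
its operator norm.\<close>

lemma quasiregular_data_AE_det:
  assumes "quasiregular_data f K D"
  shows "AE x in lborel. 0 \<le> det (D x) \<and> (\<forall>i j. \<bar>D x $ i $ j\<bar> ^ CARD('n) \<le> K * det (D (x :: real^'n::finite)))"
proof -
  have K: "K \<ge> 1" and ae: "AE x in lborel. onorm (\<lambda>v. D x *v v) ^ CARD('n) \<le> K * det (D x)"
    using assms by (auto simp: quasiregular_data_def)
  from ae show ?thesis
  proof eventually_elim
    case (elim x)
    have "\<bar>D x $ i $ j\<bar> \<le> onorm (\<lambda>v. D x *v v)" for i j by (rule matrix_component_le_onorm)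
    then have *: "\<bar>D x $ i $ j\<bar> ^ CARD('n) \<le> K * det (D x)" for i j
      using elim by (meson abs_ge_zero order_trans power_mono)
    have "0 \<le> K * det (D x)" by (rule order_trans[OF _ *]) simp
    then show ?case using * K by (simp add: zero_le_mult_iff)
  qed
qed

text \<open>Suppose that \<open>|f| < m\<close> on the boundary and \<open>|f(x0)| > m\<close>. Comparing the identity with a radial contraction
by the degree identity shows that \<open>J\<close> vanishes almost everywhere where \<open>|f| > m\<close>; by the distortion inequality
the whole derivative vanishes there and \<open>f\<close> is locally constant there. Then the points of the cube where \<open>f\<close>
takes the value \<open>f(x0)\<close> form a set that is open and compact and not empty, which is impossible.\<close>

lemma quasiregular_maximum_principle:
  fixes f :: "real^'n::finite \<Rightarrow> real^'n"
  assumes q: "quasiregular_data f K D" and x0: "x0 \<in> cbox a b"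
  shows "\<exists>p\<in>frontier (cbox a b). norm (f x0) \<le> norm (f p)"
proof (rule ccontr)
  assume "\<not> ?thesis"
  then have less: "\<And>p. p \<in> frontier (cbox a b) \<Longrightarrow> norm (f p) < norm (f x0)" by (auto simp: not_le)
  let ?B = "cbox a b"
  have w: "weak_deriv j (\<lambda>x. f x $ i) (\<lambda>x. D x $ i $ j)" for i j using q by (auto simp: quasiregular_data_def)
  have cf: "continuous_on UNIV f"
    using continuous_on_vec_lambda[of UNIV "\<lambda>i x. f x $ i"] w by (simp add: weak_deriv_def)
  have K: "K \<ge> 1" using q by (simp add: quasiregular_data_def)
  have cn: "continuous_on S (\<lambda>x. norm (f x))" for S by (intro continuous_intros continuous_on_subset[OF cf]) auto
  have "?B \<noteq> {}" using x0 by blast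
  moreover have "?B \<noteq> UNIV" using bounded_cbox[of a b] not_bounded_UNIV[where 'a="real^'n"] by auto
  ultimately have "frontier ?B \<noteq> {}" by (simp add: frontier_not_empty)
  then obtain p where p: "p \<in> frontier ?B" "\<And>y. y \<in> frontier ?B \<Longrightarrow> norm (f y) \<le> norm (f p)"
    using continuous_attains_sup[OF compact_frontier[OF compact_cbox] _ cn] by blast
  \<comment> \<open>Any level strictly between the maximum over the boundary and the value at \<open>x0\<close>.\<close>
  define m where "m = (norm (f p) + norm (f x0)) / 2"
  have m: "norm (f p) < m" "m < norm (f x0)" using less[OF p(1)] by (auto simp: m_def)
  have m0: "m \<ge> 0" using m(1) norm_ge_zero[of "f p"] by linarith
  obtain P :: "real^'n \<Rightarrow> real^'n" and DP where P: "C1_with P DP" "\<forall>y. norm y \<le> m \<longrightarrow> P y = y"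
    "\<forall>y. det (DP y) \<le> 1" "\<forall>y. norm y > m \<longrightarrow> m \<ge> 0 \<longrightarrow> det (DP y) < 1"
  proof -
    show thesis by (rule radial_contraction[of m]) (rule that, auto)
  qed
  have W: "open (ball 0 m :: (real^'n) set)" "f ` frontier ?B \<subseteq> ball 0 m" using p m(1) by fastforce+
  note d1 = degree_identity_sobolev[OF q C1_with_id P(1) W, simplified det_I]
  note d2 = degree_identity_sobolev[OF q P(1) C1_with_id W, simplified det_I]
  let ?h = "\<lambda>x. indicator ?B x * ((1 - det (DP (f x))) * det (D x))"
  have i1: "integrable lborel (\<lambda>x. indicator ?B x * (1 * det (D x)))" by (rule d1(1)) (use P(2) in auto)
  have i2: "integrable lborel (\<lambda>x. indicator ?B x * (det (DP (f x)) * det (D x)))" by (rule d2(1)) (use P(2) in auto)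
  have e: "(LINT x|lborel. indicator ?B x * (1 * det (D x))) = (LINT x|lborel. indicator ?B x * (det (DP (f x)) * det (D x)))"
    by (rule d1(2)) (use P(2) in auto)
  have h: "?h = (\<lambda>x. indicator ?B x * (1 * det (D x)) - indicator ?B x * (det (DP (f x)) * det (D x)))"
    by (auto simp: algebra_simps)
  have ih: "integrable lborel ?h" unfolding h by (rule Bochner_Integration.integrable_diff[OF i1 i2])
  have zero: "(LINT x|lborel. ?h x) = 0" unfolding h using Bochner_Integration.integral_diff[OF i1 i2] e by simp
  note ae = quasiregular_data_AE_det[OF q]
  have "AE x in lborel. 0 \<le> ?h x"
    using ae by eventually_elim (use P(3) in \<open>auto intro!: mult_nonneg_nonneg\<close>)
  then have ae0: "AE x in lborel. ?h x = 0" using integral_nonneg_eq_0_iff_AE[OF ih] zero by simp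
  define U where "U = interior ?B \<inter> {x. m < norm (f x)}"
  have oU: "open U" unfolding U_def
    by (intro open_Int open_interior open_Collect_less continuous_on_const cn)
  have Dz: "AE x in lborel. x \<in> U \<longrightarrow> D x $ i $ j = 0" for i j
    using ae ae0
  proof eventually_elim
    case (elim x)
    show ?case
    proof
      assume x: "x \<in> U"
      then have "x \<in> ?B" "m < norm (f x)" using interior_subset[of ?B] by (auto simp: U_def)
      then have "(1 - det (DP (f x))) * det (D x) = 0" "det (DP (f x)) < 1" using elim P(4) m0 by auto
      then have "det (D x) = 0" by simp
      with elim(1) have "\<bar>D x $ i $ j\<bar> ^ CARD('n) \<le> 0" by (metis mult_zero_right)
      then show "D x $ i $ j = 0" by (auto simp: power_le_zero_eq)
    qed
  qed
  define S where "S = {x \<in> ?B. f x = f x0}"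
  have SU: "S \<subseteq> U"
  proof
    fix x assume x: "x \<in> S"
    then have "x \<notin> frontier ?B" using less[of x] by (auto simp: S_def)
    then have "x \<in> interior ?B" using x by (auto simp: S_def frontier_def)
    then show "x \<in> U" using x m(2) by (simp add: S_def U_def)
  qed
  have "closed S"
  proof -
    have "S = ?B \<inter> f -` {f x0}" by (auto simp: S_def)
    then show ?thesis using continuous_closed_vimage[of "{f x0}" f] cf
      by (auto intro!: closed_Int closed_cbox simp: continuous_on_eq_continuous_at)
  qed
  moreover have "open S"
  proof (subst open_subopen, intro ballI)
    fix x assume x: "x \<in> S"
    have "\<exists>V. open V \<and> x \<in> V \<and> (\<forall>y\<in>V. f y $ i = f x $ i)" for i
    proof -
      have xU: "x \<in> U" using x SU by blast
      show ?thesis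
      proof (rule weak_deriv_zero_imp_locally_constant[OF w[where i=i] oU xU Dz[where i=i]])
        fix V assume V: "open V" "x \<in> V" "\<And>y. y \<in> V \<Longrightarrow> f y $ i = f x $ i"
        from V(3) have "\<forall>y\<in>V. f y $ i = f x $ i" ..
        with V(1,2) show ?thesis by (intro exI[of _ V] conjI)
      qed
    qed
    then obtain V where V: "\<forall>i. open (V i) \<and> x \<in> V i \<and> (\<forall>y\<in>V i. f y $ i = f x $ i)" by metis
    define T where "T = U \<inter> (\<Inter>i\<in>UNIV. V i)"
    have "open T" unfolding T_def using oU V by (intro open_Int open_INT) auto
    moreover have "x \<in> T" using x SU V by (auto simp: T_def)
    moreover have "T \<subseteq> S"
    proof
      fix y assume y: "y \<in> T"
      have "f y $ i = f x $ i" for i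
      proof -
        have "y \<in> V i" using y by (simp add: T_def)
        then show ?thesis using spec[OF V, of i] by blast
      qed
      then have "f y = f x" by (simp add: vec_eq_iff)
      moreover have "y \<in> ?B" using y interior_subset[of ?B] by (auto simp: T_def U_def)
      ultimately show "y \<in> S" using x by (simp add: S_def)
    qed
    ultimately show "\<exists>T. open T \<and> x \<in> T \<and> T \<subseteq> S" by blast
  qed
  ultimately have "S = {} \<or> S = UNIV" using clopen by blast
  moreover have "x0 \<in> S" using x0 by (simp add: S_def)
  ultimately have "S = UNIV" by auto
  then have "bounded (UNIV :: (real^'n) set)" using bounded_subset[OF bounded_cbox[of a b], of S] by (auto simp: S_def)
  then show False using not_bounded_UNIV by blast
qed

text \<open>The weights are the Jacobians of the maps of \<open>radial_squash\<close>. The maps for the radii 1 and \<open>R\<close> agree where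
\<open>|y| > R\<close>, and \<open>|f| > R\<close> on the boundary of a large cube, so the degree identity replaces the weight for \<open>R\<close>
by the one for 1. The latter lives where \<open>|f| < 1\<close>, which is a bounded set.\<close>

lemma degree_energy_bound:
  fixes f :: "real^'n::finite \<Rightarrow> real^'n"
  assumes q: "quasiregular_data f K D" and inf: "filterlim (\<lambda>x. norm (f x)) at_top at_infinity"
  shows "\<exists>C\<ge>0. \<forall>R\<ge>1. \<exists>\<kappa>. degree_weight f D C R \<kappa>"
proof -
  have far: "\<exists>L. \<forall>x. norm x \<ge> L \<longrightarrow> norm (f x) > R" for R
  proof -
    have "\<forall>\<^sub>F x in at_infinity. norm (f x) > R" using inf by (simp add: filterlim_at_top_dense)
    then show ?thesis by (auto simp: eventually_at_infinity)
  qed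
  have w: "weak_deriv j (\<lambda>x. f x $ i) (\<lambda>x. D x $ i $ j)" for i j using q by (auto simp: quasiregular_data_def)
  note ae = quasiregular_data_AE_det[OF q]
  have ncube: "norm p \<ge> L" if "p \<in> frontier (cube 0 L)" for p :: "real^'n" and L
    using frontier_cube[OF that] component_le_norm_cart[of p] by force
  have ncube': "norm p \<ge> L" if "p \<notin> cube 0 L" for p :: "real^'n" and L
  proof -
    have "\<exists>i. \<not> \<bar>p$i\<bar> \<le> L" using that by (simp add: mem_cube)
    then obtain i where "\<not> \<bar>p$i\<bar> \<le> L" by blast
    then show ?thesis using component_le_norm_cart[of p i] by linarith
  qed
  have all: "\<exists>P DP. C1_with (P :: real^'n \<Rightarrow> real^'n) DP \<and> (\<forall>y. norm y \<ge> R \<longrightarrow> P y = y /\<^sub>R norm y) \<and> (\<forall>y. det (DP y) \<ge> 0) 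
    \<and> (\<forall>y. norm y \<ge> R \<longrightarrow> det (DP y) = 0) \<and> (\<forall>y. norm y \<le> R / 2 \<longrightarrow> det (DP y) \<ge> 1 / (2 * R ^ CARD('n)))" if R: "R > 0" for R
    by (rule radial_squash[OF R, where 'n='n]) (intro exI conjI allI impI, assumption, auto)
  obtain P1 :: "real^'n \<Rightarrow> real^'n" and DP1 where P1: "C1_with P1 DP1" "\<forall>y. norm y \<ge> 1 \<longrightarrow> P1 y = y /\<^sub>R norm y" "\<forall>y. det (DP1 y) \<ge> 0" 
    "\<forall>y. norm y \<ge> 1 \<longrightarrow> det (DP1 y) = 0"
    using all[of 1] by auto
  obtain L1 where L1: "\<forall>x. norm x \<ge> L1 \<longrightarrow> norm (f x) > 1" using far by blast
  define C where "C = (LINT z|lborel. indicator (cube 0 L1) z * (det (DP1 (f z)) * det (D z)))"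
  have int: "integrable lborel (\<lambda>z. indicator (cube x \<rho>) z * (det (DP (f z)) * det (D z)))"
    if P: "C1_with (P :: real^'n \<Rightarrow> real^'n) DP" for P DP x \<rho>
    unfolding cube_def by (rule degree_identity_sobolev(1)[OF q P P open_UNIV]) auto
  have nn: "AE z in lborel. 0 \<le> indicator (cube x \<rho>) z * (det (DP (f z)) * det (D z))" if "\<forall>y. det (DP y) \<ge> 0" for DP :: "real^'n \<Rightarrow> real^'n^'n" and x \<rho>
    using ae by eventually_elim (use that in auto)
  have C0: "C \<ge> 0" unfolding C_def by (rule integral_nonneg_AE[OF nn[OF P1(3)]])
  show ?thesis
  proof (intro exI[of _ C] conjI C0 allI impI)
    fix R :: real assume R: "R \<ge> 1"
    obtain P :: "real^'n \<Rightarrow> real^'n" and DP where P: "C1_with P DP" "\<forall>y. norm y \<ge> R \<longrightarrow> P y = y /\<^sub>R norm y" "\<forall>y. det (DP y) \<ge> 0" 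
      "\<forall>y. norm y \<ge> R \<longrightarrow> det (DP y) = 0" "\<forall>y. norm y \<le> R / 2 \<longrightarrow> det (DP y) \<ge> 1 / (2 * R ^ CARD('n))"
      using all[of R] R by auto
    obtain L2 where L2: "\<forall>x. norm x \<ge> L2 \<longrightarrow> norm (f x) > R" using far by blast
    have bound: "(LINT z|lborel. indicator (cube x \<rho>) z * (det (DP (f z)) * det (D z))) \<le> C" for x \<rho>
    proof -
      \<comment> \<open>A cube around the origin that contains the given one and beyond whose interior \<open>|f| > R\<close>.\<close>
      define L where "L = max (max L1 L2) (norm x + \<rho>)"
      have sub: "cube x \<rho> \<subseteq> cube 0 L"
      proof
        fix z assume "z \<in> cube x \<rho>"
        then have zx: "\<bar>z$i - x$i\<bar> \<le> \<rho>" for i by (simp add: mem_cube)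
        have "\<bar>z$i\<bar> \<le> L" for i using zx[of i] component_le_norm_cart[of x i] unfolding L_def by linarith
        then show "z \<in> cube 0 L" by (simp add: mem_cube)
      qed
      have "(LINT z|lborel. indicator (cube x \<rho>) z * (det (DP (f z)) * det (D z))) \<le> (LINT z|lborel. indicator (cube 0 L) z * (det (DP (f z)) * det (D z)))"
      proof (rule integral_mono_AE[OF int[OF P(1)] int[OF P(1)]])
        show "AE z in lborel. indicator (cube x \<rho>) z * (det (DP (f z)) * det (D z)) \<le> indicator (cube 0 L) z * (det (DP (f z)) * det (D z))"
          using ae
        proof eventually_elim
          case (elim z)
          have "0 \<le> det (DP (f z)) * det (D z)" using elim P(3) by simp
          then show ?case using sub by (auto simp: indicator_def)
        qed
      qed
      also have "\<dots> = (LINT z|lborel. indicator (cube 0 L) z * (det (DP1 (f z)) * det (D z)))"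
        unfolding cube_def
      proof (rule degree_identity_sobolev(2)[OF q P(1) P1(1)])
        show "open {y :: real^'n. R < norm y}" by (intro open_Collect_less continuous_intros)
        show "f ` frontier (cbox (0 - (\<chi> i. L)) (0 + (\<chi> i. L))) \<subseteq> {y. R < norm y}"
          using ncube[of _ L] L2 unfolding cube_def L_def by fastforce
        show "P y = P1 y" if "y \<in> {y. R < norm y}" for y using that P(2) P1(2) R by auto
      qed
      also have "\<dots> = C"
        unfolding C_def
      proof (intro Bochner_Integration.integral_cong refl)
        fix z
        have "cube 0 L1 \<subseteq> cube (0 :: real^'n) L" by (rule cube_mono) (simp add: L_def)
        moreover have "det (DP1 (f z)) = 0" if "z \<notin> cube 0 L1" using ncube'[OF that] L1 P1(4) by (simp add: less_imp_le)
        ultimately show "indicator (cube 0 L) z * (det (DP1 (f z)) * det (D z)) = indicator (cube 0 L1) z * (det (DP1 (f z)) * det (D z))"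
          by (auto simp: indicator_def)
      qed
      finally show ?thesis .
    qed
    show "\<exists>\<kappa>. degree_weight f D C R \<kappa>"
      unfolding degree_weight_def
      by (intro exI[of _ "\<lambda>y. det (DP y)"] conjI allI continuous_on_det C1_withD(2)[OF P(1)] int[OF P(1)] bound P(3)[rule_format] P(5))
  qed
qed

section \<open>Growth of quasiregular maps of polynomial type\<close>

text \<open>Cubes are the balls of the maximum norm.\<close>

lemma infnorm_eq_imp_frontier_cube:
  fixes x y :: "real^'n::finite"
  assumes "infnorm (y - x) = \<rho>"
  shows "y \<in> frontier (cube x \<rho>)"
proof -
  have "\<bar>y$i - x$i\<bar> \<le> \<rho>" for i using component_le_infnorm_cart[of "y - x" i] assms by simp
  then have 1: "y \<in> cube x \<rho>" by (simp add: mem_cube)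
  have "infnorm (y - x) = Max ((\<lambda>i. \<bar>(y - x) \<bullet> i\<bar>) ` Basis)" by (rule infnorm_Max)
  also have "\<dots> \<in> (\<lambda>i. \<bar>(y - x) \<bullet> i\<bar>) ` Basis" by (rule Max_in) auto
  finally obtain b where "b \<in> Basis" "\<rho> = \<bar>(y - x) \<bullet> b\<bar>" using assms by auto
  then obtain i where i: "\<rho> = \<bar>y$i - x$i\<bar>" by (auto simp: Basis_vec_def inner_axis)
  have "y \<notin> box (x - (\<chi> i. \<rho>)) (x + (\<chi> i. \<rho>))"
  proof
    assume "y \<in> box (x - (\<chi> i. \<rho>)) (x + (\<chi> i. \<rho>))"
    then have "x$i - \<rho> < y$i \<and> y$i < x$i + \<rho>" by (simp add: mem_box_cart)
    then show False using i by linarith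
  qed
  with 1 show ?thesis by (simp add: cube_def frontier_cbox)
qed

text \<open>On the connected sphere of radius \<open>r\<close> the distance to \<open>x0\<close> in the maximum norm takes the values \<open>(S - 1) s\<close>
and \<open>(S + 1) s\<close> at the two points of the line through \<open>x0\<close>, where \<open>s\<close> is the maximum norm of \<open>x0 / S\<close>; hence
it takes all values in between.\<close>

lemma cubes_meet_sphere:
  fixes x0 :: "real^'n::finite"
  assumes n2: "CARD('n) \<ge> 2" and r: "r > 0" and S: "S > 1" and x0: "norm x0 = S * r"
  obtains s where "s > 0" "\<And>\<rho>. (S - 1) * s \<le> \<rho> \<Longrightarrow> \<rho> \<le> (S + 1) * s \<Longrightarrow> \<exists>q\<in>frontier (cube x0 \<rho>). norm q = r"
proof -
  define e where "e = x0 /\<^sub>R S"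
  have ne: "norm e = r" using x0 S by (simp add: e_def)
  have x0e: "x0 = S *\<^sub>R e" using S by (simp add: e_def)
  define s where "s = infnorm e"
  have s: "s > 0" unfolding s_def using ne r by (auto simp: infnorm_pos_lt)
  have con: "connected (sphere (0 :: real^'n) r)" by (rule connected_sphere) (use n2 in simp)
  have im: "is_interval ((\<lambda>y. infnorm (y - x0)) ` sphere 0 r)"
    unfolding is_interval_connected_1
    by (intro connected_continuous_image con continuous_on_infnorm continuous_intros)
  have "infnorm (e - x0) = (S - 1) * s"
  proof -
    have "e - x0 = (1 - S) *\<^sub>R e" by (simp add: x0e algebra_simps)
    then show ?thesis using S by (simp add: infnorm_mul s_def)
  qed
  moreover have "infnorm (- e - x0) = (S + 1) * s"
  proof -
    have "- e - x0 = (- (1 + S)) *\<^sub>R e" by (simp add: x0e algebra_simps)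
    then show ?thesis using S by (simp only: infnorm_mul s_def) simp
  qed
  moreover have "e \<in> sphere 0 r" "- e \<in> sphere 0 r" using ne by auto
  ultimately have ends: "(S - 1) * s \<in> (\<lambda>y. infnorm (y - x0)) ` sphere 0 r" "(S + 1) * s \<in> (\<lambda>y. infnorm (y - x0)) ` sphere 0 r"
    by (metis imageI)+
  have "\<exists>q\<in>frontier (cube x0 \<rho>). norm q = r" if "(S - 1) * s \<le> \<rho>" "\<rho> \<le> (S + 1) * s" for \<rho>
  proof -
    have "\<rho> \<in> (\<lambda>y. infnorm (y - x0)) ` sphere 0 r"
      using im ends that unfolding is_interval_1 by blast
    then obtain q where "norm q = r" "infnorm (q - x0) = \<rho>" by auto
    then show ?thesis using infnorm_eq_imp_frontier_cube by blast
  qed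
  then show ?thesis using s that by blast
qed

text \<open>A norm of matrices that is simple to bound by the entries and compatible with products of a vector and a
matrix; constants depending on the dimension do not matter.\<close>

definition entry_sum :: "real^'n::finite^'n \<Rightarrow> real" where
  "entry_sum A = (\<Sum>i\<in>UNIV. \<Sum>j\<in>UNIV. \<bar>A$i$j\<bar>)"

lemma entry_sum_power_le:
  fixes A :: "real^'n::finite^'n"
  shows "entry_sum A ^ CARD('n) \<le> (real CARD('n) ^ 2) ^ CARD('n) * (\<Sum>i\<in>UNIV. \<Sum>j\<in>UNIV. \<bar>A$i$j\<bar> ^ CARD('n))"
proof -
  let ?N = "CARD('n)"
  let ?X = "(\<lambda>(i, j). \<bar>A$i$j\<bar>) ` (UNIV \<times> UNIV)"
  have "Max ?X \<in> ?X" by (rule Max_in) auto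
  then obtain z where z: "Max ?X = (\<lambda>(i, j). \<bar>A$i$j\<bar>) z" by (rule imageE)
  obtain p q where "z = (p, q)" by (cases z)
  with z have pq: "Max ?X = \<bar>A$p$q\<bar>" by simp
  have le: "\<bar>A$i$j\<bar> \<le> \<bar>A$p$q\<bar>" for i j unfolding pq[symmetric] by (rule Max_ge) (auto intro: image_eqI[of _ _ "(i, j)"])
  have "entry_sum A \<le> (\<Sum>i\<in>(UNIV::'n set). \<Sum>j\<in>(UNIV::'n set). \<bar>A$p$q\<bar>)"
    unfolding entry_sum_def by (intro sum_mono le)
  also have "\<dots> = real ?N ^ 2 * \<bar>A$p$q\<bar>" by (simp add: power2_eq_square)
  finally have "entry_sum A ^ ?N \<le> (real ?N ^ 2 * \<bar>A$p$q\<bar>) ^ ?N"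
    by (intro power_mono) (auto simp: entry_sum_def intro!: sum_nonneg)
  also have "\<dots> = (real ?N ^ 2) ^ ?N * \<bar>A$p$q\<bar> ^ ?N" by (rule power_mult_distrib)
  also have "\<dots> \<le> (real ?N ^ 2) ^ ?N * (\<Sum>i\<in>UNIV. \<Sum>j\<in>UNIV. \<bar>A$i$j\<bar> ^ ?N)"
  proof (rule mult_left_mono)
    have "\<bar>A$p$q\<bar> ^ ?N \<le> (\<Sum>j\<in>UNIV. \<bar>A$p$j\<bar> ^ ?N)"
      by (rule member_le_sum[of q UNIV "\<lambda>j. \<bar>A$p$j\<bar> ^ ?N"]) auto
    also have "\<dots> \<le> (\<Sum>i\<in>UNIV. \<Sum>j\<in>UNIV. \<bar>A$i$j\<bar> ^ ?N)"
      by (rule member_le_sum[of p UNIV "\<lambda>i. \<Sum>j\<in>UNIV. \<bar>A$i$j\<bar> ^ ?N"]) (auto intro: sum_nonneg)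
    finally show "\<bar>A$p$q\<bar> ^ ?N \<le> (\<Sum>i\<in>UNIV. \<Sum>j\<in>UNIV. \<bar>A$i$j\<bar> ^ ?N)" .
  qed simp
  finally show ?thesis .
qed

lemma norm_vector_matrix_mult_le:
  fixes A :: "real^'n::finite^'n"
  shows "norm (v v* A) \<le> norm v * entry_sum A"
proof -
  have "norm (v v* A) \<le> (\<Sum>j\<in>UNIV. \<bar>(v v* A)$j\<bar>)" by (rule norm_le_l1_cart)
  also have "\<dots> \<le> (\<Sum>j\<in>UNIV. \<Sum>i\<in>UNIV. norm v * \<bar>A$i$j\<bar>)"
  proof (rule sum_mono)
    fix j
    have "\<bar>(v v* A)$j\<bar> \<le> (\<Sum>i\<in>UNIV. \<bar>v$i * A$i$j\<bar>)"
      unfolding vector_matrix_mult_def using sum_abs[of "\<lambda>i. v$i * A$i$j" UNIV] by simp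
    also have "\<dots> \<le> (\<Sum>i\<in>UNIV. norm v * \<bar>A$i$j\<bar>)"
      by (intro sum_mono) (simp add: abs_mult component_le_norm_cart mult_right_mono)
    finally show "\<bar>(v v* A)$j\<bar> \<le> (\<Sum>i\<in>UNIV. norm v * \<bar>A$i$j\<bar>)" .
  qed
  also have "\<dots> = norm v * entry_sum A"
    unfolding entry_sum_def sum_distrib_left by (rule sum.swap)
  finally show ?thesis .
qed

text \<open>A dyadic substitute for the logarithm of \<open>|y| / A\<close> to the base 2, constant for \<open>|y| \<le> A\<close> and for
\<open>|y| \<ge> 2\<^sup>N A\<close>.\<close>

definition log_profile :: "real \<Rightarrow> nat \<Rightarrow> real^'n::finite \<Rightarrow> real" where
  "log_profile A N y = (\<Sum>k\<in>{1..N}. ring_step (2 ^ k * A) y)"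

definition log_profile_grad :: "real \<Rightarrow> nat \<Rightarrow> real^'n::finite \<Rightarrow> real^'n" where
  "log_profile_grad A N y = (\<Sum>k\<in>{1..N}. ring_grad (2 ^ k * A) y)"

lemma log_profile:
  fixes y :: "real^'n::finite"
  assumes A: "A > 0"
  shows "(log_profile A N has_derivative (\<lambda>h. log_profile_grad A N y \<bullet> h)) (at y)"
    "continuous_on UNIV (log_profile_grad A N :: real^'n \<Rightarrow> real^'n)"
    "norm y \<le> A \<Longrightarrow> log_profile A N y = 0" "2 ^ N * A \<le> norm y \<Longrightarrow> log_profile A N y = real N"
    "norm (log_profile_grad A N y) \<le> real N * (4 / A)"
    "n \<ge> 1 \<Longrightarrow> norm (log_profile_grad A N y) ^ n \<le> (\<Sum>k\<in>{1..N}. norm (ring_grad (2 ^ k * A) y) ^ n)"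
proof -
  have R: "2 ^ k * A > 0" for k using A by simp
  show "(log_profile A N has_derivative (\<lambda>h. log_profile_grad A N y \<bullet> h)) (at y)"
    unfolding log_profile_def[abs_def] log_profile_grad_def inner_sum_left
    by (intro has_derivative_sum ring_step(1) R)
  show "continuous_on UNIV (log_profile_grad A N :: real^'n \<Rightarrow> real^'n)"
    unfolding log_profile_grad_def[abs_def] by (intro continuous_on_sum ring_step(2) R)
  show "log_profile A N y = 0" if "norm y \<le> A"
    unfolding log_profile_def
  proof (intro sum.neutral ballI ring_step(3) R)
    fix k :: nat assume "k \<in> {1..N}"
    then have "(2::real) ^ 1 \<le> 2 ^ k" by (intro power_increasing) auto
    then have "2 * A \<le> 2 ^ k * A" using A by (intro mult_right_mono) auto
    then show "norm y \<le> 2 ^ k * A / 2" using that by simp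
  qed
  show "log_profile A N y = real N" if "2 ^ N * A \<le> norm y"
  proof -
    have "ring_step (2 ^ k * A) y = 1" if k: "k \<in> {1..N}" for k
    proof (rule ring_step(4)[OF R])
      have "(2::real) ^ k \<le> 2 ^ N" using k by (intro power_increasing) auto
      then have "2 ^ k * A \<le> 2 ^ N * A" using A by (intro mult_right_mono) auto
      then show "2 ^ k * A \<le> norm y" using \<open>2 ^ N * A \<le> norm y\<close> by linarith
    qed
    then show ?thesis by (simp add: log_profile_def)
  qed
  have "norm (log_profile_grad A N y) \<le> (\<Sum>k\<in>{1..N}. norm (ring_grad (2 ^ k * A) y))"
    unfolding log_profile_grad_def by (rule norm_sum)
  also have "\<dots> \<le> (\<Sum>k\<in>{1..N}. 4 / A)"
  proof (rule sum_mono)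
    fix k
    have "norm (ring_grad (2 ^ k * A) y) \<le> 4 / (2 ^ k * A)" by (rule ring_step(6)[OF R])
    also have "\<dots> \<le> 4 / A" using A by (intro divide_left_mono) auto
    finally show "norm (ring_grad (2 ^ k * A) y) \<le> 4 / A" .
  qed
  finally show "norm (log_profile_grad A N y) \<le> real N * (4 / A)" by simp
  show "norm (log_profile_grad A N y) ^ n \<le> (\<Sum>k\<in>{1..N}. norm (ring_grad (2 ^ k * A) y) ^ n)" if n: "n \<ge> 1"
  proof (cases "\<exists>k\<in>{1..N}. ring_grad (2 ^ k * A) y \<noteq> 0")
    case True
    then obtain k where k: "k \<in> {1..N}" "ring_grad (2 ^ k * A) y \<noteq> 0" by blast
    \<comment> \<open>The open dyadic rings are disjoint, so at most one gradient is different from 0.\<close>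
    have other: "ring_grad (2 ^ l * A) y = 0" if l: "l \<noteq> k" for l
    proof (rule ccontr)
      assume "ring_grad (2 ^ l * A) y \<noteq> 0"
      then have 1: "2 ^ l * A / 2 < norm y" "norm y < 2 ^ l * A" using ring_step(5)[OF R] by auto
      have 2: "2 ^ k * A / 2 < norm y" "norm y < 2 ^ k * A" using ring_step(5)[OF R k(2)] by auto
      have step: False if "i < j" "2 ^ j * A / 2 < norm y" "norm y < 2 ^ i * A" for i j :: nat
      proof -
        have "(2::real) ^ Suc i \<le> 2 ^ j" using that(1) by (intro power_increasing) auto
        then have "2 * 2 ^ i * A \<le> 2 ^ j * A" using A by (intro mult_right_mono) auto
        then show False using that by simp
      qed
      show False using l 1 2 step[of k l] step[of l k] by (cases "k < l") auto
    qed
    have "log_profile_grad A N y = ring_grad (2 ^ k * A) y"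
      unfolding log_profile_grad_def using k(1) other by (subst sum.remove[of _ k]) (auto intro!: sum.neutral)
    then show ?thesis using member_le_sum[of k "{1..N}" "\<lambda>k. norm (ring_grad (2 ^ k * A) y) ^ n"] k(1) by simp
  next
    case False
    then have "log_profile_grad A N y = 0" unfolding log_profile_grad_def by (intro sum.neutral) blast
    then show ?thesis using n by (simp add: power_0_left sum_nonneg)
  qed
qed

definition growth_constant :: "nat \<Rightarrow> real \<Rightarrow> real \<Rightarrow> real \<Rightarrow> real" where
  "growth_constant n S K C = 2 ^ n * ((6 * real n ^ 2) ^ n * (4 * real n) * (S + 1)) *
    ((real n ^ 2) ^ n * (real n ^ 2 * K) * (2 * 8 ^ n * C))"

lemma growth_constant_nonneg: "0 \<le> S \<Longrightarrow> 0 \<le> K \<Longrightarrow> 0 \<le> C \<Longrightarrow> 0 \<le> growth_constant n S K C"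
  unfolding growth_constant_def by (intro mult_nonneg_nonneg) auto

text \<open>The comparison of the two energy bounds for \<open>log_profile A N \<circ> f\<close> on the cubes centred at \<open>x0\<close>. The lower bound
is proved for \<open>C\<^sup>1\<close> approximations of \<open>f\<close> and only then passed to the limit, so no regularity of \<open>f\<close> on
individual faces is needed. The sizes of the cubes are proportional to \<open>s\<close>, which cancels.\<close>

lemma growth_exponent_bound:
  fixes f :: "real^'n::finite \<Rightarrow> real^'n"
  assumes n2: "CARD('n) \<ge> 2" and q: "quasiregular_data f K D" and S: "S > 1"
    and C: "C \<ge> 0" "\<forall>R\<ge>1. \<exists>\<kappa>. degree_weight f D C R \<kappa>"
    and r: "r > 0" and A: "A \<ge> 1" "\<And>x. norm x = r \<Longrightarrow> norm (f x) \<le> A"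
    and x0: "norm x0 = S * r" "2 ^ N * A \<le> norm (f x0)"
  shows "real N \<le> growth_constant CARD('n) S K C"
proof (cases "N = 0")
  case True
  have "K \<ge> 1" using q by (simp add: quasiregular_data_def)
  then show ?thesis using True C(1) S by (simp add: growth_constant_nonneg)
next
  case False
  let ?n = "CARD('n)"
  let ?k1 = "(6 * real CARD('n) ^ 2) ^ CARD('n) * (4 * real CARD('n))"
  let ?k2 = "(real CARD('n) ^ 2) ^ CARD('n)"
  let ?E = "?k2 * (real ?n ^ 2 * K) * (2 * 8 ^ ?n * C)"
  have K: "K \<ge> 1" using q by (simp add: quasiregular_data_def)
  have A0: "A > 0" using A(1) by simp
  have n1: "?n \<ge> 1" using n2 by simp
  have w: "weak_deriv j (\<lambda>x. f x $ i) (\<lambda>x. D x $ i $ j)" and Dn: "loc_integrable (\<lambda>x. \<bar>D x $ i $ j\<bar> ^ CARD('n))" for i j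
    using q by (auto simp: quasiregular_data_def)
  obtain s where s: "s > 0" "\<forall>\<rho>. (S - 1) * s \<le> \<rho> \<longrightarrow> \<rho> \<le> (S + 1) * s \<longrightarrow> (\<exists>q\<in>frontier (cube x0 \<rho>). norm q = r)"
    by (rule cubes_meet_sphere[OF n2 r S x0(1)]) (rule that, auto)
  define \<rho>2 where "\<rho>2 = (S + 1) * s"
  let ?Q = "cube x0 \<rho>2"
  let ?u = "log_profile A N :: real^'n \<Rightarrow> real" and ?du = "log_profile_grad A N :: real^'n \<Rightarrow> real^'n"
  note lp = log_profile[OF A0, where N=N and 'n='n]
  obtain g G where app: "approximates ?Q f D g G"
    unfolding cube_def by (rule sobolev_approximation[OF w Dn])
  have C1: "C1_with (g k) (G k)" for k using app by (simp add: approximates_def)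
  have unif: "uniform_limit ?Q g f sequentially" using app by (simp add: approximates_def)
  define \<kappa>0 where "\<kappa>0 y = norm (?du y) ^ ?n" for y
  define F where "F M = entry_sum M ^ ?n" for M :: "real^'n^'n"
  have c\<kappa>: "continuous_on UNIV \<kappa>0" unfolding \<kappa>0_def by (intro continuous_intros lp(2))
  have cF: "continuous_on UNIV F" unfolding F_def entry_sum_def by (intro continuous_intros)
  have F0: "F M \<ge> 0" for M unfolding F_def entry_sum_def by (intro zero_le_power sum_nonneg) auto
  have Fb: "\<bar>F M\<bar> \<le> ?k2 * (\<Sum>i\<in>UNIV. \<Sum>j\<in>UNIV. \<bar>M$i$j\<bar> ^ ?n)" for M
    using entry_sum_power_le[of M] F0[of M] by (simp add: F_def)
  have k2: "?k2 \<ge> 0" by simp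
  note lim = approximatesD[OF app c\<kappa> cF k2 Fb]
  have energy: "(LINT x|lborel. indicator ?Q x * (\<kappa>0 (f x) * F (D x))) \<le> ?E * real N"
  proof -
    have "\<forall>k\<in>{1..N}. \<exists>\<kappa>. degree_weight f D C (2 * (2 ^ k * A)) \<kappa>"
    proof
      fix k
      have "1 * 1 \<le> 2 ^ k * A" using A(1) by (intro mult_mono) auto
      then have "1 \<le> 2 * (2 ^ k * A)" by linarith
      then show "\<exists>\<kappa>. degree_weight f D C (2 * (2 ^ k * A)) \<kappa>"
        by (rule C(2)[rule_format])
    qed
    from bchoice[OF this] obtain \<kappa> where \<kappa>: "\<forall>k\<in>{1..N}. degree_weight f D C (2 * (2 ^ k * A)) (\<kappa> k)" ..
    have \<kappa>pos: "0 \<le> \<kappa> k y" if "k \<in> {1..N}" for k y using bspec[OF \<kappa> that] by (simp add: degree_weight_def)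
    have \<kappa>0b: "\<kappa>0 y \<le> (\<Sum>k\<in>{1..N}. 2 * 8 ^ ?n * \<kappa> k y)" for y
    proof -
      have "\<kappa>0 y \<le> (\<Sum>k\<in>{1..N}. norm (ring_grad (2 ^ k * A) y) ^ ?n)" unfolding \<kappa>0_def by (rule lp(6)[OF n1])
      also have "\<dots> \<le> (\<Sum>k\<in>{1..N}. 2 * 8 ^ ?n * \<kappa> k y)"
      proof (rule sum_mono)
        fix k assume k: "k \<in> {1..N}"
        let ?R = "2 ^ k * A"
        have R: "?R > 0" using A0 by simp
        show "norm (ring_grad ?R y) ^ ?n \<le> 2 * 8 ^ ?n * \<kappa> k y"
        proof (cases "ring_grad ?R y = 0")
          case True
          then show ?thesis using \<kappa>pos[OF k] n1 by (simp add: power_0_left)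
        next
          case False
          have "norm y < ?R" using ring_step(5)[OF R False] by simp
          then have "1 / (2 * (2 * ?R) ^ ?n) \<le> \<kappa> k y" using bspec[OF \<kappa> k] by (simp add: degree_weight_def)
          then have "2 * 8 ^ ?n * (1 / (2 * (2 * ?R) ^ ?n)) \<le> 2 * 8 ^ ?n * \<kappa> k y" by (intro mult_left_mono) auto
          moreover have "2 * 8 ^ ?n * (1 / (2 * (2 * ?R) ^ ?n)) = (4 / ?R) ^ ?n"
          proof -
            have "8 ^ ?n / (2 * ?R) ^ ?n = (8 / (2 * ?R)) ^ ?n" by (rule power_divide[symmetric])
            also have "8 / (2 * ?R) = 4 / ?R" by simp
            finally show ?thesis by simp
          qed
          moreover have "norm (ring_grad ?R y) ^ ?n \<le> (4 / ?R) ^ ?n" by (intro power_mono ring_step(6)[OF R]) auto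
          ultimately show ?thesis by linarith
        qed
      qed
      finally show ?thesis .
    qed
    let ?J = "\<lambda>k z. indicator ?Q z * (\<kappa> k (f z) * det (D z)) :: real"
    have iJ: "integrable lborel (?J k)" "(LINT z|lborel. ?J k z) \<le> C" if "k \<in> {1..N}" for k
      using bspec[OF \<kappa> that] by (auto simp: degree_weight_def)
    have iS: "integrable lborel (\<lambda>z. \<Sum>k\<in>{1..N}. ?k2 * (real ?n ^ 2 * K) * (2 * 8 ^ ?n) * ?J k z)"
      by (intro Bochner_Integration.integrable_sum integrable_mult_right iJ)
    have "(LINT x|lborel. indicator ?Q x * (\<kappa>0 (f x) * F (D x))) \<le> (LINT z|lborel. (\<Sum>k\<in>{1..N}. ?k2 * (real ?n ^ 2 * K) * (2 * 8 ^ ?n) * ?J k z))"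
    proof (rule integral_mono_AE[OF lim(1) iS])
      show "AE x in lborel. indicator ?Q x * (\<kappa>0 (f x) * F (D x)) \<le> (\<Sum>k\<in>{1..N}. ?k2 * (real ?n ^ 2 * K) * (2 * 8 ^ ?n) * ?J k x)"
        using quasiregular_data_AE_det[OF q]
      proof eventually_elim
        case (elim x)
        have d0: "0 \<le> det (D x)" using elim by simp
        have "F (D x) \<le> ?k2 * (\<Sum>i\<in>UNIV. \<Sum>j\<in>UNIV. \<bar>D x$i$j\<bar> ^ ?n)" using Fb[of "D x"] by linarith
        also have "\<dots> \<le> ?k2 * (\<Sum>i\<in>(UNIV::'n set). \<Sum>j\<in>(UNIV::'n set). K * det (D x))"
          using elim by (intro mult_left_mono sum_mono) auto
        also have "\<dots> = ?k2 * (real ?n ^ 2 * K) * det (D x)" by (simp add: power2_eq_square)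
        finally have FD: "F (D x) \<le> ?k2 * (real ?n ^ 2 * K) * det (D x)" .
        have "\<kappa>0 (f x) * F (D x) \<le> (\<Sum>k\<in>{1..N}. 2 * 8 ^ ?n * \<kappa> k (f x)) * (?k2 * (real ?n ^ 2 * K) * det (D x))"
          using \<kappa>0b FD F0 \<kappa>pos by (intro mult_mono) (auto intro!: sum_nonneg)
        also have "\<dots> = (\<Sum>k\<in>{1..N}. ?k2 * (real ?n ^ 2 * K) * (2 * 8 ^ ?n) * (\<kappa> k (f x) * det (D x)))"
          unfolding sum_distrib_right by (intro sum.cong refl) (simp only: mult_ac)
        finally show ?case by (cases "x \<in> ?Q") auto
      qed
    qed
    also have "\<dots> = (\<Sum>k\<in>{1..N}. ?k2 * (real ?n ^ 2 * K) * (2 * 8 ^ ?n) * (LINT z|lborel. ?J k z))"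
      by (subst Bochner_Integration.integral_sum) (intro integrable_mult_right iJ, simp_all)
    also have "\<dots> \<le> (\<Sum>k\<in>{1..N}. ?k2 * (real ?n ^ 2 * K) * (2 * 8 ^ ?n) * C)"
      using K by (intro sum_mono mult_left_mono iJ) auto
    also have "\<dots> = ?E * real N" by simp
    finally show ?thesis .
  qed
  have lip: "\<bar>?u y - ?u z\<bar> \<le> real N * (4 / A) * norm (y - z)" for y z :: "real^'n"
  proof -
    have "norm (?u y - ?u z) \<le> real N * (4 / A) * norm (y - z)"
    proof (rule differentiable_bound[OF convex_UNIV])
      show "(?u has_derivative (\<lambda>h. ?du x \<bullet> h)) (at x within UNIV)" for x using lp(1) by simp
      show "onorm (\<lambda>h. ?du x \<bullet> h) \<le> real N * (4 / A)" for x
      proof (rule onorm_le)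
        fix h
        have "norm (?du x \<bullet> h) \<le> norm (?du x) * norm h" by (simp add: Cauchy_Schwarz_ineq2)
        also have "\<dots> \<le> real N * (4 / A) * norm h" by (intro mult_right_mono lp(5)) simp
        finally show "norm (?du x \<bullet> h) \<le> real N * (4 / A) * norm h" .
      qed
    qed auto
    then show ?thesis by simp
  qed
  \<comment> \<open>Approximation within \<open>\<delta>\<close> changes the profile by at most \<open>1/4\<close> at each point, so at least \<open>N - 1/2 \<ge> N / 2\<close> of the oscillation survives.\<close>
  define \<delta> where "\<delta> = 1 / (4 * (real N * (4 / A)))"
  have \<delta>: "\<delta> > 0" using False A0 by (simp add: \<delta>_def)
  have \<delta>N: "real N * (4 / A) * \<delta> = 1 / 4" using False A0 by (simp add: \<delta>_def)
  have "\<forall>\<^sub>F k in sequentially. \<forall>x\<in>?Q. dist (g k x) (f x) < \<delta>" by (rule uniform_limitD[OF unif \<delta>])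
  then have ev: "\<forall>\<^sub>F k in sequentially. (\<rho>2 - (S - 1) * s) * (real N / 2) ^ ?n \<le> ?k1 * \<rho>2 * (LINT x|lborel. indicator ?Q x * (\<kappa>0 (g k x) * F (G k x)))"
  proof eventually_elim
    case (elim k)
    define d where "d x = ?du (g k x) v* G k x" for x
    have der: "((\<lambda>x. ?u (g k x)) has_derivative (\<lambda>h. d x \<bullet> h)) (at x)" for x
      using has_derivative_compose[OF C1_withD(1)[OF C1] lp(1)] by (simp add: d_def dot_lmul_matrix)
    have cg: "continuous_on UNIV (g k)" and cG: "continuous_on UNIV (G k)" using C1_withD[OF C1] by auto
    have cdu: "continuous_on UNIV (\<lambda>x. ?du (g k x))" by (rule continuous_on_compose2[OF lp(2) cg]) auto
    have cd: "continuous_on UNIV d"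
      unfolding d_def vector_matrix_mult_def by (intro continuous_intros cdu cG)
    have \<rho>12: "0 < (S - 1) * s" "(S - 1) * s \<le> \<rho>2" using S s(1) by (simp_all add: \<rho>2_def)
    have osc: "\<exists>p\<in>frontier (cube x0 \<rho>). \<exists>q\<in>frontier (cube x0 \<rho>). real N / 2 \<le> \<bar>?u (g k p) - ?u (g k q)\<bar>"
      if \<rho>: "(S - 1) * s \<le> \<rho>" "\<rho> \<le> \<rho>2" for \<rho>
    proof -
      obtain z where z: "z \<in> frontier (cube x0 \<rho>)" "norm z = r" using s(2) \<rho> unfolding \<rho>2_def by blast
      have "0 \<le> \<rho>" using \<rho>(1) \<rho>12(1) by linarith
      then have "x0 \<in> cube x0 \<rho>" by (simp add: mem_cube)
      then obtain p where p: "p \<in> frontier (cube x0 \<rho>)" "norm (f x0) \<le> norm (f p)"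
        using quasiregular_maximum_principle[OF q] unfolding cube_def by blast
      have fr: "frontier (cube x0 \<rho>) \<subseteq> ?Q"
        using cube_mono[OF \<rho>(2), of x0] by (auto simp: cube_def frontier_cbox)
      have close: "\<bar>?u (g k y) - ?u (f y)\<bar> \<le> 1 / 4" if "y \<in> ?Q" for y
      proof -
        have "\<bar>?u (g k y) - ?u (f y)\<bar> \<le> real N * (4 / A) * norm (g k y - f y)" by (rule lip)
        also have "\<dots> \<le> real N * (4 / A) * \<delta>" using elim that A0 by (intro mult_left_mono) (auto simp: dist_norm less_imp_le)
        finally show ?thesis unfolding \<delta>N .
      qed
      have "?u (f p) = real N" by (rule lp(4)) (use p x0 in linarith)
      moreover have "?u (f z) = 0" by (rule lp(3)) (use A z in simp)
      moreover have "real N \<ge> 1" using False by simp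
      moreover have "\<bar>?u (g k p) - ?u (f p)\<bar> \<le> 1 / 4" "\<bar>?u (g k z) - ?u (f z)\<bar> \<le> 1 / 4" using close fr p z by blast+
      ultimately have "real N / 2 \<le> \<bar>?u (g k p) - ?u (g k z)\<bar>" by linarith
      then show ?thesis using p(1) z(1) by blast
    qed
    have "(\<rho>2 - (S - 1) * s) * (real N / 2) ^ ?n \<le> ?k1 * \<rho>2 * integral ?Q (\<lambda>z. norm (d z) ^ ?n)"
      using loewner_cubes[OF n2 der cd \<rho>12 _ osc] by (simp add: mult.assoc)
    also have "\<dots> \<le> ?k1 * \<rho>2 * integral ?Q (\<lambda>x. \<kappa>0 (g k x) * F (G k x))"
    proof (rule mult_left_mono)
      show "integral ?Q (\<lambda>z. norm (d z) ^ ?n) \<le> integral ?Q (\<lambda>x. \<kappa>0 (g k x) * F (G k x))"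
        unfolding cube_def
      proof (rule integral_le)
        show "(\<lambda>z. norm (d z) ^ ?n) integrable_on cbox a b" for a b
          by (intro integrable_continuous continuous_intros continuous_on_subset[OF cd]) auto
        show "(\<lambda>x. \<kappa>0 (g k x) * F (G k x)) integrable_on cbox a b" for a b
          by (intro integrable_continuous continuous_intros continuous_on_compose2[OF c\<kappa>] continuous_on_compose2[OF cF]
              continuous_on_subset[OF cg] continuous_on_subset[OF cG]) auto
        fix x
        have "norm (d x) ^ ?n \<le> (norm (?du (g k x)) * entry_sum (G k x)) ^ ?n"
          unfolding d_def by (intro power_mono norm_vector_matrix_mult_le) simp
        then show "norm (d x) ^ ?n \<le> \<kappa>0 (g k x) * F (G k x)" by (simp add: \<kappa>0_def F_def power_mult_distrib)
      qed
    qed (use \<rho>12 in auto)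
    also have "integral ?Q (\<lambda>x. \<kappa>0 (g k x) * F (G k x)) = (LINT x|lborel. indicator ?Q x * (\<kappa>0 (g k x) * F (G k x)))"
      unfolding cube_def
      by (intro integral_cbox_eq_LINT continuous_intros continuous_on_compose2[OF c\<kappa> cg] continuous_on_compose2[OF cF cG]) auto
    finally show ?case .
  qed
  have "(\<rho>2 - (S - 1) * s) * (real N / 2) ^ ?n \<le> ?k1 * \<rho>2 * (LINT x|lborel. indicator ?Q x * (\<kappa>0 (f x) * F (D x)))"
    by (rule tendsto_lowerbound[OF tendsto_mult_left[OF lim(2)] ev]) simp
  also have "\<dots> \<le> ?k1 * \<rho>2 * (?E * real N)"
    using S s(1) by (intro mult_left_mono energy) (auto simp: \<rho>2_def)
  finally have "2 * s * (real N / 2) ^ ?n \<le> s * (?k1 * (S + 1) * (?E * real N))"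
    by (simp add: \<rho>2_def algebra_simps)
  then have "2 * (real N / 2) ^ ?n \<le> ?k1 * (S + 1) * (?E * real N)" using s(1) by (simp add: mult.left_commute)
  moreover have "(real N / 2) ^ ?n = real N ^ ?n / 2 ^ ?n" by (rule power_divide)
  moreover have "0 \<le> real N ^ ?n / 2 ^ ?n" by simp
  ultimately have "real N ^ ?n / 2 ^ ?n \<le> ?k1 * (S + 1) * (?E * real N)" by linarith
  then have up: "real N ^ ?n \<le> 2 ^ ?n * (?k1 * (S + 1)) * ?E * real N" by (simp add: pos_divide_le_eq mult_ac)
  have "real N ^ 2 \<le> real N ^ ?n" using False n2 by (intro power_increasing) auto
  with up have "real N * real N \<le> (2 ^ ?n * (?k1 * (S + 1)) * ?E) * real N" unfolding power2_eq_square by linarith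
  moreover have "real N > 0" using False by simp
  ultimately show ?thesis unfolding growth_constant_def by (rule mult_right_le_imp_le)
qed

theorem theorem1p3:
  fixes f :: "real^'n::finite \<Rightarrow> real^'n" and S :: real
  assumes "CARD('n) \<ge> 2"
    and "quasiregular f"
    and "polynomial_type f"
    and "S > 1"
  shows "Limsup at_top (\<lambda>r. ereal (max_modulus (S * r) f / max_modulus r f)) < \<infinity>"
proof -
  obtain K D where q: "quasiregular_data f K D" by (rule quasiregular_data_exists[OF assms(2)])
  have inf: "filterlim (\<lambda>x. norm (f x)) at_top at_infinity" using assms(3) by (simp add: polynomial_type_def)
  have cf: "continuous_on UNIV f" using assms(2) by (simp add: quasiregular_def)
  obtain C where C: "C \<ge> 0" "\<forall>R\<ge>1. \<exists>\<kappa>. degree_weight f D C R \<kappa>"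
    using degree_energy_bound[OF q inf] by blast
  define B where "B = growth_constant CARD('n) S K C"
  have "\<forall>\<^sub>F x in at_infinity. norm (f x) > 1" using inf by (simp add: filterlim_at_top_dense)
  then obtain L where L: "\<And>x. norm x \<ge> L \<Longrightarrow> norm (f x) > 1" by (auto simp: eventually_at_infinity)
  have att: "\<exists>x. norm x = r \<and> norm (f x) = max_modulus r f" and le: "\<And>x. norm x = r \<Longrightarrow> norm (f x) \<le> max_modulus r f" if r: "r > 0" for r
  proof -
    have cn: "continuous_on (sphere 0 r) (\<lambda>x. norm (f x))" by (intro continuous_intros continuous_on_subset[OF cf]) auto
    have ne: "sphere (0 :: real^'n) r \<noteq> {}" using r by simp
    obtain x where x: "x \<in> sphere 0 r" "\<forall>y\<in>sphere 0 r. norm (f y) \<le> norm (f x)"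
      using continuous_attains_sup[OF compact_sphere ne cn] by blast
    have "max_modulus r f = norm (f x)"
      unfolding max_modulus_def by (rule cSup_eq_maximum) (use x in auto)
    with x show "\<exists>x. norm x = r \<and> norm (f x) = max_modulus r f" "\<And>x. norm x = r \<Longrightarrow> norm (f x) \<le> max_modulus r f" by auto
  qed
  have ratio: "max_modulus (S * r) f / max_modulus r f \<le> 2 powr (B + 1)" if r: "r \<ge> max 1 L" for r
  proof -
    have r0: "r > 0" using r by simp
    have Sr0: "S * r > 0" using assms(4) r0 by simp
    obtain x1 where "norm x1 = r" "norm (f x1) = max_modulus r f" using att[OF r0] by blast
    then have A1: "max_modulus r f \<ge> 1" using L[of x1] r by simp
    obtain x0 where x0: "norm x0 = S * r" "norm (f x0) = max_modulus (S * r) f" using att[OF Sr0] by blast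
    let ?q = "max_modulus (S * r) f / max_modulus r f"
    show ?thesis
    proof (cases "?q < 1")
      case True
      have "B \<ge> 0" unfolding B_def using C(1) q assms(4) by (intro growth_constant_nonneg) (auto simp: quasiregular_data_def)
      then have "1 \<le> 2 powr (B + 1)" by (intro ge_one_powr_ge_zero) auto
      with True show ?thesis by linarith
    next
      case False
      \<comment> \<open>The largest \<open>N\<close> with \<open>2\<^sup>N M(r,f) \<le> M(Sr,f)\<close>.\<close>
      define N where "N = nat \<lfloor>log 2 ?q\<rfloor>"
      have l0: "log 2 ?q \<ge> 0" using False by (simp add: zero_le_log_cancel_iff)
      have N: "real N \<le> log 2 ?q" "log 2 ?q < real N + 1" unfolding N_def using l0 by linarith+
      have qpos: "?q > 0" using False by linarith
      have "2 powr real N \<le> ?q" using N(1) qpos by (subst (asm) le_log_iff) auto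
      then have "2 ^ N * max_modulus r f \<le> max_modulus (S * r) f"
        using A1 by (simp add: powr_realpow le_divide_eq)
      then have "2 ^ N * max_modulus r f \<le> norm (f x0)" using x0 by simp
      from growth_exponent_bound[OF assms(1) q assms(4) C r0 A1 le[OF r0] x0(1) this]
      have "real N \<le> B" by (simp add: B_def)
      then have "log 2 ?q \<le> B + 1" using N(2) by linarith
      then show ?thesis using qpos by (subst (asm) log_le_iff) auto
    qed
  qed
  have "Limsup at_top (\<lambda>r. ereal (max_modulus (S * r) f / max_modulus r f)) \<le> ereal (2 powr (B + 1))"
  proof (rule Limsup_bounded)
    show "\<forall>\<^sub>F r in at_top. ereal (max_modulus (S * r) f / max_modulus r f) \<le> ereal (2 powr (B + 1))"
      using eventually_ge_at_top[of "max 1 L"] by eventually_elim (use ratio in simp)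
  qed
  also have "\<dots> < \<infinity>" by simp
  finally show ?thesis .
qed

end
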